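(* Let $n\in\mathbb{N}\cup\{\infty\}$ and let $f\colon(L,\ell)\to(L',\ell')$ be a fibration between Lie $n$-algebras. Then there exists a Lie $n$-algebra $(L,\tilde\ell)$ (on the same underlying graded vector space $L$) and an isomorphism $\phi\colon(L,\tilde\ell)\xrightarrow{\cong}(L,\ell)$ such that $$f\phi\colon(L,\tilde\ell)\to(L',\ell')$$ is a strict fibration with $f\phi=(f\phi)_1=f_1$.
   Context: Conventions: $\Bbbk$ is a field of characteristic zero and gradings are homological. For a $\mathbb{Z}$-graded vector space $V$, $\mathbf{s}V$ denotes the suspension, $(\mathbf{s}V)_i = V_{i-1}$, and $\bar S(V)=\bigoplus_{k\ge 1}S^k(V)$ is the reduced symmetric coalgebra, with $\bar\Delta(v_1\vee\cdots\vee v_m)=\sum_{p=1}^{m-1}\sum_{\sigma}\epsilon(\sigma)(v_{\sigma(1)}\vee\cdots\vee v_{\sigma(p)})\otimes(v_{\sigma(p+1)}\vee\cdots\vee v_{\sigma(m)})$, the inner sum over $(p,m-p)$-shuffles and $\epsilon(\sigma)$ the Koszul sign. Coderivations of, and coalgebra morphisms between, such coalgebras are uniquely determined by their components $\bar S(V)\to V$, resp. $\bar S(V)\to V'$. An $L_\infty$-algebra $(L,\ell)$ is a $\mathbb{Z}$-graded vector space $L$ with graded skew-symmetric maps $\ell_k\colon \Lambda^kL\to L$ of degree $k-2$ ($k\ge 1$) such that the degree $-1$ coderivation $\delta$ of $\bar S(\mathbf{s}L)$ with components $\delta^1_k=(-1)^{k(k-1)/2}\,\mathbf{s}\circ\ell_k\circ(\mathbf{s}^{-1})^{\otimes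 k}\colon S^k(\mathbf{s}L)\to \mathbf{s}L$ satisfies $\delta^2=0$. In particular $(L,\ell_1)$ is a chain complex. A (weak) $L_\infty$-morphism $f\colon(L,\ell)\to(L',\ell')$ is a collection of graded skew-symmetric maps $f_k\colon\Lambda^kL\to L'$ of degree $k-1$ ($k\ge1$) such that the coalgebra morphism $F\colon\bar S(\mathbf{s}L)\to\bar S(\mathbf{s}L')$ with components $F^1_k=(-1)^{k(k-1)/2}\,\mathbf{s}\circ f_k\circ(\mathbf{s}^{-1})^{\otimes k}$ satisfies $F\delta=\delta'F$. Composition is composition of the corresponding coalgebra morphisms; $f_1$ is always a chain map. The morphism $f$ is strict if $f_k=0$ for all $k\ge2$ (and one then writes $f=f_1$), and an isomorphism if $f_1$ is an isomorphism of chain complexes (equivalently, $F$ is an isomorphism of dg coalgebras). A Lie $n$-algebra is an $L_\infty$-algebra whose underlying graded vector space is concentrated in degrees $0,1,\dots,n-1$ (in all degrees $\geq 0$ if $n=\infty$); morphisms are weak $L_\infty$-morphisms. A morphism $f$ of Lie $n$-algebras is a fibration if $f_1$ is surjective in all positive degrees. *)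

theory Defs
  imports
    "HOL-Library.Poly_Mapping"
    "HOL-Library.Extended_Nat"
    "HOL-Combinatorics.Permutations"
begin

section \<open>Graded vector spaces\<close>

text \<open>A graded vector space is a family \<open>V :: int \<Rightarrow> 'v set\<close> of subspaces of an ambient vector
  space with scalar multiplication \<open>sc\<close>.  The pieces are not required to be independent inside
  the ambient space: homogeneous elements always carry their degree, as pairs \<open>(i, v)\<close> with
  \<open>v \<in> V i\<close>.\<close>

definition graded_vs :: "('k::field \<Rightarrow> 'v::ab_group_add \<Rightarrow> 'v) \<Rightarrow> (int \<Rightarrow> 'v set) \<Rightarrow> bool"
  where "graded_vs sc V \<longleftrightarrow> vector_space sc \<and> (\<forall>i. module.subspace sc (V i))"

definition susp :: "(int \<Rightarrow> 'v set) \<Rightarrow> int \<Rightarrow> 'v set"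
  where "susp V i = V (i - 1)"

type_synonym 'v word = "(int \<times> 'v) list"

definition wdeg :: "'v word \<Rightarrow> int"
  where "wdeg w = sum_list (map fst w)"

definition hlists :: "(int \<Rightarrow> 'v set) \<Rightarrow> 'v word set"
  where "hlists V = {w. \<forall>(i, v) \<in> set w. v \<in> V i}"

definition words :: "(int \<Rightarrow> 'v set) \<Rightarrow> 'v word set"
  where "words V = {w \<in> hlists V. w \<noteq> []}"

text \<open>A family of graded skew-symmetric maps \<open>\<Lambda>\<^sup>k V \<rightarrow> V'\<close>, \<open>k \<ge> 1\<close>, of degree \<open>e k\<close> is a function
  \<open>q\<close> on nonempty words; its \<open>k\<close>-th member is the restriction of \<open>q\<close> to words of length \<open>k\<close>.\<close>

definition skew_maps ::
  "('k::field \<Rightarrow> 'v::ab_group_add \<Rightarrow> 'v) \<Rightarrow> (int \<Rightarrow> 'v set) \<Rightarrow>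
   ('k \<Rightarrow> 'w::ab_group_add \<Rightarrow> 'w) \<Rightarrow> (int \<Rightarrow> 'w set) \<Rightarrow> (nat \<Rightarrow> int) \<Rightarrow> ('v word \<Rightarrow> 'w) \<Rightarrow> bool"
  where "skew_maps sc V sc' V' e q \<longleftrightarrow>
    (\<forall>w \<in> words V. q w \<in> V' (wdeg w + e (length w))) \<and>
    (\<forall>xs \<in> hlists V. \<forall>ys \<in> hlists V. \<forall>i. \<forall>a \<in> V i. \<forall>b \<in> V i.
       q (xs @ (i, a + b) # ys) = q (xs @ (i, a) # ys) + q (xs @ (i, b) # ys)) \<and>
    (\<forall>xs \<in> hlists V. \<forall>ys \<in> hlists V. \<forall>i. \<forall>a \<in> V i. \<forall>c.
       q (xs @ (i, sc c a) # ys) = sc' c (q (xs @ (i, a) # ys))) \<and>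
    (\<forall>xs \<in> hlists V. \<forall>ys \<in> hlists V. \<forall>i j. \<forall>a \<in> V i. \<forall>b \<in> V j.
       q (xs @ (i, a) # (j, b) # ys) =
         sc' (- ((-1) powi (i * j))) (q (xs @ (j, b) # (i, a) # ys)))"


section \<open>The reduced symmetric coalgebra\<close>

definition fscale :: "'k::field \<Rightarrow> ('a \<Rightarrow>\<^sub>0 'k) \<Rightarrow> ('a \<Rightarrow>\<^sub>0 'k)"
  where "fscale c p = Poly_Mapping.map ((*) c) p"

lemma lookup_fscale: "Poly_Mapping.lookup (fscale c p) a = c * Poly_Mapping.lookup p a"
  by (simp add: fscale_def Poly_Mapping.map.rep_eq when_def)

lemma vector_space_fscale: "vector_space (fscale :: 'k::field \<Rightarrow> ('a \<Rightarrow>\<^sub>0 'k) \<Rightarrow> _)"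
  by unfold_locales
    (auto intro!: poly_mapping_eqI simp: lookup_fscale lookup_add algebra_simps)

abbreviation gen :: "'a \<Rightarrow> ('a \<Rightarrow>\<^sub>0 'k::field)"
  where "gen a \<equiv> Poly_Mapping.single a 1"

abbreviation fspan :: "('a \<Rightarrow>\<^sub>0 'k::field) set \<Rightarrow> ('a \<Rightarrow>\<^sub>0 'k) set"
  where "fspan \<equiv> module.span fscale"

definition lin_extend :: "('a \<Rightarrow> ('b \<Rightarrow>\<^sub>0 'k::field)) \<Rightarrow> ('a \<Rightarrow>\<^sub>0 'k) \<Rightarrow> ('b \<Rightarrow>\<^sub>0 'k)"
  where "lin_extend g x =
    (\<Sum>a \<in> Poly_Mapping.keys x. fscale (Poly_Mapping.lookup x a) (g a))"

text \<open>The reduced symmetric coalgebra on \<open>V\<close> is the quotient of the free vector space \<open>free_sp V\<close>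
  on nonempty words by the subspace \<open>sym_rel sc V\<close> of multilinearity and graded symmetry
  relations; the class of \<open>gen [(i\<^sub>1, v\<^sub>1), \<dots>, (i\<^sub>m, v\<^sub>m)]\<close> is \<open>v\<^sub>1 \<or> \<dots> \<or> v\<^sub>m\<close>.  Linear maps between such
  quotients are represented by linear maps of the free spaces that preserve the relations, and
  equalities between them are stated modulo the relations.\<close>

definition free_sp :: "(int \<Rightarrow> 'v set) \<Rightarrow> ('v word \<Rightarrow>\<^sub>0 'k::field) set"
  where "free_sp V = fspan (gen ` words V)"

definition free_deg :: "(int \<Rightarrow> 'v set) \<Rightarrow> int \<Rightarrow> ('v word \<Rightarrow>\<^sub>0 'k::field) set"
  where "free_deg V d = fspan (gen ` {w \<in> words V. wdeg w = d})"

definition sym_rel ::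
  "('k::field \<Rightarrow> 'v::ab_group_add \<Rightarrow> 'v) \<Rightarrow> (int \<Rightarrow> 'v set) \<Rightarrow> ('v word \<Rightarrow>\<^sub>0 'k) set"
  where "sym_rel sc V = fspan
   ({gen (xs @ (i, a + b) # ys) - gen (xs @ (i, a) # ys) - gen (xs @ (i, b) # ys) | xs ys i a b.
       xs \<in> hlists V \<and> ys \<in> hlists V \<and> a \<in> V i \<and> b \<in> V i} \<union>
    {gen (xs @ (i, sc c a) # ys) - fscale c (gen (xs @ (i, a) # ys)) | xs ys i a c.
       xs \<in> hlists V \<and> ys \<in> hlists V \<and> a \<in> V i} \<union>
    {gen (xs @ (i, a) # (j, b) # ys) - fscale ((-1) powi (i * j)) (gen (xs @ (j, b) # (i, a) # ys))
       | xs ys i j a b.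
       xs \<in> hlists V \<and> ys \<in> hlists V \<and> a \<in> V i \<and> b \<in> V j})"

definition tens :: "('a \<Rightarrow>\<^sub>0 'k::field) \<Rightarrow> ('b \<Rightarrow>\<^sub>0 'k) \<Rightarrow> ('a \<times> 'b \<Rightarrow>\<^sub>0 'k)"
  where "tens x y = (\<Sum>a \<in> Poly_Mapping.keys x. \<Sum>b \<in> Poly_Mapping.keys y.
    Poly_Mapping.single (a, b) (Poly_Mapping.lookup x a * Poly_Mapping.lookup y b))"

text \<open>The tensor square of the quotient \<open>T / R\<close> is \<open>(T \<otimes> T) / (R \<otimes> T + T \<otimes> R)\<close>, and \<open>T \<otimes> T\<close> is free
  on pairs of words.\<close>

definition sym_rel2 ::
  "('k::field \<Rightarrow> 'v::ab_group_add \<Rightarrow> 'v) \<Rightarrow> (int \<Rightarrow> 'v set) \<Rightarrow> ('v word \<times> 'v word \<Rightarrow>\<^sub>0 'k) set"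
  where "sym_rel2 sc V = fspan
   ({tens r y | r y. r \<in> sym_rel sc V \<and> y \<in> free_sp V} \<union>
    {tens y r | r y. r \<in> sym_rel sc V \<and> y \<in> free_sp V})"

definition shuffle_perms :: "nat \<Rightarrow> nat \<Rightarrow> (nat \<Rightarrow> nat) set"
  where "shuffle_perms p m = {\<sigma>. \<sigma> permutes {..<m} \<and>
    strict_mono_on {..<p} \<sigma> \<and> strict_mono_on {p..<m} \<sigma>}"

definition koszul :: "'v word \<Rightarrow> (nat \<Rightarrow> nat) \<Rightarrow> 'k::field"
  where "koszul w \<sigma> = (\<Prod>(i, j) \<in> {(i, j). i < j \<and> j < length w \<and> \<sigma> j < \<sigma> i}.
    (-1) powi (fst (w ! \<sigma> i) * fst (w ! \<sigma> j)))"

definition coprod :: "('v word \<Rightarrow>\<^sub>0 'k::field) \<Rightarrow> ('v word \<times> 'v word \<Rightarrow>\<^sub>0 'k)"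
  where "coprod = lin_extend (\<lambda>w.
    \<Sum>p \<in> {1..<length w}. \<Sum>\<sigma> \<in> shuffle_perms p (length w).
      fscale (koszul w \<sigma>)
        (gen (map (\<lambda>i. w ! \<sigma> i) [0..<p], map (\<lambda>i. w ! \<sigma> i) [p..<length w])))"

definition sym_hom ::
  "('k::field \<Rightarrow> 'v::ab_group_add \<Rightarrow> 'v) \<Rightarrow> (int \<Rightarrow> 'v set) \<Rightarrow>
   ('k \<Rightarrow> 'w::ab_group_add \<Rightarrow> 'w) \<Rightarrow> (int \<Rightarrow> 'w set) \<Rightarrow> int \<Rightarrow>
   (('v word \<Rightarrow>\<^sub>0 'k) \<Rightarrow> ('w word \<Rightarrow>\<^sub>0 'k)) \<Rightarrow> bool"
  where "sym_hom sc V sc' V' e F \<longleftrightarrow>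
    Vector_Spaces.linear fscale fscale F \<and>
    (\<forall>d. \<forall>x \<in> free_deg V d. F x \<in> free_deg V' (d + e)) \<and>
    (\<forall>x \<in> sym_rel sc V. F x \<in> sym_rel sc' V')"

text \<open>\<open>tens_map e F G\<close> is \<open>F \<otimes> G\<close> for \<open>G\<close> of degree \<open>e\<close>, with the Koszul sign
  \<open>(F \<otimes> G) (x \<otimes> y) = (-1)\<^bsup>e |x|\<^esup> F x \<otimes> G y\<close>.\<close>

definition tens_map ::
  "int \<Rightarrow> (('v word \<Rightarrow>\<^sub>0 'k::field) \<Rightarrow> ('w word \<Rightarrow>\<^sub>0 'k)) \<Rightarrow>
   (('v word \<Rightarrow>\<^sub>0 'k) \<Rightarrow> ('w word \<Rightarrow>\<^sub>0 'k)) \<Rightarrow>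
   ('v word \<times> 'v word \<Rightarrow>\<^sub>0 'k) \<Rightarrow> ('w word \<times> 'w word \<Rightarrow>\<^sub>0 'k)"
  where "tens_map e F G = lin_extend (\<lambda>(u, w).
    fscale ((-1) powi (e * wdeg u)) (tens (F (gen u)) (G (gen w))))"

definition coalg_hom ::
  "('k::field \<Rightarrow> 'v::ab_group_add \<Rightarrow> 'v) \<Rightarrow> (int \<Rightarrow> 'v set) \<Rightarrow>
   ('k \<Rightarrow> 'w::ab_group_add \<Rightarrow> 'w) \<Rightarrow> (int \<Rightarrow> 'w set) \<Rightarrow>
   (('v word \<Rightarrow>\<^sub>0 'k) \<Rightarrow> ('w word \<Rightarrow>\<^sub>0 'k)) \<Rightarrow> bool"
  where "coalg_hom sc V sc' V' F \<longleftrightarrow>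
    sym_hom sc V sc' V' 0 F \<and>
    (\<forall>x \<in> free_sp V. coprod (F x) - tens_map 0 F F (coprod x) \<in> sym_rel2 sc' V')"

definition coderivation ::
  "('k::field \<Rightarrow> 'v::ab_group_add \<Rightarrow> 'v) \<Rightarrow> (int \<Rightarrow> 'v set) \<Rightarrow>
   (('v word \<Rightarrow>\<^sub>0 'k) \<Rightarrow> ('v word \<Rightarrow>\<^sub>0 'k)) \<Rightarrow> bool"
  where "coderivation sc V D \<longleftrightarrow>
    sym_hom sc V sc V (-1) D \<and>
    (\<forall>x \<in> free_sp V.
       coprod (D x) - (tens_map 0 D id (coprod x) + tens_map (-1) id D (coprod x))
         \<in> sym_rel2 sc V)"

text \<open>The projection onto the linear part.  It is only applied to homogeneous elements, so no
  vectors of different degrees get added.\<close>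

definition pr1 :: "('k::field \<Rightarrow> 'v::ab_group_add \<Rightarrow> 'v) \<Rightarrow> ('v word \<Rightarrow>\<^sub>0 'k) \<Rightarrow> 'v"
  where "pr1 sc x = (\<Sum>w \<in> Poly_Mapping.keys x.
    if length w = 1 then sc (Poly_Mapping.lookup x w) (snd (hd w)) else 0)"


section \<open>L-infinity algebras and their morphisms\<close>

text \<open>\<open>desusp_sign w\<close> is the Koszul sign produced by applying the \<open>k\<close>-th tensor power of the
  degree \<open>-1\<close> map \<open>s\<^sup>-\<^sup>1\<close> to a word: every letter is passed by one \<open>s\<^sup>-\<^sup>1\<close> for each letter to its
  right.\<close>

fun desusp_sign :: "'v word \<Rightarrow> 'k::field"
  where
    "desusp_sign [] = 1"
  | "desusp_sign ((i, v) # w) = (-1) powi (i * int (length w)) * desusp_sign w"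

text \<open>\<open>decalage sc' q w\<close> is \<open>(-1)\<^bsup>k(k-1)/2\<^esup> s (q\<^sub>k ((s\<^sup>-\<^sup>1)\<^bsup>\<otimes>k\<^esup> w))\<close> for a word \<open>w\<close> of length \<open>k\<close> in the
  suspension; on underlying vectors \<open>s\<close> is the identity.\<close>

definition decalage ::
  "('k::field \<Rightarrow> 'w::ab_group_add \<Rightarrow> 'w) \<Rightarrow> ('v word \<Rightarrow> 'w) \<Rightarrow> 'v word \<Rightarrow> 'w"
  where "decalage sc' q w =
    sc' ((-1) ^ (length w * (length w - 1) div 2) * desusp_sign w)
      (q (map (\<lambda>(i, v). (i - 1, v)) w))"

text \<open>\<open>coder_of sc L l D\<close>: \<open>D\<close> is the coderivation of the symmetric coalgebra on the suspension of
  \<open>L\<close> whose components are given by \<open>l\<close>; \<open>D\<close> is unique modulo the relations.  Similarly for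
  \<open>coalg_hom_of\<close>.\<close>

definition coder_of ::
  "('k::field \<Rightarrow> 'v::ab_group_add \<Rightarrow> 'v) \<Rightarrow> (int \<Rightarrow> 'v set) \<Rightarrow> ('v word \<Rightarrow> 'v) \<Rightarrow>
   (('v word \<Rightarrow>\<^sub>0 'k) \<Rightarrow> ('v word \<Rightarrow>\<^sub>0 'k)) \<Rightarrow> bool"
  where "coder_of sc L l D \<longleftrightarrow>
    coderivation sc (susp L) D \<and>
    (\<forall>w \<in> words (susp L). pr1 sc (D (gen w)) = decalage sc l w)"

definition coalg_hom_of ::
  "('k::field \<Rightarrow> 'v::ab_group_add \<Rightarrow> 'v) \<Rightarrow> (int \<Rightarrow> 'v set) \<Rightarrow>
   ('k \<Rightarrow> 'w::ab_group_add \<Rightarrow> 'w) \<Rightarrow> (int \<Rightarrow> 'w set) \<Rightarrow> ('v word \<Rightarrow> 'w) \<Rightarrow>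
   (('v word \<Rightarrow>\<^sub>0 'k) \<Rightarrow> ('w word \<Rightarrow>\<^sub>0 'k)) \<Rightarrow> bool"
  where "coalg_hom_of sc L sc' L' f F \<longleftrightarrow>
    coalg_hom sc (susp L) sc' (susp L') F \<and>
    (\<forall>w \<in> words (susp L). pr1 sc' (F (gen w)) = decalage sc' f w)"

definition Linf_algebra ::
  "('k::field_char_0 \<Rightarrow> 'v::ab_group_add \<Rightarrow> 'v) \<Rightarrow> (int \<Rightarrow> 'v set) \<Rightarrow> ('v word \<Rightarrow> 'v) \<Rightarrow> bool"
  where "Linf_algebra sc L l \<longleftrightarrow>
    graded_vs sc L \<and>
    skew_maps sc L sc L (\<lambda>k. int k - 2) l \<and>
    (\<exists>D. coder_of sc L l D \<and> (\<forall>x \<in> free_sp (susp L). D (D x) \<in> sym_rel sc (susp L)))"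

definition Linf_morphism ::
  "('k::field_char_0 \<Rightarrow> 'v::ab_group_add \<Rightarrow> 'v) \<Rightarrow> (int \<Rightarrow> 'v set) \<Rightarrow> ('v word \<Rightarrow> 'v) \<Rightarrow>
   ('k \<Rightarrow> 'w::ab_group_add \<Rightarrow> 'w) \<Rightarrow> (int \<Rightarrow> 'w set) \<Rightarrow> ('w word \<Rightarrow> 'w) \<Rightarrow> ('v word \<Rightarrow> 'w) \<Rightarrow> bool"
  where "Linf_morphism sc L l sc' L' l' f \<longleftrightarrow>
    Linf_algebra sc L l \<and> Linf_algebra sc' L' l' \<and>
    skew_maps sc L sc' L' (\<lambda>k. int k - 1) f \<and>
    (\<exists>D D' F. coder_of sc L l D \<and> coder_of sc' L' l' D' \<and> coalg_hom_of sc L sc' L' f F \<and>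
       (\<forall>x \<in> free_sp (susp L). F (D x) - D' (F x) \<in> sym_rel sc' (susp L')))"

text \<open>\<open>h\<close> is the composite of \<open>g : L \<rightarrow> L'\<close> followed by \<open>f : L' \<rightarrow> L''\<close>.\<close>

definition Linf_composite ::
  "('k::field_char_0 \<Rightarrow> 'u::ab_group_add \<Rightarrow> 'u) \<Rightarrow> (int \<Rightarrow> 'u set) \<Rightarrow>
   ('k \<Rightarrow> 'v::ab_group_add \<Rightarrow> 'v) \<Rightarrow> (int \<Rightarrow> 'v set) \<Rightarrow>
   ('k \<Rightarrow> 'w::ab_group_add \<Rightarrow> 'w) \<Rightarrow> (int \<Rightarrow> 'w set) \<Rightarrow>
   ('v word \<Rightarrow> 'w) \<Rightarrow> ('u word \<Rightarrow> 'v) \<Rightarrow> ('u word \<Rightarrow> 'w) \<Rightarrow> bool"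
  where "Linf_composite sc L sc' L' sc'' L'' f g h \<longleftrightarrow>
    (\<exists>F G. coalg_hom_of sc' L' sc'' L'' f F \<and> coalg_hom_of sc L sc' L' g G \<and>
       coalg_hom_of sc L sc'' L'' h (F \<circ> G))"

definition strict :: "(int \<Rightarrow> 'v set) \<Rightarrow> ('v word \<Rightarrow> 'w::zero) \<Rightarrow> bool"
  where "strict L f \<longleftrightarrow> (\<forall>w \<in> words L. length w \<ge> 2 \<longrightarrow> f w = 0)"

definition Linf_isomorphism ::
  "('k::field_char_0 \<Rightarrow> 'v::ab_group_add \<Rightarrow> 'v) \<Rightarrow> (int \<Rightarrow> 'v set) \<Rightarrow> ('v word \<Rightarrow> 'v) \<Rightarrow>
   ('k \<Rightarrow> 'w::ab_group_add \<Rightarrow> 'w) \<Rightarrow> (int \<Rightarrow> 'w set) \<Rightarrow> ('w word \<Rightarrow> 'w) \<Rightarrow> ('v word \<Rightarrow> 'w) \<Rightarrow> bool"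
  where "Linf_isomorphism sc L l sc' L' l' f \<longleftrightarrow>
    Linf_morphism sc L l sc' L' l' f \<and>
    (\<forall>i. \<forall>x \<in> L i. f [(i - 1, l [(i, x)])] = l' [(i, f [(i, x)])]) \<and>
    (\<forall>i. bij_betw (\<lambda>x. f [(i, x)]) (L i) (L' i))"

definition Lie_n_algebra ::
  "enat \<Rightarrow> ('k::field_char_0 \<Rightarrow> 'v::ab_group_add \<Rightarrow> 'v) \<Rightarrow> (int \<Rightarrow> 'v set) \<Rightarrow> ('v word \<Rightarrow> 'v) \<Rightarrow> bool"
  where "Lie_n_algebra n sc L l \<longleftrightarrow>
    Linf_algebra sc L l \<and> (\<forall>i. \<not> (0 \<le> i \<and> enat (nat i) < n) \<longrightarrow> L i = {0})"

definition Lie_n_fibration ::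
  "enat \<Rightarrow> ('k::field_char_0 \<Rightarrow> 'v::ab_group_add \<Rightarrow> 'v) \<Rightarrow> (int \<Rightarrow> 'v set) \<Rightarrow> ('v word \<Rightarrow> 'v) \<Rightarrow>
   ('k \<Rightarrow> 'w::ab_group_add \<Rightarrow> 'w) \<Rightarrow> (int \<Rightarrow> 'w set) \<Rightarrow> ('w word \<Rightarrow> 'w) \<Rightarrow> ('v word \<Rightarrow> 'w) \<Rightarrow> bool"
  where "Lie_n_fibration n sc L l sc' L' l' f \<longleftrightarrow>
    Lie_n_algebra n sc L l \<and> Lie_n_algebra n sc' L' l' \<and>
    Linf_morphism sc L l sc' L' l' f \<and>
    (\<forall>i > 0. (\<lambda>x. f [(i, x)]) ` L i = L' i)"

end

theory Submission
  imports Defs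
begin

text \<open>
  Since \<open>L\<close> lives in degrees \<open>\<ge> 0\<close>, the maps \<open>f\<^sub>k\<close> with \<open>k \<ge> 2\<close> take values in positive degrees, where
  \<open>f\<^sub>1\<close> has a linear section \<open>\<sigma>\<close>.  Let \<open>\<Psi>\<close> be the endomorphism of the coalgebra on \<open>sL\<close> with components
  \<open>\<Psi>\<^sub>1 = id\<close> and \<open>\<Psi>\<^sub>k = \<sigma> F\<^sub>k\<close> for \<open>k \<ge> 2\<close>.  Then \<open>S(f\<^sub>1) \<Psi>\<close> and \<open>F\<close> have the same components, hence
  agree, and \<open>\<Psi>\<close> is invertible because it is unipotent for the filtration by word length.  So
  \<open>\<Phi> = \<Psi>\<^sup>-\<^sup>1\<close> satisfies \<open>F \<Phi> = S(f\<^sub>1)\<close>, and the differential \<open>\<delta>\<close> is transported to \<open>\<Psi> \<delta> \<Phi>\<close>.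

  All uniqueness statements come from one fact: multiplying out the reduced coproduct acts on \<open>S\<^sup>m\<close> as
  \<open>2\<^sup>m - 2\<close>, so in characteristic zero an element with vanishing reduced coproduct lies in \<open>S\<^sup>1\<close>.  The
  same fact shows that the coalgebra map defined on words by its components respects the symmetry
  relations.
\<close>

section \<open>Linear maps between free spaces\<close>

text \<open>Three points shape the argument. The extension of given components to a coalgebra map is
  a sum over set partitions that singles out the first letter, so its symmetry is not visible. It is
  not checked by hand: the coproduct of a relation of length \<open>m\<close> is built from shorter
  relations, and by induction on \<open>m\<close> the kernel of the reduced coproduct forces the
  image into the relations. The number \<open>2^m - 2\<close> counts the splittings of
  \<open>m\<close> letters into two nonempty parts: multiplying the parts back together undoes each
  Koszul sign, so every splitting contributes the same class. Finally, \<open>\<Psi>\<close> is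
  inverted on the free space of words, before passing to the quotient: there \<open>\<Phi>\<close>
  and \<open>\<Psi>\<close> are inverse to each other exactly, while most other identities hold only
  modulo the relations. The price is that \<open>\<Phi>\<close> must be shown to respect degrees and
  relations, which follows from the recursion
  \<open>\<Phi> x = x - \<Phi> (\<Psi> x - x)\<close>.\<close>

interpretation fs: vector_space "fscale :: 'k::field \<Rightarrow> ('a \<Rightarrow>\<^sub>0 'k) \<Rightarrow> _"
  by (rule vector_space_fscale)

interpretation fp: vector_space_pair "fscale :: 'k::field \<Rightarrow> ('a \<Rightarrow>\<^sub>0 'k) \<Rightarrow> _"
    "fscale :: 'k::field \<Rightarrow> ('b \<Rightarrow>\<^sub>0 'k) \<Rightarrow> _" ..

abbreviation flinear :: "(('a \<Rightarrow>\<^sub>0 'k::field) \<Rightarrow> ('b \<Rightarrow>\<^sub>0 'k)) \<Rightarrow> bool"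
  where "flinear \<equiv> Vector_Spaces.linear fscale fscale"

lemma flinearI:
  assumes "\<And>x y. h (x + y) = h x + h y" "\<And>c x. h (fscale c x) = fscale c (h x)"
  shows "flinear h"
  by (simp add: Vector_Spaces.linear_iff vector_space_fscale assms)

lemma fscale_gen: "fscale c (gen a) = Poly_Mapping.single a c"
  by (rule poly_mapping_eqI) (simp add: lookup_fscale lookup_single when_def)

lemma poly_mapping_expand: "x = (\<Sum>a\<in>Poly_Mapping.keys x. fscale (Poly_Mapping.lookup x a) (gen a))"
proof (rule poly_mapping_eqI)
  fix b
  show "Poly_Mapping.lookup x b =
    Poly_Mapping.lookup (\<Sum>a\<in>Poly_Mapping.keys x. fscale (Poly_Mapping.lookup x a) (gen a)) b"
    by (simp add: fscale_gen lookup_sum lookup_single when_def sum.delta' in_keys_iff)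
qed

lemma lin_extend_superset:
  assumes "finite A" "Poly_Mapping.keys x \<subseteq> A"
  shows "lin_extend g x = (\<Sum>a\<in>A. fscale (Poly_Mapping.lookup x a) (g a))"
  unfolding lin_extend_def
  by (rule sum.mono_neutral_left) (use assms in \<open>auto simp: in_keys_iff fs.scale_zero_left\<close>)

lemma flinear_lin_extend:
  fixes g :: "'a \<Rightarrow> ('b \<Rightarrow>\<^sub>0 'k::field)"
  shows "flinear (lin_extend g)"
proof (rule flinearI)
  fix x y :: "'a \<Rightarrow>\<^sub>0 'k"
  let ?A = "Poly_Mapping.keys x \<union> Poly_Mapping.keys y"
  show "lin_extend g (x + y) = lin_extend g x + lin_extend g y"
    by (subst (1 2 3) lin_extend_superset[where A = ?A])
      (use Poly_Mapping.keys_add[of x y] in \<open>auto simp: lookup_add fs.scale_left_distrib sum.distrib\<close>)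
next
  fix c :: 'k and x :: "'a \<Rightarrow>\<^sub>0 'k"
  have "Poly_Mapping.keys (fscale c x) \<subseteq> Poly_Mapping.keys x"
    by (auto simp: in_keys_iff lookup_fscale)
  then show "lin_extend g (fscale c x) = fscale c (lin_extend g x)"
    by (subst (1 2) lin_extend_superset[where A = "Poly_Mapping.keys x"])
      (auto simp: lookup_fscale fs.scale_sum_right)
qed

lemma lin_extend_gen [simp]: "lin_extend g (gen a) = g a"
  by (simp add: lin_extend_def)

lemma fspan_gen: "fspan (gen ` A) = {x. Poly_Mapping.keys x \<subseteq> A}" (is "?L = ?R")
proof
  have "fs.subspace ?R"
  proof (rule fs.subspaceI)
    show "x + y \<in> ?R" if "x \<in> ?R" "y \<in> ?R" for x y
      using that Poly_Mapping.keys_add[of x y] by blast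
    show "fscale c x \<in> ?R" if "x \<in> ?R" for c x
      using that by (auto simp: in_keys_iff lookup_fscale)
  qed simp
  then show "?L \<subseteq> ?R"
    by (intro fs.span_minimal) auto
  show "?R \<subseteq> ?L"
  proof
    fix x assume "x \<in> ?R"
    then show "x \<in> ?L"
      by (subst poly_mapping_expand) (intro fs.span_sum fs.span_scale fs.span_base, auto)
  qed
qed

text \<open>With \<open>S\<close> a space of relations or a graded piece, this reduces membership
  claims about a whole span to its generators. Most statements about maps of quotients are proved
  through it.\<close>

lemma flinear_span_in:
  assumes "flinear h" "fs.subspace S" "\<And>b. b \<in> B \<Longrightarrow> h b \<in> S" "x \<in> fspan B"
  shows "h x \<in> S"
proof -
  interpret h: Vector_Spaces.linear fscale fscale h by fact
  from assms(4) show ?thesis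
  proof (induction rule: fs.span_induct_alt)
    case base then show ?case using assms(2) by (simp add: h.zero fs.subspace_0)
  next
    case (step c x y)
    then show ?case using assms(2,3) by (simp add: h.add h.scale fs.subspace_add fs.subspace_scale)
  qed
qed

lemma flinear_eq_on_span:
  assumes "flinear h" "flinear h'" "\<And>b. b \<in> B \<Longrightarrow> h b = h' b" "x \<in> fspan B"
  shows "h x = h' x"
  by (rule fp.linear_eq_on[OF assms(1,2,4,3)])

lemma flinear_eqI:
  assumes "flinear h" "flinear h'" "\<And>a. h (gen a) = h' (gen a)"
  shows "h = h'"
proof
  fix x
  show "h x = h' x"
    by (rule flinear_eq_on_span[OF assms(1,2), where B = "gen ` UNIV"])
      (use assms(3) in \<open>auto simp: fspan_gen\<close>)
qed

lemma flinear_compose: "flinear g \<Longrightarrow> flinear h \<Longrightarrow> flinear (\<lambda>x. h (g x))"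
  by (simp add: Vector_Spaces.linear_iff)

lemma flinear_id: "flinear (\<lambda>x. x)"
  by (simp add: Vector_Spaces.linear_iff vector_space_fscale)

lemmas flinear_diff = fp.linear_compose_sub
lemmas flinear_plus = fp.linear_compose_add

lemmas fl_simps = fp.linear_add fp.linear_diff fp.linear_neg fp.linear_scale fp.linear_0 fp.linear_sum

section \<open>The tensor product\<close>

lemma tens_superset:
  assumes "finite A" "finite B" "Poly_Mapping.keys x \<subseteq> A" "Poly_Mapping.keys y \<subseteq> B"
  shows "tens x y = (\<Sum>a\<in>A. \<Sum>b\<in>B.
    Poly_Mapping.single (a, b) (Poly_Mapping.lookup x a * Poly_Mapping.lookup y b))"
proof -
  have "tens x y = (\<Sum>a\<in>Poly_Mapping.keys x. \<Sum>b\<in>B.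
    Poly_Mapping.single (a, b) (Poly_Mapping.lookup x a * Poly_Mapping.lookup y b))"
    unfolding tens_def
    by (intro sum.cong refl sum.mono_neutral_left) (use assms in \<open>auto simp: in_keys_iff\<close>)
  also have "\<dots> = (\<Sum>a\<in>A. \<Sum>b\<in>B.
    Poly_Mapping.single (a, b) (Poly_Mapping.lookup x a * Poly_Mapping.lookup y b))"
    by (intro sum.mono_neutral_left) (use assms in \<open>auto simp: in_keys_iff\<close>)
  finally show ?thesis .
qed

lemma lookup_tens:
  "Poly_Mapping.lookup (tens x y) (a, b) = Poly_Mapping.lookup x a * Poly_Mapping.lookup y b"
proof -
  let ?A = "insert a (Poly_Mapping.keys x)" and ?B = "insert b (Poly_Mapping.keys y)"
  have "Poly_Mapping.lookup (tens x y) (a, b) =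
      (\<Sum>a'\<in>?A. \<Sum>b'\<in>?B. if a' = a \<and> b' = b then Poly_Mapping.lookup x a' * Poly_Mapping.lookup y b' else 0)"
    by (subst tens_superset[where A = ?A and B = ?B])
      (auto simp: lookup_sum lookup_single when_def intro!: sum.cong)
  also have "\<dots> = (\<Sum>a'\<in>?A. if a' = a then \<Sum>b'\<in>?B. if b' = b then Poly_Mapping.lookup x a' * Poly_Mapping.lookup y b' else 0 else 0)"
    by (intro sum.cong) auto
  also have "\<dots> = Poly_Mapping.lookup x a * Poly_Mapping.lookup y b"
    by (subst sum.delta, simp, subst sum.delta) auto
  finally show ?thesis .
qed

lemma tens_gen [simp]: "tens (gen a) (gen b) = gen (a, b)"
  by (rule poly_mapping_eqI) (auto simp: lookup_tens lookup_single when_def split: prod.splits if_splits)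

lemma flinear_tens_left: "flinear (\<lambda>x. tens x y)"
  by (rule flinearI; rule poly_mapping_eqI)
    (auto simp: lookup_tens lookup_add lookup_fscale algebra_simps split: prod.splits)

lemma flinear_tens_right: "flinear (\<lambda>y. tens x y)"
  by (rule flinearI; rule poly_mapping_eqI)
    (auto simp: lookup_tens lookup_add lookup_fscale algebra_simps split: prod.splits)

lemmas tens_left_simps =
  fp.linear_add[OF flinear_tens_left] fp.linear_diff[OF flinear_tens_left]
  fp.linear_neg[OF flinear_tens_left] fp.linear_scale[OF flinear_tens_left]
  fp.linear_0[OF flinear_tens_left]
lemmas tens_right_simps =
  fp.linear_add[OF flinear_tens_right] fp.linear_diff[OF flinear_tens_right]
  fp.linear_neg[OF flinear_tens_right] fp.linear_scale[OF flinear_tens_right]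
  fp.linear_0[OF flinear_tens_right]

section \<open>Signed sums over unshuffles\<close>

text \<open>Koszul signs acting on an arbitrary abelian group, so that sums over unshuffles need no
  scalars. Only the parity of the exponent matters, which keeps sign bookkeeping inside integer
  arithmetic.\<close>

definition signed :: "int \<Rightarrow> 'a::ab_group_add \<Rightarrow> 'a"
  where "signed n x = (if even n then x else - x)"

lemma signed_0 [simp]: "signed n 0 = 0" "signed 0 x = x"
  by (simp_all add: signed_def)

lemma signed_add: "signed n (x + y) = signed n x + signed n y"
  by (simp add: signed_def)

lemma signed_diff: "signed n (x - y) = signed n x - signed n y"
  by (simp add: signed_def)

lemma signed_signed [simp]: "signed n (signed m x) = signed (n + m) x"
  by (auto simp: signed_def)

lemma signed_parity: "even n = even m \<Longrightarrow> signed n x = signed m x"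
  by (simp add: signed_def)

lemma fscale_signed: "fscale ((-1) powi n) x = signed n x"
  by (cases "even n") (simp_all add: signed_def power_int_minus_left)

lemma additive_signed: "additive h \<Longrightarrow> h (signed n x) = signed n (h x)"
  by (simp add: signed_def additive.minus)

lemma flinear_additive: "flinear h \<Longrightarrow> additive h"
  by unfold_locales (rule fp.linear_add)

lemmas flinear_signed = additive_signed[OF flinear_additive]

lemma fs_subspace_signed: "fs.subspace S \<Longrightarrow> x \<in> S \<Longrightarrow> signed n x \<in> S"
  by (simp add: signed_def fs.subspace_neg)

text \<open>\<open>unsh f w\<close> is the sum of \<open>\<plusminus> f a b\<close> over all unshuffles \<open>(a, b)\<close> of \<open>w\<close> with their Koszul signs.
  With the consumer \<open>f\<close> as an argument, coassociativity and cocommutativity of the coproduct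
  become identities for arbitrary \<open>f\<close>.\<close>

fun unsh :: "('v word \<Rightarrow> 'v word \<Rightarrow> 'm::ab_group_add) \<Rightarrow> 'v word \<Rightarrow> 'm"
  where
    "unsh f [] = f [] []"
  | "unsh f (x # w) = unsh (\<lambda>a b. f (x # a) b + signed (fst x * wdeg a) (f a (x # b))) w"

lemma wdeg_simps [simp]: "wdeg [] = 0" "wdeg (x # w) = fst x + wdeg w"
  "wdeg (u @ w) = wdeg u + wdeg w"
  by (simp_all add: wdeg_def)

lemma wdeg_mset: "wdeg w = sum_mset (image_mset fst (mset w))"
  unfolding wdeg_def by (metis mset_map sum_mset_sum_list)

lemma mset_wdeg: "mset a + mset b = mset w \<Longrightarrow> wdeg w = wdeg a + wdeg b"
  by (metis wdeg_mset image_mset_union sum_mset.union)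

lemma mset_length: "mset a + mset b = mset w \<Longrightarrow> length w = length a + length b"
  by (metis size_mset size_union)

lemma mset_set: "mset a + mset b = mset w \<Longrightarrow> set w = set a \<union> set b"
  by (metis set_mset_mset set_mset_union)

text \<open>The multiset hypothesis records that the two parts together use exactly the letters of
  the word. As a \<open>fundef_cong\<close> rule it hands this fact to the termination proof of
  \<open>ext_word\<close>, whose recursive call is hidden inside the argument of
  \<open>unsh\<close>.\<close>

lemma unsh_cong [fundef_cong]:
  assumes "w = w'" "\<And>a b. mset a + mset b = mset w' \<Longrightarrow> f a b = g a b"
  shows "unsh f w = unsh g w'"
  using assms(2) unfolding assms(1)
proof (induction w' arbitrary: f g)
  case (Cons x w)
  show ?case
    by (simp, rule Cons.IH) (use Cons.prems in auto)
qed auto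

lemma unsh_add: "unsh (\<lambda>a b. f a b + g a b) w = unsh f w + unsh g w"
proof (induction w arbitrary: f g)
  case (Cons x w)
  show ?case
    by (simp add: Cons.IH[symmetric] signed_add algebra_simps)
qed auto

lemma unsh_hom: "additive h \<Longrightarrow> h (unsh f w) = unsh (\<lambda>a b. h (f a b)) w"
  by (induction w arbitrary: f) (simp_all add: additive.add additive_signed)

lemma additive_uminus_ab_group: "additive (uminus :: 'a::ab_group_add \<Rightarrow> 'a)"
  by unfold_locales simp

lemma unsh_minus: "unsh (\<lambda>a b. - f a b) w = - unsh f w"
  by (rule unsh_hom[OF additive_uminus_ab_group, symmetric])

lemma unsh_diff: "unsh (\<lambda>a b. f a b - g a b) w = unsh f w - unsh g w"
  using unsh_add[of f "\<lambda>a b. - g a b" w] by (simp add: unsh_minus)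

lemma unsh_signed: "unsh (\<lambda>a b. signed n (f a b)) w = signed n (unsh f w)"
  by (simp add: signed_def unsh_minus)

lemma unsh_zero [simp]: "unsh (\<lambda>a b. 0) w = 0"
  by (induction w) auto

lemma unsh_in:
  assumes "fs.subspace S" "\<And>a b. mset a + mset b = mset w \<Longrightarrow> f a b \<in> S"
  shows "unsh f w \<in> S"
  using assms(2)
proof (induction w arbitrary: f)
  case (Cons x w)
  show ?case
    by (simp, rule Cons.IH)
      (use Cons.prems assms(1) in \<open>auto intro!: fs.subspace_add fs_subspace_signed\<close>)
qed auto

text \<open>Exactly one unshuffle has an empty left part, and in it no letter passes another, so it
  carries no sign.\<close>

lemma unsh_Nil_left: "unsh (\<lambda>a b. if a = [] then h b else 0) w = h w"
  by (induction w arbitrary: h) (auto simp: if_distrib[of "signed _"] cong: if_cong)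

lemma unsh_Nil_right: "unsh (\<lambda>a b. if b = [] then h a else 0) w = h w"
  by (induction w arbitrary: h) (auto simp: if_distrib[of "signed _"] cong: if_cong)

text \<open>Coassociativity: both sides run over the distributions of the letters to three ordered
  parts. In the induction the new first letter joins one of the parts and pays for passing the parts
  before it; \<open>?g\<close> lists the three cases.\<close>

lemma unsh_assoc:
  "unsh (\<lambda>a b. unsh (\<lambda>a1 a2. f a1 a2 b) a) w = unsh (\<lambda>a b. unsh (f a) b) w"
proof (induction w arbitrary: f)
  case (Cons x w)
  let ?g = "\<lambda>a1 a2 b. f (x # a1) a2 b + signed (fst x * wdeg a1) (f a1 (x # a2) b) +
    signed (fst x * (wdeg a1 + wdeg a2)) (f a1 a2 (x # b))"
  have "unsh (\<lambda>a b. unsh (\<lambda>a1 a2. f a1 a2 b) a) (x # w) = unsh (\<lambda>a b. unsh (\<lambda>a1 a2. ?g a1 a2 b) a) w"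
    by (auto simp: unsh_add unsh_signed[symmetric] mset_wdeg intro!: unsh_cong arg_cong2[where f = "(+)"])
  also have "\<dots> = unsh (\<lambda>a b. unsh (?g a) b) w"
    by (rule Cons.IH)
  also have "\<dots> = unsh (\<lambda>a b. unsh (f a) b) (x # w)"
    by (auto simp: unsh_add unsh_signed[symmetric] signed_add algebra_simps intro!: unsh_cong arg_cong2[where f = "(+)"])
  finally show ?case .
qed auto

text \<open>Cocommutativity: exchanging the two parts costs the sign of moving one whole part past
  the other.\<close>

lemma unsh_commute: "unsh f w = unsh (\<lambda>a b. signed (wdeg a * wdeg b) (f b a)) w"
proof (induction w arbitrary: f)
  case (Cons x w)
  have "unsh f (x # w) = unsh (\<lambda>a b. signed (wdeg a * wdeg b) (f (x # b) a + signed (fst x * wdeg b) (f b (x # a)))) w"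
    by (simp, subst Cons.IH) simp
  also have "\<dots> = unsh (\<lambda>a b. signed (wdeg a * wdeg b) (f b a)) (x # w)"
    by (auto simp: signed_add intro!: unsh_cong signed_parity simp: algebra_simps)
  finally show ?case .
qed auto

text \<open>Multiplicativity of the coproduct: prefix and suffix are unshuffled separately, and the
  only additional sign comes from moving \<open>c\<close> in front of \<open>b\<close>.\<close>

lemma unsh_append:
  "unsh f (u @ w) = unsh (\<lambda>a b. unsh (\<lambda>c d. signed (wdeg b * wdeg c) (f (a @ c) (b @ d))) w) u"
proof (induction u arbitrary: f)
  case (Cons x u)
  show ?case
    by (auto simp: Cons.IH signed_add unsh_add unsh_signed[symmetric] algebra_simps
        intro!: unsh_cong arg_cong2[where f = "(+)"] signed_parity)
qed auto

section \<open>The coproduct as a sum over unshuffles\<close>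

lemma nths_eq_map_filter: "nths w I = map ((!) w) (filter (\<lambda>i. i \<in> I) [0..<length w])"
proof (induction w arbitrary: I)
  case (Cons x w)
  have "filter (\<lambda>i. i \<in> I) [0..<length (x # w)] =
      (if 0 \<in> I then [0] else []) @ map Suc (filter (\<lambda>i. Suc i \<in> I) [0..<length w])"
    by (simp add: upt_conv_Cons map_Suc_upt[symmetric] filter_map o_def del: upt_Suc)
  then show ?case
    by (simp add: nths_Cons Cons.IH o_def)
qed simp

lemma nths_eq_map_sorted_list:
  assumes "I \<subseteq> {..<length w}"
  shows "nths w I = map ((!) w) (sorted_list_of_set I)"
proof -
  have "filter (\<lambda>i. i \<in> I) [0..<length w] = sorted_list_of_set I"
    by (rule sorted_distinct_set_unique)
      (use assms finite_subset[OF assms] in \<open>auto intro: sorted_filter[where f = "\<lambda>x. x", simplified]\<close>)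
  then show ?thesis
    by (simp add: nths_eq_map_filter)
qed

lemma nths_Compl: "nths w (- I) = nths w ({..<length w} - I)"
  unfolding nths_eq_map_filter by (rule arg_cong[where f = "map _"], rule filter_cong) auto

lemma wdeg_nths:
  assumes "I \<subseteq> {..<length w}"
  shows "wdeg (nths w I) = (\<Sum>i\<in>I. fst (w ! i))"
  using finite_subset[OF assms]
  by (simp add: nths_eq_map_sorted_list[OF assms] wdeg_def o_def sum_list_distinct_conv_sum_set)

text \<open>The exponent of the Koszul sign for pulling the letters at the positions
  \<open>I\<close> to the front: each chosen letter \<open>j\<close> passes every unchosen letter
  before it.\<close>

definition subset_parity :: "'v word \<Rightarrow> nat set \<Rightarrow> int"
  where "subset_parity w I = (\<Sum>j\<in>I. \<Sum>i\<in>{..<j} - I. fst (w ! j) * fst (w ! i))"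

lemma subset_parity_insert:
  assumes "finite J"
  shows "subset_parity (x # w) (insert 0 (Suc ` J)) = subset_parity w J"
proof -
  have "i \<in> {..<Suc j} - insert 0 (Suc ` J) \<longleftrightarrow> i \<in> Suc ` ({..<j} - J)" for i j
    by (cases i) auto
  then have "{..<Suc j} - insert 0 (Suc ` J) = Suc ` ({..<j} - J)" for j
    by blast
  then show ?thesis
    using assms by (simp add: subset_parity_def sum.reindex o_def)
qed

text \<open>Here the first letter stays behind and every chosen letter passes it, which gives the
  extra summand. In \<open>subset_parity_insert\<close> the first letter is itself chosen and
  nothing passes it.\<close>

lemma subset_parity_Suc:
  assumes "J \<subseteq> {..<length w}"
  shows "subset_parity (x # w) (Suc ` J) = subset_parity w J + fst x * wdeg (nths w J)"
proof -
  have "i \<in> {..<Suc j} - Suc ` J \<longleftrightarrow> i \<in> insert 0 (Suc ` ({..<j} - J))" for i j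
    by (cases i) auto
  then have *: "{..<Suc j} - Suc ` J = insert 0 (Suc ` ({..<j} - J))" for j
    by blast
  show ?thesis
    by (simp add: subset_parity_def sum.reindex o_def * wdeg_nths[OF assms] sum.distrib sum_distrib_left algebra_simps)
qed

text \<open>Subsets are sorted by whether they contain position 0; this matches the two summands in
  the recursion of \<open>unsh\<close>.\<close>

lemma unsh_eq_sum_subsets:
  "unsh f w = (\<Sum>I\<in>Pow {..<length w}. signed (subset_parity w I) (f (nths w I) (nths w (- I))))"
proof (induction w arbitrary: f)
  case (Cons x w)
  let ?P = "Pow {..<length w}"
  have lt: "{..<Suc n} = insert 0 (Suc ` {..<n})" for n
    by (auto simp: image_iff less_Suc_eq_0_disj)
  have P: "Pow {..<length (x # w)} = (\<lambda>J. Suc ` J) ` ?P \<union> (\<lambda>J. insert 0 (Suc ` J)) ` ?P"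
    by (simp add: lt Pow_insert image_image image_Pow_surj[OF refl, symmetric])
  have i1: "inj_on ((`) Suc) ?P"
    by (rule inj_onI) (simp add: inj_image_eq_iff)
  have i2: "inj_on (\<lambda>J. insert 0 (Suc ` J)) ?P"
  proof (rule inj_onI)
    fix I J assume "insert 0 (Suc ` I) = insert 0 (Suc ` J)"
    then have "Suc ` I = Suc ` J"
      by (metis (no_types, lifting) Zero_not_Suc image_iff insert_ident)
    then show "I = J" by (simp add: inj_image_eq_iff)
  qed
  have n: "nths (x # w) (Suc ` J) = nths w J" "nths (x # w) (- Suc ` J) = x # nths w (- J)"
     "nths (x # w) (insert 0 (Suc ` J)) = x # nths w J" "nths (x # w) (- insert 0 (Suc ` J)) = nths w (- J)" for J
    by (auto simp: nths_Cons image_iff intro!: arg_cong[where f = "nths w"])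
  have "(\<Sum>I\<in>Pow {..<length (x # w)}. signed (subset_parity (x # w) I) (f (nths (x # w) I) (nths (x # w) (- I)))) =
    (\<Sum>J\<in>?P. signed (subset_parity w J + fst x * wdeg (nths w J)) (f (nths w J) (x # nths w (- J)))) +
    (\<Sum>J\<in>?P. signed (subset_parity w J) (f (x # nths w J) (nths w (- J))))"
    unfolding P
    by (subst sum.union_disjoint)
      (auto simp: sum.reindex[OF i1] sum.reindex[OF i2] n subset_parity_Suc
         subset_parity_insert[OF finite_subset] intro!: arg_cong2[where f = "(+)"] sum.cong)
  then show ?case
    by (simp add: Cons.IH signed_add sum.distrib)
qed (simp add: subset_parity_def)

section \<open>Shuffle permutations as subsets of positions\<close>

lemma map_strict_mono_on_upt:
  fixes \<sigma> :: "nat \<Rightarrow> nat"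
  assumes "strict_mono_on {a..<b} \<sigma>"
  shows "map \<sigma> [a..<b] = sorted_list_of_set (\<sigma> ` {a..<b})"
proof (rule sorted_distinct_set_unique)
  show "sorted (map \<sigma> [a..<b])"
    unfolding sorted_map
    by (rule sorted_wrt_mono_rel[OF _ sorted_wrt_upt])
      (use assms in \<open>auto simp: strict_mono_on_def intro: less_imp_le\<close>)
  show "distinct (map \<sigma> [a..<b])"
    using strict_mono_on_imp_inj_on[OF assms] by (simp add: distinct_map)
qed auto

text \<open>A shuffle increases on both blocks, so it is determined by the image of the first block:
  it enumerates that image and then its complement in increasing order.\<close>

lemma shuffle_perms_lists:
  assumes "\<sigma> \<in> shuffle_perms p m" "p \<le> m"
  shows "map \<sigma> [0..<p] = sorted_list_of_set (\<sigma> ` {..<p})"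
    and "map \<sigma> [p..<m] = sorted_list_of_set ({..<m} - \<sigma> ` {..<p})"
proof -
  from assms have p: "\<sigma> permutes {..<m}" and s1: "strict_mono_on {..<p} \<sigma>" and s2: "strict_mono_on {p..<m} \<sigma>"
    by (auto simp: shuffle_perms_def)
  have inj: "inj \<sigma>" using p by (rule permutes_inj)
  have "{..<m} - \<sigma> ` {..<p} = \<sigma> ` ({..<m} - {..<p})"
    using image_set_diff[OF inj, of "{..<m}" "{..<p}"] permutes_image[OF p] by simp
  also have "{..<m} - {..<p} = {p..<m}" by auto
  finally have c: "{..<m} - \<sigma> ` {..<p} = \<sigma> ` {p..<m}" .
  show "map \<sigma> [0..<p] = sorted_list_of_set (\<sigma> ` {..<p})"
    using map_strict_mono_on_upt[of 0 p] s1 by (simp add: lessThan_atLeast0)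
  show "map \<sigma> [p..<m] = sorted_list_of_set ({..<m} - \<sigma> ` {..<p})"
    unfolding c by (rule map_strict_mono_on_upt[OF s2])
qed

lemma koszul_shuffle:
  assumes "\<sigma> \<in> shuffle_perms p (length w)" "p \<le> length w"
  shows "koszul w \<sigma> = (-1) powi subset_parity w (\<sigma> ` {..<p})"
proof -
  let ?m = "length w" and ?I = "\<sigma> ` {..<p}"
  let ?K = "{(i, j). i < j \<and> j < ?m \<and> \<sigma> j < \<sigma> i}"
  let ?S = "Sigma ?I (\<lambda>b. {..<b} - ?I)"
  from assms have p: "\<sigma> permutes {..<?m}" and s1: "strict_mono_on {..<p} \<sigma>" and s2: "strict_mono_on {p..<?m} \<sigma>"
    by (auto simp: shuffle_perms_def)
  have inj: "inj \<sigma>" using p by (rule permutes_inj)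
  have lt: "\<sigma> i < ?m \<longleftrightarrow> i < ?m" for i
    using permutes_in_image[OF p, of i] by simp
  \<comment> \<open>A shuffle has no inversions inside a block. So an inversion pairs a chosen
    position with a smaller unchosen one, and these are the pairs counted by
    \<open>subset_parity\<close>.\<close>
  have K: "i < p \<and> p \<le> j" if "(i, j) \<in> ?K" for i j
  proof (rule ccontr)
    assume "\<not> ?thesis"
    with that have "j < p \<or> p \<le> i" by auto
    then have "\<sigma> i < \<sigma> j"
      using that strict_mono_onD[OF s1, of i j] strict_mono_onD[OF s2, of i j] by auto
    with that show False by simp
  qed
  have fin: "finite ?K"
    by (rule finite_subset[of _ "{..<?m} \<times> {..<?m}"]) auto
  have prod_powi: "(\<Prod>x\<in>A. (-1) powi g x) = ((-1) powi (\<Sum>x\<in>A. g x) :: 'b::field)" if "finite A" for A and g :: "nat \<times> nat \<Rightarrow> int"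
    using that by induction (simp_all add: power_int_add)
  have "koszul w \<sigma> = ((-1) powi (\<Sum>(i, j)\<in>?K. fst (w ! \<sigma> i) * fst (w ! \<sigma> j)) :: 'b)"
    unfolding koszul_def by (subst prod_powi[OF fin, symmetric]) (simp add: case_prod_unfold)
  also have "(\<Sum>(i, j)\<in>?K. fst (w ! \<sigma> i) * fst (w ! \<sigma> j)) = (\<Sum>(b, a)\<in>?S. fst (w ! b) * fst (w ! a))"
  proof (rule sum.reindex_bij_witness[where i = "\<lambda>(b, a). (inv \<sigma> b, inv \<sigma> a)" and j = "\<lambda>(i, j). (\<sigma> i, \<sigma> j)"])
    fix x assume x: "x \<in> ?K"
    then obtain i j where ij: "x = (i, j)" "i < j" "j < ?m" "\<sigma> j < \<sigma> i" by blast
    with K[of i j] have "i < p" "p \<le> j" by auto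
    then have "\<sigma> i \<in> ?I" "\<sigma> j \<notin> ?I"
      using inj by (auto simp: inj_eq)
    then show "(case x of (i, j) \<Rightarrow> (\<sigma> i, \<sigma> j)) \<in> ?S"
      using ij by auto
    show "(case (case x of (i, j) \<Rightarrow> (\<sigma> i, \<sigma> j)) of (b, a) \<Rightarrow> (inv \<sigma> b, inv \<sigma> a)) = x"
      using ij inj by simp
    show "(case (case x of (i, j) \<Rightarrow> (\<sigma> i, \<sigma> j)) of (b, a) \<Rightarrow> fst (w ! b) * fst (w ! a)) =
        (case x of (i, j) \<Rightarrow> fst (w ! \<sigma> i) * fst (w ! \<sigma> j))"
      using ij by simp
  next
    fix y assume "y \<in> ?S"
    then obtain b a where y: "y = (b, a)" and h: "b \<in> ?I" "a < b" "a \<notin> ?I" by blast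
    then obtain i where i: "i < p" "b = \<sigma> i" by auto
    obtain j where j: "a = \<sigma> j" using permutes_surj[OF p] by blast
    have "\<not> j < p" using h(3) j by auto
    moreover have "j < ?m" using lt[of i] lt[of j] i j h(2) assms(2) by auto
    ultimately show "(case y of (b, a) \<Rightarrow> (inv \<sigma> b, inv \<sigma> a)) \<in> ?K"
      using y i j h(2) inj by auto
    show "(case (case y of (b, a) \<Rightarrow> (inv \<sigma> b, inv \<sigma> a)) of (i, j) \<Rightarrow> (\<sigma> i, \<sigma> j)) = y"
      using y i j inj by simp
  qed
  also have "\<dots> = subset_parity w ?I"
    by (simp add: subset_parity_def sum.Sigma)
  finally show ?thesis .
qed

lemma shuffle_perms_bij:
  "bij_betw (\<lambda>(p, \<sigma>). \<sigma> ` {..<p}) (Sigma {1..<m} (\<lambda>p. shuffle_perms p m))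
    {I \<in> Pow {..<m}. I \<noteq> {} \<and> I \<noteq> {..<m}}" (is "bij_betw ?h ?A ?B")
proof -
  have "inj_on ?h ?A"
  proof (rule inj_onI, clarify)
    fix p \<sigma> q \<tau>
    assume p: "p \<in> {1..<m}" and q: "q \<in> {1..<m}" and s: "\<sigma> \<in> shuffle_perms p m" and t: "\<tau> \<in> shuffle_perms q m"
      and e: "\<sigma> ` {..<p} = \<tau> ` {..<q}"
    have ps: "\<sigma> permutes {..<m}" and pt: "\<tau> permutes {..<m}"
      using s t by (auto simp: shuffle_perms_def)
    have "card (\<sigma> ` {..<p}) = p" "card (\<tau> ` {..<q}) = q"
      using permutes_inj[OF ps] permutes_inj[OF pt] by (auto simp: card_image inj_on_subset)
    with e have pq: "p = q" by simp
    have "map \<sigma> [0..<p] = map \<tau> [0..<p]" "map \<sigma> [p..<m] = map \<tau> [p..<m]"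
      using shuffle_perms_lists[OF s] shuffle_perms_lists[OF t] p e pq by auto
    then have "\<sigma> i = \<tau> i" if "i < m" for i
      using that by (cases "i < p") (auto simp: map_eq_conv)
    then have "\<sigma> i = \<tau> i" for i
      using permutes_not_in[OF ps, of i] permutes_not_in[OF pt, of i] by (cases "i < m") auto
    with pq show "p = q \<and> \<sigma> = \<tau>" by auto
  qed
  moreover have "?h ` ?A \<subseteq> ?B"
  proof (rule image_subsetI)
    fix x assume "x \<in> ?A"
    then obtain p \<sigma> where x: "x = (p, \<sigma>)" and p: "p \<in> {1..<m}" and s: "\<sigma> \<in> shuffle_perms p m"
      by blast
    have ps: "\<sigma> permutes {..<m}" using s by (auto simp: shuffle_perms_def)
    have c: "card (\<sigma> ` {..<p}) = p"
      using permutes_inj[OF ps] by (auto simp: card_image inj_on_subset)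
    have "\<sigma> ` {..<p} \<subseteq> \<sigma> ` {..<m}" using p by (intro image_mono) auto
    then have "\<sigma> ` {..<p} \<subseteq> {..<m}" using permutes_image[OF ps] by simp
    moreover have "\<sigma> ` {..<p} \<noteq> {}" "\<sigma> ` {..<p} \<noteq> {..<m}"
      using c p by (force, metis card_lessThan atLeastLessThan_iff less_irrefl)
    ultimately show "?h x \<in> ?B" using x by simp
  qed
  moreover have "?B \<subseteq> ?h ` ?A"
  proof (rule subsetI)
    fix I assume "I \<in> ?B"
    then have I: "I \<subseteq> {..<m}" "I \<noteq> {}" "I \<noteq> {..<m}" by auto
    then have fin: "finite I" using finite_subset by blast
    define xs where "xs = sorted_list_of_set I"
    define ys where "ys = sorted_list_of_set ({..<m} - I)"
    define p where "p = card I"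
    \<comment> \<open>The shuffle belonging to \<open>I\<close>: list \<open>I\<close> increasingly,
      then its complement; outside the positions it must be the identity to be a
      permutation.\<close>
    define \<sigma> where "\<sigma> i = (if i < m then (xs @ ys) ! i else i)" for i
    have "card I \<le> m" using card_mono[OF _ I(1)] by simp
    then have len: "length xs = p" "length (xs @ ys) = m"
      using I fin by (simp_all add: xs_def ys_def p_def card_Diff_subset)
    have p: "p \<in> {1..<m}"
      using I fin psubset_card_mono[of "{..<m}" I] by (simp add: p_def Suc_le_eq card_gt_0_iff psubset_eq)
    have "bij_betw ((!) (xs @ ys)) {..<m} {..<m}"
      by (rule bij_betw_nth) (use I fin len in \<open>auto simp: xs_def ys_def\<close>)
    then have "bij_betw \<sigma> {..<m} {..<m}"
      by (subst bij_betw_cong[where g = "(!) (xs @ ys)"]) (auto simp: \<sigma>_def)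
    then have perm: "\<sigma> permutes {..<m}"
      by (rule bij_imp_permutes) (simp add: \<sigma>_def)
    have "strict_mono_on {..<p} \<sigma>"
    proof (rule strict_mono_onI)
      fix i j assume "i \<in> {..<p}" "j \<in> {..<p}" "i < j"
      then show "\<sigma> i < \<sigma> j"
        using p len sorted_wrt_nth_less[OF strict_sorted_list_of_set[of I], of i j]
        by (auto simp: \<sigma>_def nth_append xs_def[symmetric])
    qed
    moreover have "strict_mono_on {p..<m} \<sigma>"
    proof (rule strict_mono_onI)
      fix i j assume "i \<in> {p..<m}" "j \<in> {p..<m}" "i < j"
      then show "\<sigma> i < \<sigma> j"
        using p len sorted_wrt_nth_less[OF strict_sorted_list_of_set[of "{..<m} - I"], of "i - p" "j - p"]
        by (auto simp: \<sigma>_def nth_append ys_def[symmetric])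
    qed
    moreover have "\<sigma> ` {..<p} = I"
    proof -
      have "\<sigma> ` {..<p} = (!) xs ` {..<length xs}"
        using p len by (auto simp: \<sigma>_def nth_append intro!: image_cong)
      also have "\<dots> = set xs" by (auto simp: set_conv_nth)
      finally show ?thesis using fin by (simp add: xs_def)
    qed
    ultimately show "I \<in> ?h ` ?A"
      using p perm by (intro image_eqI[where x = "(p, \<sigma>)"]) (auto simp: shuffle_perms_def)
  qed
  ultimately show ?thesis
    by (auto simp: bij_betw_def)
qed

text \<open>The bridge from the sum over shuffle permutations in the definition to the recursive
  \<open>unsh\<close>. The excluded subsets, empty and full, are the splittings with an empty
  part.\<close>

lemma coprod_gen: "coprod (gen w) = unsh (\<lambda>a b. if a = [] \<or> b = [] then 0 else gen (a, b)) w"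
proof -
  let ?m = "length w" and ?g = "\<lambda>a b. if a = [] \<or> b = [] then 0 else gen (a, b)"
  let ?B = "{I \<in> Pow {..<?m}. I \<noteq> {} \<and> I \<noteq> {..<?m}}"
  let ?t = "\<lambda>I. signed (subset_parity w I) (gen (nths w I, nths w (- I)))"
  have fin: "finite (shuffle_perms p ?m)" for p
    by (rule finite_subset[OF _ finite_permutations[of "{..<?m}"]]) (auto simp: shuffle_perms_def)
  have "coprod (gen w) = (\<Sum>p\<in>{1..<?m}. \<Sum>\<sigma>\<in>shuffle_perms p ?m. ?t (\<sigma> ` {..<p}))"
    unfolding coprod_def lin_extend_gen
  proof (rule sum.cong[OF refl], rule sum.cong[OF refl])
    fix p \<sigma> assume p: "p \<in> {1..<?m}" and s: "\<sigma> \<in> shuffle_perms p ?m"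
    have "\<sigma> ` {..<p} \<subseteq> {..<?m}"
      using image_mono[of "{..<p}" "{..<?m}" \<sigma>] permutes_image[of \<sigma> "{..<?m}"] s p
      by (simp add: shuffle_perms_def)
    then have "nths w (\<sigma> ` {..<p}) = map ((!) w) (map \<sigma> [0..<p])"
        "nths w (- \<sigma> ` {..<p}) = map ((!) w) (map \<sigma> [p..<?m])"
      using shuffle_perms_lists[OF s] p by (simp_all add: nths_Compl nths_eq_map_sorted_list)
    then show "fscale (koszul w \<sigma>) (gen (map (\<lambda>i. w ! \<sigma> i) [0..<p], map (\<lambda>i. w ! \<sigma> i) [p..<?m])) = ?t (\<sigma> ` {..<p})"
      using p by (simp add: koszul_shuffle[OF s] fscale_signed o_def)
  qed
  also have "\<dots> = (\<Sum>(p, \<sigma>)\<in>Sigma {1..<?m} (\<lambda>p. shuffle_perms p ?m). ?t (\<sigma> ` {..<p}))"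
    by (rule sum.Sigma) (use fin in auto)
  also have "\<dots> = (\<Sum>I\<in>?B. ?t I)"
    using sum.reindex_bij_betw[OF shuffle_perms_bij, of ?t ?m] by (simp add: case_prod_unfold)
  also have "\<dots> = (\<Sum>I\<in>Pow {..<?m}. signed (subset_parity w I) (?g (nths w I) (nths w (- I))))"
  proof (rule sum.mono_neutral_cong_left)
    have e: "nths w I = [] \<longleftrightarrow> I = {}" if "I \<subseteq> {..<?m}" for I
      using finite_subset[OF that] that by (simp add: nths_eq_map_sorted_list)
    have e': "nths w (- I) = [] \<longleftrightarrow> I = {..<?m}" if "I \<subseteq> {..<?m}" for I
      using e[of "{..<?m} - I"] that by (auto simp: nths_Compl)
    show "\<forall>I\<in>Pow {..<?m} - ?B. signed (subset_parity w I) (?g (nths w I) (nths w (- I))) = 0"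
      using e e' by auto
    show "?t I = signed (subset_parity w I) (?g (nths w I) (nths w (- I)))" if "I \<in> ?B" for I
      using that e[of I] e'[of I] by auto
  qed auto
  also have "\<dots> = unsh ?g w"
    by (rule unsh_eq_sum_subsets[symmetric])
  finally show ?thesis .
qed

section \<open>The symmetry relations\<close>

text \<open>The generators of \<open>sym_rel\<close>, indexed by word length and degree. Length is
  the induction parameter for extending maps over the quotient; degree makes the signs in tensor
  products constant on each generator.\<close>

inductive rel_gen :: "('k::field \<Rightarrow> 'v::ab_group_add \<Rightarrow> 'v) \<Rightarrow> (int \<Rightarrow> 'v set) \<Rightarrow> nat \<Rightarrow> int \<Rightarrow>
    ('v word \<Rightarrow>\<^sub>0 'k) \<Rightarrow> bool"
  for sc V
  where
    rel_gen_add: "xs \<in> hlists V \<Longrightarrow> ys \<in> hlists V \<Longrightarrow> a \<in> V i \<Longrightarrow> b \<in> V i \<Longrightarrow>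
      rel_gen sc V (Suc (length xs + length ys)) (wdeg xs + i + wdeg ys)
        (gen (xs @ (i, a + b) # ys) - gen (xs @ (i, a) # ys) - gen (xs @ (i, b) # ys))"
  | rel_gen_scale: "xs \<in> hlists V \<Longrightarrow> ys \<in> hlists V \<Longrightarrow> a \<in> V i \<Longrightarrow>
      rel_gen sc V (Suc (length xs + length ys)) (wdeg xs + i + wdeg ys)
        (gen (xs @ (i, sc c a) # ys) - fscale c (gen (xs @ (i, a) # ys)))"
  | rel_gen_swap: "xs \<in> hlists V \<Longrightarrow> ys \<in> hlists V \<Longrightarrow> a \<in> V i \<Longrightarrow> b \<in> V j \<Longrightarrow>
      rel_gen sc V (Suc (Suc (length xs + length ys))) (wdeg xs + i + j + wdeg ys)
        (gen (xs @ (i, a) # (j, b) # ys) - signed (i * j) (gen (xs @ (j, b) # (i, a) # ys)))"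

lemma sym_rel_eq: "sym_rel sc V = fspan {r. \<exists>m d. rel_gen sc V m d r}"
  unfolding sym_rel_def fscale_signed
proof (rule arg_cong[where f = fspan], rule equalityI; rule subsetI)
  fix r assume "r \<in> {r. \<exists>m d. rel_gen sc V m d r}"
  then obtain m d where "rel_gen sc V m d r" by blast
  then show "r \<in> {gen (xs @ (i, a + b) # ys) - gen (xs @ (i, a) # ys) - gen (xs @ (i, b) # ys) | xs ys i a b.
       xs \<in> hlists V \<and> ys \<in> hlists V \<and> a \<in> V i \<and> b \<in> V i} \<union>
    {gen (xs @ (i, sc c a) # ys) - fscale c (gen (xs @ (i, a) # ys)) | xs ys i a c.
       xs \<in> hlists V \<and> ys \<in> hlists V \<and> a \<in> V i} \<union>
    {gen (xs @ (i, a) # (j, b) # ys) - signed (i * j) (gen (xs @ (j, b) # (i, a) # ys))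
       | xs ys i j a b.
       xs \<in> hlists V \<and> ys \<in> hlists V \<and> a \<in> V i \<and> b \<in> V j}"
    by cases blast+
qed (elim UnE; clarsimp; blast intro: rel_gen.intros)

lemma rel_gen_sym_rel: "rel_gen sc V m d r \<Longrightarrow> r \<in> sym_rel sc V"
  unfolding sym_rel_eq by (rule fs.span_base) blast

lemma subspace_sym_rel: "fs.subspace (sym_rel sc V)"
  unfolding sym_rel_def by (rule fs.subspace_span)

lemma subspace_sym_rel2: "fs.subspace (sym_rel2 sc V)"
  unfolding sym_rel2_def by (rule fs.subspace_span)

lemma subspace_free_deg: "fs.subspace (free_deg V d)"
  unfolding free_deg_def by (rule fs.subspace_span)

lemma subspace_free_sp: "fs.subspace (free_sp V)"
  unfolding free_sp_def by (rule fs.subspace_span)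

lemma sym_rel_cong:
  assumes "x - y \<in> sym_rel sc V"
  shows "x \<in> sym_rel sc V \<longleftrightarrow> y \<in> sym_rel sc V"
  using fs.subspace_add[OF subspace_sym_rel assms, of y] fs.subspace_diff[OF subspace_sym_rel _ assms, of x]
  by auto

lemma hlists_simps [simp]: "[] \<in> hlists V" "(i, v) # w \<in> hlists V \<longleftrightarrow> v \<in> V i \<and> w \<in> hlists V"
    "u @ w \<in> hlists V \<longleftrightarrow> u \<in> hlists V \<and> w \<in> hlists V"
  by (auto simp: hlists_def)

lemma hlists_mset: "mset a + mset b = mset w \<Longrightarrow> w \<in> hlists V \<longleftrightarrow> a \<in> hlists V \<and> b \<in> hlists V"
  by (drule mset_set) (auto simp: hlists_def)

lemma words_iff: "w \<in> words V \<longleftrightarrow> w \<in> hlists V \<and> w \<noteq> []"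
  by (simp add: words_def)

lemma gen_free_deg: "w \<in> words V \<Longrightarrow> wdeg w = d \<Longrightarrow> gen w \<in> free_deg V d"
  unfolding free_deg_def by (rule fs.span_base) auto

lemma gen_free_sp: "w \<in> words V \<Longrightarrow> gen w \<in> free_sp V"
  unfolding free_sp_def by (rule fs.span_base) auto

lemma free_deg_subset_free_sp: "free_deg V d \<subseteq> free_sp V"
  unfolding free_deg_def free_sp_def by (rule fs.span_mono) auto

lemma graded_vs_in:
  assumes "graded_vs sc V"
  shows "vector_space sc" "0 \<in> V i" "a \<in> V i \<Longrightarrow> b \<in> V i \<Longrightarrow> a + b \<in> V i" "a \<in> V i \<Longrightarrow> sc c a \<in> V i"
proof -
  from assms interpret vector_space sc by (simp add: graded_vs_def)
  show "vector_space sc" ..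
  show "0 \<in> V i" "a \<in> V i \<Longrightarrow> b \<in> V i \<Longrightarrow> a + b \<in> V i" "a \<in> V i \<Longrightarrow> sc c a \<in> V i"
    using assms by (auto simp: graded_vs_def subspace_def)
qed

lemma rel_gen_homogeneous:
  assumes "graded_vs sc V" "rel_gen sc V m d r"
  shows "r \<in> fspan (gen ` {w \<in> words V. wdeg w = d \<and> length w = m})"
  using assms(2)
  by cases
    (auto intro!: fs.span_diff fs.span_scale fs_subspace_signed fs.subspace_span intro: fs.span_base
      simp: words_iff graded_vs_in(3,4)[OF assms(1)])

lemma rel_gen_free_deg:
  assumes "graded_vs sc V" "rel_gen sc V m d r"
  shows "r \<in> free_deg V d"
  using rel_gen_homogeneous[OF assms] unfolding free_deg_def
  by (rule subsetD[OF fs.span_mono, rotated]) auto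

text \<open>The relations form an ideal for concatenation, because the surrounding words can be
  absorbed into \<open>xs\<close> and \<open>ys\<close>.\<close>

lemma rel_gen_append:
  assumes "rel_gen sc V m d r" "u \<in> hlists V" "w \<in> hlists V"
  shows "lin_extend (\<lambda>v. gen (u @ v @ w)) r \<in> sym_rel sc V"
  using assms(1)
proof cases
  case (rel_gen_add xs ys a i b)
  show ?thesis
    unfolding rel_gen_add fl_simps[OF flinear_lin_extend] lin_extend_gen
    using rel_gen.rel_gen_add[of "u @ xs" V "ys @ w" a i b sc] rel_gen_add assms
    by (auto intro: rel_gen_sym_rel)
next
  case (rel_gen_scale xs ys a i c)
  show ?thesis
    unfolding rel_gen_scale fl_simps[OF flinear_lin_extend] lin_extend_gen
    using rel_gen.rel_gen_scale[of "u @ xs" V "ys @ w" a i sc c] rel_gen_scale assms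
    by (auto intro: rel_gen_sym_rel)
next
  case (rel_gen_swap xs ys a i b j)
  show ?thesis
    unfolding rel_gen_swap fl_simps[OF flinear_lin_extend] flinear_signed[OF flinear_lin_extend] lin_extend_gen
    using rel_gen.rel_gen_swap[of "u @ xs" V "ys @ w" a i b j sc] rel_gen_swap assms
    by (auto intro: rel_gen_sym_rel)
qed

lemma sym_rel_append:
  assumes "r \<in> sym_rel sc V" "u \<in> hlists V" "w \<in> hlists V"
  shows "lin_extend (\<lambda>v. gen (u @ v @ w)) r \<in> sym_rel sc V"
  by (rule flinear_span_in[OF flinear_lin_extend subspace_sym_rel _ assms(1)[unfolded sym_rel_eq]])
    (use rel_gen_append assms in blast)

lemma flinear_tens_in:
  assumes "flinear h" "fs.subspace S" "x \<in> fspan A" "y \<in> fspan B"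
    and "\<And>a b. a \<in> A \<Longrightarrow> b \<in> B \<Longrightarrow> h (tens a b) \<in> S"
  shows "h (tens x y) \<in> S"
  by (rule flinear_span_in[OF flinear_compose[OF flinear_tens_left assms(1)] assms(2) _ assms(3)],
      rule flinear_span_in[OF flinear_compose[OF flinear_tens_right assms(1)] assms(2) _ assms(4)])
    (rule assms(5))

lemma flinear_sym_rel2_in:
  assumes "flinear h" "fs.subspace S" "x \<in> sym_rel2 sc V"
    and "\<And>m d r w. rel_gen sc V m d r \<Longrightarrow> w \<in> words V \<Longrightarrow> h (tens r (gen w)) \<in> S"
    and "\<And>m d r w. rel_gen sc V m d r \<Longrightarrow> w \<in> words V \<Longrightarrow> h (tens (gen w) r) \<in> S"
  shows "h x \<in> S"
proof (rule flinear_span_in[OF assms(1,2) _ assms(3)[unfolded sym_rel2_def]])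
  fix z assume "z \<in> {tens r y |r y. r \<in> sym_rel sc V \<and> y \<in> free_sp V} \<union> {tens y r |r y. r \<in> sym_rel sc V \<and> y \<in> free_sp V}"
  then consider r y where "z = tens r y" "r \<in> sym_rel sc V" "y \<in> free_sp V"
    | r y where "z = tens y r" "r \<in> sym_rel sc V" "y \<in> free_sp V" by blast
  then show "h z \<in> S"
  proof cases
    case 1
    show ?thesis unfolding 1(1)
      by (rule flinear_tens_in[OF assms(1,2) 1(2)[unfolded sym_rel_eq] 1(3)[unfolded free_sp_def]]) (use assms(4) in blast)
  next
    case 2
    show ?thesis unfolding 2(1)
      by (rule flinear_tens_in[OF assms(1,2) 2(3)[unfolded free_sp_def] 2(2)[unfolded sym_rel_eq]]) (use assms(5) in blast)
  qed
qed

lemma tens_sym_rel2: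
  assumes "r \<in> sym_rel sc V" "y \<in> free_sp V"
  shows "tens r y \<in> sym_rel2 sc V" "tens y r \<in> sym_rel2 sc V"
  unfolding sym_rel2_def by (rule fs.span_base, use assms in blast)+

section \<open>The projection onto the linear part\<close>

lemma vector_space_simps:
  assumes "vector_space sc"
  shows "sc 0 v = 0" "sc c 0 = 0" "sc 1 v = v" "sc c (sc d v) = sc (c * d) v"
    "sc c (u + v) = sc c u + sc c v" "sc (- c) v = - sc c v" "sc c (- v) = - sc c v"
proof -
  interpret vector_space sc by fact
  show "sc 0 v = 0" "sc c 0 = 0" "sc 1 v = v" "sc c (sc d v) = sc (c * d) v"
    "sc c (u + v) = sc c u + sc c v" "sc (- c) v = - sc c v" "sc c (- v) = - sc c v"
    by (simp_all add: scale_right_distrib)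
qed

lemma pr1_superset:
  assumes "vector_space sc" "finite A" "Poly_Mapping.keys x \<subseteq> A"
  shows "pr1 sc x = (\<Sum>w\<in>A. if length w = 1 then sc (Poly_Mapping.lookup x w) (snd (hd w)) else 0)"
  unfolding pr1_def
  by (rule sum.mono_neutral_left)
    (use assms vector_space_simps[OF assms(1)] in \<open>auto simp: in_keys_iff\<close>)

lemma pr1_linear:
  assumes "vector_space (sc :: 'k::field \<Rightarrow> 'v::ab_group_add \<Rightarrow> 'v)"
  shows "Vector_Spaces.linear fscale sc (pr1 sc)"
proof -
  interpret vector_space sc by fact
  have "pr1 sc (x + y) = pr1 sc x + pr1 sc y" for x y :: "'v word \<Rightarrow>\<^sub>0 'k"
    by (subst (1 2 3) pr1_superset[OF assms, where A = "Poly_Mapping.keys x \<union> Poly_Mapping.keys y"])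
      (use Poly_Mapping.keys_add[of x y] in \<open>auto simp: lookup_add scale_left_distrib sum.distrib[symmetric] intro!: sum.cong\<close>)
  moreover have "pr1 sc (fscale c x) = sc c (pr1 sc x)" for c and x :: "'v word \<Rightarrow>\<^sub>0 'k"
  proof -
    have "Poly_Mapping.keys (fscale c x) \<subseteq> Poly_Mapping.keys x"
      by (auto simp: in_keys_iff lookup_fscale)
    then show ?thesis
      by (subst (1 2) pr1_superset[OF assms, where A = "Poly_Mapping.keys x"])
        (auto simp: lookup_fscale scale_sum_right intro!: sum.cong)
  qed
  ultimately show ?thesis
    by (simp add: Vector_Spaces.linear_iff vector_space_fscale assms)
qed

lemma pr1_simps:
  assumes "vector_space sc"
  shows "pr1 sc (x + y) = pr1 sc x + pr1 sc y" "pr1 sc (x - y) = pr1 sc x - pr1 sc y"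
    "pr1 sc (fscale c x) = sc c (pr1 sc x)" "pr1 sc 0 = 0" "pr1 sc (signed n x) = signed n (pr1 sc x)"
proof -
  interpret l: Vector_Spaces.linear fscale sc "pr1 sc" by (rule pr1_linear[OF assms])
  show "pr1 sc (x + y) = pr1 sc x + pr1 sc y" "pr1 sc (x - y) = pr1 sc x - pr1 sc y"
    "pr1 sc (fscale c x) = sc c (pr1 sc x)" "pr1 sc 0 = 0" "pr1 sc (signed n x) = signed n (pr1 sc x)"
    by (simp_all add: l.add l.diff l.scale l.zero l.neg signed_def)
qed

lemma pr1_gen:
  assumes "vector_space sc"
  shows "pr1 sc (gen w) = (if length w = 1 then snd (hd w) else 0)"
  by (simp add: pr1_def vector_space_simps[OF assms])

text \<open>Swaps and all longer relations contain no word of length one. On single letters, sums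
  and multiples are evaluated in the ambient vector space, where the relation becomes an
  identity.\<close>

lemma pr1_rel_gen:
  assumes "vector_space sc" "rel_gen sc V m d r"
  shows "pr1 sc r = 0"
  using assms(2) by cases (auto simp: pr1_simps[OF assms(1)] pr1_gen[OF assms(1)] vector_space_simps[OF assms(1)])

lemma pr1_sym_rel:
  assumes "vector_space sc" "r \<in> sym_rel sc V"
  shows "pr1 sc r = 0"
  using assms(2) unfolding sym_rel_eq
  by (induction rule: fs.span_induct_alt)
    (auto simp: pr1_simps[OF assms(1)] pr1_rel_gen[OF assms(1)] vector_space_simps[OF assms(1)])

lemma pr1_free_deg:
  assumes "graded_vs sc V" "x \<in> free_deg V d"
  shows "pr1 sc x \<in> V d"
  using assms(2) unfolding free_deg_def
proof (induction rule: fs.span_induct_alt)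
  case (step c x y)
  then obtain w where w: "x = gen w" "w \<in> words V" "wdeg w = d" by auto
  have "pr1 sc x \<in> V d"
  proof (cases "length w = 1")
    case True
    then obtain i v where "w = [(i, v)]" by (auto simp: length_Suc_conv)
    with w show ?thesis by (simp add: pr1_gen graded_vs_in[OF assms(1)] words_iff)
  next
    case False then show ?thesis using w by (simp add: pr1_gen graded_vs_in[OF assms(1)])
  qed
  with step show ?case
    by (simp add: pr1_simps graded_vs_in[OF assms(1)])
qed (simp add: pr1_simps graded_vs_in[OF assms(1)])

section \<open>Elements with vanishing reduced coproduct\<close>

text \<open>The product of the symmetric algebra, lifted to words as concatenation.\<close>

definition mult_words :: "('v word \<times> 'v word \<Rightarrow>\<^sub>0 'k::field) \<Rightarrow> ('v word \<Rightarrow>\<^sub>0 'k)"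
  where "mult_words = lin_extend (\<lambda>(a, b). gen (a @ b))"

lemma flinear_mult_words: "flinear mult_words"
  unfolding mult_words_def by (rule flinear_lin_extend)

lemma mult_words_gen [simp]: "mult_words (gen (a, b)) = gen (a @ b)"
  by (simp add: mult_words_def)

lemma mult_words_tens_left: "mult_words (tens r (gen w)) = lin_extend (\<lambda>v. gen ([] @ v @ w)) r"
  by (rule fun_cong[OF flinear_eqI[OF flinear_compose[OF flinear_tens_left flinear_mult_words] flinear_lin_extend]]) simp

lemma mult_words_tens_right: "mult_words (tens (gen w) r) = lin_extend (\<lambda>v. gen (w @ v @ [])) r"
  by (rule fun_cong[OF flinear_eqI[OF flinear_compose[OF flinear_tens_right flinear_mult_words] flinear_lin_extend]]) simp

lemma mult_words_sym_rel2: "x \<in> sym_rel2 sc V \<Longrightarrow> mult_words x \<in> sym_rel sc V"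
  by (rule flinear_sym_rel2_in[OF flinear_mult_words subspace_sym_rel])
    (auto simp: mult_words_tens_left mult_words_tens_right words_iff simp del: append.simps append_Nil2 intro!: rel_gen_append)

text \<open>Repeated adjacent swaps. The sign is the one that \<open>unsh\<close> attaches to a
  letter sent to the right part, so multiplying the parts together cancels it.\<close>

lemma move_letter:
  assumes "a \<in> hlists V" "b \<in> hlists V" "v \<in> V i"
  shows "signed (i * wdeg a) (gen (a @ (i, v) # b)) - gen ((i, v) # a @ b) \<in> sym_rel sc V"
  using assms(1)
proof (induction a)
  case (Cons y a)
  obtain j u where y: "y = (j, u)" by (cases y)
  have s: "signed (i * wdeg a) (gen (a @ (i, v) # b)) - gen ((i, v) # a @ b) \<in> sym_rel sc V"
    using Cons y by simp
  have "signed (i * j) (signed (i * wdeg a) (gen (y # a @ (i, v) # b)) - gen (y # (i, v) # a @ b)) \<in> sym_rel sc V"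
    using fs_subspace_signed[OF subspace_sym_rel sym_rel_append[OF s, of "[y]" "[]"]] Cons y
    by (simp add: fl_simps[OF flinear_lin_extend] flinear_signed[OF flinear_lin_extend])
  moreover have "gen ([] @ (i, v) # (j, u) # (a @ b)) - signed (i * j) (gen ([] @ (j, u) # (i, v) # (a @ b))) \<in> sym_rel sc V"
    by (rule rel_gen_sym_rel, rule rel_gen_swap) (use Cons y assms in auto)
  ultimately show ?case
    using fs.subspace_diff[OF subspace_sym_rel] y
    by (fastforce simp: signed_diff algebra_simps)
qed (simp add: fs.subspace_0[OF subspace_sym_rel])

text \<open>Each of the \<open>2 ^ length w\<close> unshuffles multiplies back to \<open>w\<close>
  modulo the relations. In the induction the first letter is either already in front or is brought
  there by \<open>move_letter\<close>, and this doubles the count.\<close>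

lemma unsh_mult:
  fixes sc :: "'k::field \<Rightarrow> 'v::ab_group_add \<Rightarrow> 'v"
  assumes "w \<in> hlists V"
  shows "unsh (\<lambda>a b. gen (a @ b)) w - fscale (2 ^ length w) (gen w) \<in> sym_rel sc V"
  using assms
proof (induction w)
  case (Cons x w)
  obtain i v where x: "x = (i, v)" by (cases x)
  let ?p = "lin_extend (\<lambda>v. gen ([x] @ v @ []))"
  have "?p (unsh (\<lambda>a b. gen (a @ b)) w - fscale (2 ^ length w) (gen w)) \<in> sym_rel sc V"
    using Cons x by (intro sym_rel_append) auto
  then have 1: "unsh (\<lambda>a b. gen (x # a @ b)) w - fscale (2 ^ length w) (gen (x # w)) \<in> sym_rel sc V"
    by (simp add: fl_simps[OF flinear_lin_extend] unsh_hom[OF flinear_additive[OF flinear_lin_extend]])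
  have 2: "unsh (\<lambda>a b. signed (fst x * wdeg a) (gen (a @ x # b)) - gen (x # a @ b)) w \<in> sym_rel sc V"
    by (rule unsh_in[OF subspace_sym_rel]) (use Cons x hlists_mset in \<open>auto intro!: move_letter\<close>)
  have "unsh (\<lambda>a b. gen (a @ b)) (x # w) - fscale (2 ^ length (x # w)) (gen (x # w) :: _ \<Rightarrow>\<^sub>0 'k) =
    (unsh (\<lambda>a b. gen (x # a @ b)) w - fscale (2 ^ length w) (gen (x # w))) +
    (unsh (\<lambda>a b. gen (x # a @ b)) w - fscale (2 ^ length w) (gen (x # w))) +
    unsh (\<lambda>a b. signed (fst x * wdeg a) (gen (a @ x # b)) - gen (x # a @ b)) w"
    unfolding unsh.simps unsh_add unsh_diff append_Cons length_Cons power_Suc mult_2 fs.scale_left_distrib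
    by simp
  then show ?case
    using 1 2 by (simp only: fs.subspace_add[OF subspace_sym_rel])
qed (simp add: fs.subspace_0[OF subspace_sym_rel])

text \<open>Splits off the two trivial unshuffles, which the reduced coproduct omits.\<close>

lemma unsh_reduce:
  assumes "w \<noteq> []"
  shows "unsh f w = unsh (\<lambda>a b. if a = [] \<or> b = [] then 0 else f a b) w + f [] w + f w []"
proof -
  have "f [] w + f w [] = unsh (\<lambda>a b. (if a = [] then f [] b else 0) + (if b = [] then f a [] else 0)) w"
    by (simp add: unsh_add unsh_Nil_left unsh_Nil_right)
  also have "\<dots> + unsh (\<lambda>a b. if a = [] \<or> b = [] then 0 else f a b) w = unsh f w"
    unfolding unsh_add[symmetric] using assms by (intro unsh_cong) auto
  finally show ?thesis by (simp add: algebra_simps)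
qed

lemma flinear_coprod: "flinear coprod"
  unfolding coprod_def by (rule flinear_lin_extend)

lemma flinear_coprod_gen:
  assumes "flinear h"
  shows "h (coprod (gen w)) = unsh (\<lambda>a b. if a = [] \<or> b = [] then 0 else h (gen (a, b))) w"
  unfolding coprod_gen unsh_hom[OF flinear_additive[OF assms]]
  by (rule unsh_cong) (auto simp: fl_simps[OF assms])

lemma mult_coprod:
  fixes sc :: "'k::field \<Rightarrow> 'v::ab_group_add \<Rightarrow> 'v"
  assumes "w \<in> words V"
  shows "mult_words (coprod (gen w)) - fscale (2 ^ length w - 2) (gen w) \<in> sym_rel sc V"
proof -
  let ?f = "\<lambda>a b. gen (a @ b) :: _ \<Rightarrow>\<^sub>0 'k"
  have w: "w \<noteq> []" using assms by (simp add: words_iff)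
  have "unsh ?f w = mult_words (coprod (gen w)) + gen w + gen w"
    unfolding flinear_coprod_gen[OF flinear_mult_words] mult_words_gen unsh_reduce[OF w, of ?f] by simp
  moreover have "fscale 2 (gen w) = gen w + (gen w :: _ \<Rightarrow>\<^sub>0 'k)"
    using fs.scale_left_distrib[of 1 1 "gen w :: _ \<Rightarrow>\<^sub>0 'k"] by simp
  ultimately have "mult_words (coprod (gen w)) + fscale 2 (gen w :: _ \<Rightarrow>\<^sub>0 'k) = unsh (\<lambda>a b. gen (a @ b)) w"
    by (simp add: add.assoc)
  then have e: "mult_words (coprod (gen w)) = unsh (\<lambda>a b. gen (a @ b)) w - fscale 2 (gen w :: _ \<Rightarrow>\<^sub>0 'k)"
    by (simp only: eq_diff_eq)
  have "mult_words (coprod (gen w)) - fscale (2 ^ length w - 2) (gen w) =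
      unsh (\<lambda>a b. gen (a @ b)) w - fscale (2 ^ length w) (gen w :: _ \<Rightarrow>\<^sub>0 'k)"
    unfolding fs.scale_left_diff_distrib e by simp
  then show ?thesis
    using unsh_mult[of w V sc] assms by (simp add: words_iff)
qed

text \<open>Modulo the relations, \<open>x\<close> is \<open>T (mult_words (coprod x))\<close> plus
  its part of length one. The first term is a relation if \<open>coprod x\<close> is one. The second
  collapses to a single letter by linearity, which is possible because all its letters have the same
  degree \<open>d\<close>.\<close>

lemma coprod_kernel:
  fixes sc :: "'k::field_char_0 \<Rightarrow> 'v::ab_group_add \<Rightarrow> 'v"
  assumes V: "graded_vs sc V" and x: "x \<in> free_deg V d" and c: "coprod x \<in> sym_rel2 sc V"
  shows "x - gen [(d, pr1 sc x)] \<in> sym_rel sc V"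
proof -
  note vs = graded_vs_in(1)[OF V]
  let ?R = "sym_rel sc V"
  \<comment> \<open>Divides the part of length \<open>m\<close> by \<open>2 ^ m - 2\<close> and
    discards length one, where this number is zero.\<close>
  define T :: "('v word \<Rightarrow>\<^sub>0 'k) \<Rightarrow> ('v word \<Rightarrow>\<^sub>0 'k)"
    where "T = lin_extend (\<lambda>w. if length w = 1 then 0 else fscale (inverse (2 ^ length w - 2)) (gen w))"
  define l1 :: "('v word \<Rightarrow>\<^sub>0 'k) \<Rightarrow> ('v word \<Rightarrow>\<^sub>0 'k)"
    where "l1 = lin_extend (\<lambda>w. if length w = 1 then gen w else 0)"
  have linT: "flinear T" and linl: "flinear l1"
    by (simp_all add: T_def l1_def flinear_lin_extend)
  \<comment> \<open>\<open>T\<close> respects the relations because each generating relation lives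
    in a single word length, where \<open>T\<close> is a scalar.\<close>
  have T: "T r \<in> ?R" if "r \<in> ?R" for r
  proof (rule flinear_span_in[OF linT subspace_sym_rel _ that[unfolded sym_rel_eq]])
    fix r assume "r \<in> {r. \<exists>m d. rel_gen sc V m d r}"
    then obtain m d where r: "rel_gen sc V m d r" by blast
    have "T r = fscale (if m = 1 then 0 else inverse (2 ^ m - 2)) r"
      by (rule flinear_eq_on_span[OF linT _ _ rel_gen_homogeneous[OF V r]])
        (auto simp: T_def intro!: flinearI simp: fs.scale_right_distrib mult.commute)
    then show "T r \<in> ?R"
      using rel_gen_sym_rel[OF r] by (simp add: fs.subspace_scale[OF subspace_sym_rel])
  qed
  have "x - T (mult_words (coprod x)) - l1 x \<in> ?R"
  proof (rule flinear_span_in[OF _ subspace_sym_rel _ x[unfolded free_deg_def]])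
    show "flinear (\<lambda>x. x - T (mult_words (coprod x)) - l1 x)"
      by (intro flinear_diff flinear_id flinear_compose[OF _ linT] flinear_compose[OF _ flinear_mult_words]
          flinear_coprod linl)
    fix b :: "'v word \<Rightarrow>\<^sub>0 'k"
    assume "b \<in> gen ` {w \<in> words V. wdeg w = d}"
    then obtain w where w: "b = gen w" "w \<in> words V" by auto
    have "T (mult_words (coprod b) - fscale (2 ^ length w - 2) (gen w)) \<in> ?R"
      unfolding w(1) by (rule T, rule mult_coprod[OF w(2)])
    moreover have "T (fscale (2 ^ length w - 2) (gen w)) = b - l1 b"
    proof (cases "length w = 1")
      case False
      then have "2 \<le> length w"
        using w(2) by (cases w) (auto simp: words_iff Suc_le_eq)
      then have "(2::nat) ^ 2 \<le> 2 ^ length w"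
        by (rule power_increasing) simp
      then have "(2::nat) ^ length w \<noteq> 2" by simp
      \<comment> \<open>Characteristic zero enters here: the inequality of natural numbers is
        transported to the field.\<close>
      then have "(of_nat (2 ^ length w) :: 'k) \<noteq> of_nat 2"
        by (subst of_nat_eq_iff)
      then have "(2::'k) ^ length w - 2 \<noteq> 0" by simp
      then show ?thesis
        using False by (simp add: w(1) T_def l1_def fl_simps[OF flinear_lin_extend] fs.scale_zero_right)
    qed (simp add: w(1) T_def l1_def fl_simps[OF flinear_lin_extend])
    ultimately have "T (mult_words (coprod b)) - (b - l1 b) \<in> ?R"
      by (simp add: fl_simps[OF linT])
    then show "b - T (mult_words (coprod b)) - l1 b \<in> ?R"
      using fs.subspace_neg[OF subspace_sym_rel] by (fastforce simp: algebra_simps)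
  qed
  moreover have "T (mult_words (coprod x)) \<in> ?R"
    by (intro T mult_words_sym_rel2 c)
  ultimately have 1: "x - l1 x \<in> ?R"
    using fs.subspace_add[OF subspace_sym_rel] by (fastforce simp: algebra_simps)
  have "pr1 sc x \<in> V d \<and> l1 x - gen [(d, pr1 sc x)] \<in> ?R"
    using x unfolding free_deg_def
  proof (induction rule: fs.span_induct_alt)
    case base
    \<comment> \<open>The letter with zero vector is not zero in the free space; scaling by 0 shows
      that it is a relation.\<close>
    have "gen ([] @ [(d, sc 0 0)]) - fscale 0 (gen ([] @ [(d, 0)])) \<in> ?R"
      by (rule rel_gen_sym_rel, rule rel_gen_scale) (auto simp: graded_vs_in[OF V])
    then show ?case
      using fs.subspace_neg[OF subspace_sym_rel]
      by (fastforce simp: fl_simps[OF linl] pr1_simps[OF vs] vector_space_simps[OF vs] graded_vs_in[OF V])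
  next
    case (step c b y)
    then obtain w where w: "b = gen w" "w \<in> words V" "wdeg w = d" by auto
    have y: "pr1 sc y \<in> V d" using step by blast
    have "pr1 sc b \<in> V d"
      using pr1_free_deg[OF V gen_free_deg[OF w(2,3)]] w(1) by simp
    then have "pr1 sc (fscale c b + y) \<in> V d"
      using y by (simp add: pr1_simps[OF vs] graded_vs_in[OF V])
    moreover have "l1 (fscale c b + y) - gen [(d, pr1 sc (fscale c b + y))] \<in> ?R"
    proof (cases "length w = 1")
      case False
      then have "l1 b = 0" "pr1 sc b = 0" by (simp_all add: w(1) l1_def pr1_gen[OF vs])
      then show ?thesis
        using step by (simp add: fl_simps[OF linl] pr1_simps[OF vs] vector_space_simps[OF vs])
    next
      case True
      then obtain v where v: "w = [(d, v)]" using w(3) by (auto simp: length_Suc_conv)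
      then have "v \<in> V d" using w by (simp add: words_iff)
      have "gen ([] @ [(d, sc c v + pr1 sc y)]) - gen ([] @ [(d, sc c v)]) - gen ([] @ [(d, pr1 sc y)]) \<in> ?R"
        by (rule rel_gen_sym_rel, rule rel_gen_add) (auto simp: graded_vs_in[OF V] \<open>v \<in> V d\<close> y)
      moreover have "gen ([] @ [(d, sc c v)]) - fscale c (gen ([] @ [(d, v)])) \<in> ?R"
        by (rule rel_gen_sym_rel, rule rel_gen_scale) (auto simp: \<open>v \<in> V d\<close>)
      moreover have b: "l1 b = gen [(d, v)]" "pr1 sc b = v"
        by (simp_all add: w(1) v l1_def pr1_gen[OF vs])
      have "l1 (fscale c b + y) - gen [(d, pr1 sc (fscale c b + y))] =
         (l1 y - gen [(d, pr1 sc y)])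
         - (gen ([] @ [(d, sc c v + pr1 sc y)]) - gen ([] @ [(d, sc c v)]) - gen ([] @ [(d, pr1 sc y)]))
         - (gen ([] @ [(d, sc c v)]) - fscale c (gen ([] @ [(d, v)])))"
        by (simp add: fl_simps[OF linl] pr1_simps[OF vs] b algebra_simps)
      ultimately show ?thesis
        using step.IH by (simp only: fs.subspace_diff[OF subspace_sym_rel])
    qed
    ultimately show ?case ..
  qed
  then have "l1 x - gen [(d, pr1 sc x)] \<in> ?R" ..
  from fs.subspace_add[OF subspace_sym_rel 1 this] show ?thesis by simp
qed

section \<open>The coproduct preserves the relations\<close>

lemma unsh_insert1:
  "unsh f (p @ x # s) = unsh (\<lambda>p1 p2. unsh (\<lambda>c d.
    signed (wdeg p2 * (fst x + wdeg c)) (f (p1 @ x # c) (p2 @ d)) +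
    signed (fst x * wdeg c + wdeg p2 * wdeg c) (f (p1 @ c) (p2 @ x # d))) s) p"
  by (simp add: unsh_append)

text \<open>The summands correspond to both marked letters going left, the two ways of separating
  them, and both going right.\<close>

lemma unsh_insert2:
  "unsh f (p @ x # y # s) = unsh (\<lambda>p1 p2. unsh (\<lambda>c d.
    signed (wdeg p2 * (fst x + fst y + wdeg c)) (f (p1 @ x # y # c) (p2 @ d)) +
    signed (fst y * wdeg c + wdeg p2 * (fst x + wdeg c)) (f (p1 @ x # c) (p2 @ y # d)) +
    signed (fst x * (fst y + wdeg c) + wdeg p2 * (fst y + wdeg c)) (f (p1 @ y # c) (p2 @ x # d)) +
    signed (fst y * wdeg c + fst x * wdeg c + wdeg p2 * wdeg c) (f (p1 @ c) (p2 @ x # y # d))) s) p"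
  by (simp add: unsh_append signed_add algebra_simps)

text \<open>The part of \<open>sym_rel2\<close> generated by relations shorter than
  \<open>m\<close>. Coproducts of relations of length \<open>m\<close> land here, since the opposite
  tensor factor is a nonempty word; this supports the induction in
  \<open>ext_hom_rel_gen\<close>.\<close>

definition lower_rel2 ::
  "('k::field \<Rightarrow> 'v::ab_group_add \<Rightarrow> 'v) \<Rightarrow> (int \<Rightarrow> 'v set) \<Rightarrow> nat \<Rightarrow> ('v word \<times> 'v word \<Rightarrow>\<^sub>0 'k) set"
  where "lower_rel2 sc V m = fspan
   ({tens r (gen w) | r w m' d. rel_gen sc V m' d r \<and> m' < m \<and> w \<in> words V} \<union>
    {tens (gen w) r | r w m' d. rel_gen sc V m' d r \<and> m' < m \<and> w \<in> words V})"

lemma subspace_lower_rel2: "fs.subspace (lower_rel2 sc V m)"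
  unfolding lower_rel2_def by (rule fs.subspace_span)

lemma lower_rel2I:
  assumes "rel_gen sc V m' d r" "w \<in> hlists V" "w \<noteq> [] \<Longrightarrow> m' < m"
  shows "w \<noteq> [] \<Longrightarrow> tens r (gen w) \<in> lower_rel2 sc V m"
    "w \<noteq> [] \<Longrightarrow> tens (gen w) r \<in> lower_rel2 sc V m"
  unfolding lower_rel2_def
  by (rule fs.span_base, rule UnI1, use assms in \<open>auto simp: words_iff\<close>)
    (rule fs.span_base, rule UnI2, use assms in \<open>auto simp: words_iff\<close>)

text \<open>One shape for both linearity relations: coefficients 1 and 1 give additivity,
  \<open>c\<close> and 0 give homogeneity. The marked letter goes left or right, and in both cases a
  shorter relation tensored with a word appears.\<close>

lemma coprod_letter_rel:
  fixes sc :: "'k::field \<Rightarrow> 'v::ab_group_add \<Rightarrow> 'v"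
  assumes r: "\<And>p s. p \<in> hlists V \<Longrightarrow> s \<in> hlists V \<Longrightarrow>
      rel_gen sc V (Suc (length p + length s)) (wdeg p + i + wdeg s)
        (gen (p @ (i, a0) # s) - fscale c1 (gen (p @ (i, a1) # s)) - fscale c2 (gen (p @ (i, a2) # s)))"
    and xs: "xs \<in> hlists V" and ys: "ys \<in> hlists V"
  shows "coprod (gen (xs @ (i, a0) # ys) - fscale c1 (gen (xs @ (i, a1) # ys)) - fscale c2 (gen (xs @ (i, a2) # ys)))
    \<in> lower_rel2 sc V (Suc (length xs + length ys))"
proof -
  let ?S = "lower_rel2 sc V (Suc (length xs + length ys))"
  let ?g = "\<lambda>a b. if a = [] \<or> b = [] then 0 else gen (a, b) :: _ \<Rightarrow>\<^sub>0 'k"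
  let ?l = "\<lambda>p1 p2 c d a. ?g (p1 @ (i, a) # c) (p2 @ d)"
  let ?r = "\<lambda>p1 p2 c d a. ?g (p1 @ c) (p2 @ (i, a) # d)"
  have scale: "fscale c (unsh f w) = unsh (\<lambda>a b. fscale c (f a b)) w" for c :: 'k and f :: "'v word \<Rightarrow> 'v word \<Rightarrow> 'v word \<times> 'v word \<Rightarrow>\<^sub>0 'k" and w
    by (rule unsh_hom) (unfold_locales, rule fs.scale_right_distrib)
  have sg: "signed n x0 + signed k y0 - fscale c1 (signed n x1 + signed k y1) - fscale c2 (signed n x2 + signed k y2) =
      signed n (x0 - fscale c1 x1 - fscale c2 x2) + signed k (y0 - fscale c1 y1 - fscale c2 y2)"
    for n k and x0 x1 x2 y0 y1 y2 :: "'v word \<times> 'v word \<Rightarrow>\<^sub>0 'k"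
    by (simp add: signed_def fs.scale_right_distrib)
  have "coprod (gen (xs @ (i, a0) # ys) - fscale c1 (gen (xs @ (i, a1) # ys)) - fscale c2 (gen (xs @ (i, a2) # ys))) =
    unsh (\<lambda>p1 p2. unsh (\<lambda>c d.
      signed (wdeg p2 * (i + wdeg c)) (?l p1 p2 c d a0 - fscale c1 (?l p1 p2 c d a1) - fscale c2 (?l p1 p2 c d a2)) +
      signed (i * wdeg c + wdeg p2 * wdeg c) (?r p1 p2 c d a0 - fscale c1 (?r p1 p2 c d a1) - fscale c2 (?r p1 p2 c d a2))) ys) xs"
    unfolding fl_simps[OF flinear_coprod] coprod_gen unsh_insert1 scale unsh_diff[symmetric] fst_conv
    by (intro unsh_cong refl) (rule sg)
  also have "\<dots> \<in> ?S"
  proof (rule unsh_in[OF subspace_lower_rel2], rule unsh_in[OF subspace_lower_rel2])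
    fix p1 p2 c d
    assume p: "mset p1 + mset p2 = mset xs" and c: "mset c + mset d = mset ys"
    have h: "p1 \<in> hlists V" "p2 \<in> hlists V" "c \<in> hlists V" "d \<in> hlists V"
      using xs ys hlists_mset[OF p] hlists_mset[OF c] by auto
    have "?l p1 p2 c d a0 - fscale c1 (?l p1 p2 c d a1) - fscale c2 (?l p1 p2 c d a2) \<in> ?S"
    proof (cases "p2 @ d = []")
      case False
      with lower_rel2I(1)[OF r[OF h(1,3)], of "p2 @ d" "Suc (length xs + length ys)"]
      show ?thesis
        using h mset_length[OF p] mset_length[OF c] by (auto simp: tens_left_simps)
    qed (simp add: fs.subspace_0[OF subspace_lower_rel2])
    moreover have "?r p1 p2 c d a0 - fscale c1 (?r p1 p2 c d a1) - fscale c2 (?r p1 p2 c d a2) \<in> ?S"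
    proof (cases "p1 @ c = []")
      case False
      with lower_rel2I(2)[OF r[OF h(2,4)], of "p1 @ c" "Suc (length xs + length ys)"]
      show ?thesis
        using h mset_length[OF p] mset_length[OF c] by (auto simp: tens_right_simps)
    qed (simp add: fs.subspace_0[OF subspace_lower_rel2])
    ultimately show "signed (wdeg p2 * (i + wdeg c)) (?l p1 p2 c d a0 - fscale c1 (?l p1 p2 c d a1) - fscale c2 (?l p1 p2 c d a2)) +
      signed (i * wdeg c + wdeg p2 * wdeg c) (?r p1 p2 c d a0 - fscale c1 (?r p1 p2 c d a1) - fscale c2 (?r p1 p2 c d a2)) \<in> ?S"
      by (intro fs.subspace_add[OF subspace_lower_rel2] fs_subspace_signed[OF subspace_lower_rel2])
  qed
  finally show ?thesis .
qed

text \<open>If both letters go to the same side, a shorter swap relation results. If they are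
  separated, the terms of the two words cancel, because the order of the letters is then no longer
  recorded.\<close>

lemma coprod_swap_rel:
  fixes sc :: "'k::field \<Rightarrow> 'v::ab_group_add \<Rightarrow> 'v"
  assumes a: "a \<in> V i" and b: "b \<in> V j" and xs: "xs \<in> hlists V" and ys: "ys \<in> hlists V"
  shows "coprod (gen (xs @ (i, a) # (j, b) # ys) - signed (i * j) (gen (xs @ (j, b) # (i, a) # ys)))
    \<in> lower_rel2 sc V (Suc (Suc (length xs + length ys)))"
proof -
  let ?S = "lower_rel2 sc V (Suc (Suc (length xs + length ys)))"
  let ?g = "\<lambda>a b. if a = [] \<or> b = [] then 0 else gen (a, b) :: _ \<Rightarrow>\<^sub>0 'k"
  let ?l = "\<lambda>p1 p2 c d. ?g (p1 @ (i, a) # (j, b) # c) (p2 @ d) - signed (i * j) (?g (p1 @ (j, b) # (i, a) # c) (p2 @ d))"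
  let ?r = "\<lambda>p1 p2 c d. ?g (p1 @ c) (p2 @ (i, a) # (j, b) # d) - signed (i * j) (?g (p1 @ c) (p2 @ (j, b) # (i, a) # d))"
  \<comment> \<open>\<open>x2\<close> and \<open>x3\<close> are the separated terms; they occur in
    the opposite order in the expansion of the swapped word. The four parity conditions say that
    they cancel and that the unseparated terms pair up.\<close>
  have sg: "signed n x1 + signed m x2 + signed m' x3 + signed k x4 -
      (signed (e + n') y1 + signed (e + l) x3 + signed (e + l') x2 + signed (e + k') y4) =
      signed n (x1 - signed e y1) + signed k (x4 - signed e y4)"
    if "even (n + n')" "even (m + (e + l'))" "even (m' + (e + l))" "even (k + k')"
    for n m m' k e n' l l' k' and x1 x2 x3 x4 y1 y4 :: "'v word \<times> 'v word \<Rightarrow>\<^sub>0 'k"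
    using that by (auto simp: signed_def algebra_simps)
  have "coprod (gen (xs @ (i, a) # (j, b) # ys) - signed (i * j) (gen (xs @ (j, b) # (i, a) # ys))) =
    unsh (\<lambda>p1 p2. unsh (\<lambda>c d. signed (wdeg p2 * (i + j + wdeg c)) (?l p1 p2 c d) +
      signed (j * wdeg c + i * wdeg c + wdeg p2 * wdeg c) (?r p1 p2 c d)) ys) xs"
    unfolding fl_simps[OF flinear_coprod] flinear_signed[OF flinear_coprod] coprod_gen unsh_insert2
      unsh_signed[symmetric] unsh_diff[symmetric] signed_add signed_signed fst_conv
    by (intro unsh_cong refl, rule sg) auto
  also have "\<dots> \<in> ?S"
  proof (rule unsh_in[OF subspace_lower_rel2], rule unsh_in[OF subspace_lower_rel2])
    fix p1 p2 c d
    assume p: "mset p1 + mset p2 = mset xs" and c: "mset c + mset d = mset ys"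
    have h: "p1 \<in> hlists V" "p2 \<in> hlists V" "c \<in> hlists V" "d \<in> hlists V"
      using xs ys hlists_mset[OF p] hlists_mset[OF c] by auto
    have "?l p1 p2 c d \<in> ?S"
    proof (cases "p2 @ d = []")
      case False
      with lower_rel2I(1)[OF rel_gen_swap[OF h(1,3) a b], of "p2 @ d" "Suc (Suc (length xs + length ys))" sc]
      show ?thesis
        using h mset_length[OF p] mset_length[OF c] by (auto simp: tens_left_simps flinear_signed[OF flinear_tens_left])
    qed (simp add: fs.subspace_0[OF subspace_lower_rel2])
    moreover have "?r p1 p2 c d \<in> ?S"
    proof (cases "p1 @ c = []")
      case False
      with lower_rel2I(2)[OF rel_gen_swap[OF h(2,4) a b], of "p1 @ c" "Suc (Suc (length xs + length ys))" sc]
      show ?thesis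
        using h mset_length[OF p] mset_length[OF c] by (auto simp: tens_right_simps flinear_signed[OF flinear_tens_right])
    qed (simp add: fs.subspace_0[OF subspace_lower_rel2])
    ultimately show "signed (wdeg p2 * (i + j + wdeg c)) (?l p1 p2 c d) +
      signed (j * wdeg c + i * wdeg c + wdeg p2 * wdeg c) (?r p1 p2 c d) \<in> ?S"
      by (intro fs.subspace_add[OF subspace_lower_rel2] fs_subspace_signed[OF subspace_lower_rel2])
  qed
  finally show ?thesis .
qed

lemma coprod_rel_gen:
  assumes "rel_gen sc V m d r"
  shows "coprod r \<in> lower_rel2 sc V m"
  using assms
proof cases
  case (rel_gen_add xs ys a i b)
  then show ?thesis
    using coprod_letter_rel[of V sc i "a + b" 1 a 1 b xs ys] rel_gen.rel_gen_add[of _ V _ a i b sc] by simp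
next
  case (rel_gen_scale xs ys a i c)
  then show ?thesis
    using coprod_letter_rel[of V sc i "sc c a" c a 0 a xs ys] rel_gen.rel_gen_scale[of _ V _ a i sc c] by simp
next
  case (rel_gen_swap xs ys a i b j)
  then show ?thesis
    using coprod_swap_rel[of a V i b j xs ys sc] by simp
qed

section \<open>Tensor products of maps\<close>

lemma flinear_tens_map: "flinear (tens_map e F G)"
  unfolding tens_map_def by (rule flinear_lin_extend)

lemma tens_map_gen: "tens_map e F G (gen (u, w)) = signed (e * wdeg u) (tens (F (gen u)) (G (gen w)))"
  by (simp add: tens_map_def fscale_signed)

text \<open>The Koszul sign depends on the degree of \<open>x\<close>, so homogeneity is required
  unless \<open>e\<close> is zero.\<close>

lemma tens_map_tens:
  fixes F :: "('v word \<Rightarrow>\<^sub>0 'k::field) \<Rightarrow> ('w word \<Rightarrow>\<^sub>0 'k)"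
  assumes F: "flinear F" and G: "flinear G" and x: "e = 0 \<or> x \<in> free_deg V d"
  shows "tens_map e F G (tens x y) = signed (e * d) (tens (F x) (G y))"
proof -
  have lin: "flinear (\<lambda>x. signed (e * d) (tens (F x) y'))" for y'
    using flinear_tens_left F by (intro flinearI) (simp_all add: fl_simps[OF F] tens_left_simps signed_def)
  have lin2: "flinear (\<lambda>y. signed (e * d) (tens (F x') (G y)))" for x'
    using F G by (intro flinearI) (simp_all add: fl_simps[OF G] tens_right_simps signed_def)
  obtain A where A: "x \<in> fspan (gen ` A)" "\<And>u. u \<in> A \<Longrightarrow> e = 0 \<or> wdeg u = d"
  proof (cases "e = 0")
    case True
    then show ?thesis using that[of UNIV] by (simp add: fspan_gen)
  next
    case False
    with x that[of "{w \<in> words V. wdeg w = d}"] show ?thesis by (simp add: free_deg_def)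
  qed
  show ?thesis
  proof (rule flinear_eq_on_span[OF flinear_compose[OF flinear_tens_left flinear_tens_map] lin _ A(1)])
    fix b :: "'v word \<Rightarrow>\<^sub>0 'k" assume "b \<in> gen ` A"
    then obtain u where u: "b = gen u" "e = 0 \<or> wdeg u = d" using A(2) by auto
    show "tens_map e F G (tens b y) = signed (e * d) (tens (F b) (G y))"
      by (rule fun_cong[OF flinear_eqI[OF flinear_compose[OF flinear_tens_right flinear_tens_map] lin2]])
        (use u in \<open>auto simp: tens_map_gen\<close>)
  qed
qed

lemma sym_homD:
  assumes "sym_hom sc V sc' V' e F"
  shows "flinear F" "x \<in> free_deg V d \<Longrightarrow> F x \<in> free_deg V' (d + e)"
    "x \<in> sym_rel sc V \<Longrightarrow> F x \<in> sym_rel sc' V'"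
  using assms by (auto simp: sym_hom_def)

lemma sym_hom_free_sp:
  assumes "sym_hom sc V sc' V' e F" "x \<in> free_sp V"
  shows "F x \<in> free_sp V'"
  by (rule flinear_span_in[OF sym_homD(1)[OF assms(1)] subspace_free_sp _ assms(2)[unfolded free_sp_def]])
    (use sym_homD(2)[OF assms(1) gen_free_deg[OF _ refl]] free_deg_subset_free_sp in blast)

lemma sym_hom_compose:
  assumes F: "sym_hom sc V sc' V' e F" and G: "sym_hom sc' V' sc'' V'' e' G"
  shows "sym_hom sc V sc'' V'' (e + e') (\<lambda>x. G (F x))"
  unfolding sym_hom_def
  using sym_homD[OF F] sym_homD[OF G] flinear_compose[of F G] by (auto simp: add.assoc[symmetric])

lemma sym_hom_id: "sym_hom sc V sc V 0 id"
  by (simp add: sym_hom_def fs.linear_id)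

lemma tens_map_sym_rel2:
  assumes V: "graded_vs sc V" and F: "sym_hom sc V sc' V' e1 F" and G: "sym_hom sc V sc' V' e2 G"
    and x: "x \<in> sym_rel2 sc V"
  shows "tens_map e F G x \<in> sym_rel2 sc' V'"
proof (rule flinear_sym_rel2_in[OF flinear_tens_map subspace_sym_rel2 x])
  fix m d r w assume r: "rel_gen sc V m d r" and w: "w \<in> words V"
  have r': "F r \<in> sym_rel sc' V'" "G r \<in> sym_rel sc' V'"
    using sym_homD(3)[OF F] sym_homD(3)[OF G] rel_gen_sym_rel[OF r] by auto
  have w': "F (gen w) \<in> free_sp V'" "G (gen w) \<in> free_sp V'"
    using sym_hom_free_sp[OF F] sym_hom_free_sp[OF G] gen_free_sp[OF w] by auto
  show "tens_map e F G (tens r (gen w)) \<in> sym_rel2 sc' V'"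
    unfolding tens_map_tens[OF sym_homD(1)[OF F] sym_homD(1)[OF G] disjI2[OF rel_gen_free_deg[OF V r]]]
    by (rule fs_subspace_signed[OF subspace_sym_rel2 tens_sym_rel2(1)[OF r'(1) w'(2)]])
  show "tens_map e F G (tens (gen w) r) \<in> sym_rel2 sc' V'"
    unfolding tens_map_tens[OF sym_homD(1)[OF F] sym_homD(1)[OF G] disjI2[OF gen_free_deg[OF w refl]]]
    by (rule fs_subspace_signed[OF subspace_sym_rel2 tens_sym_rel2(2)[OF r'(2) w'(1)]])
qed

lemma tens_map_coprod_gen:
  "tens_map e F G (coprod (gen w)) =
    unsh (\<lambda>a b. if a = [] \<or> b = [] then 0 else signed (e * wdeg a) (tens (F (gen a)) (G (gen b)))) w"
  unfolding flinear_coprod_gen[OF flinear_tens_map] tens_map_gen ..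

section \<open>Uniqueness of coalgebra morphisms and coderivations\<close>

lemma gen_zero_sym_rel:
  assumes "graded_vs sc V"
  shows "gen [(d, 0)] \<in> sym_rel sc V"
proof -
  have "gen ([] @ [(d, sc 0 0)]) - fscale 0 (gen ([] @ [(d, 0)])) \<in> sym_rel sc V"
    by (rule rel_gen_sym_rel, rule rel_gen_scale) (auto simp: graded_vs_in[OF assms])
  then show ?thesis by (simp add: vector_space_simps[OF graded_vs_in(1)[OF assms]])
qed

lemma coprod_pr1_kernel:
  fixes sc :: "'k::field_char_0 \<Rightarrow> 'v::ab_group_add \<Rightarrow> 'v"
  assumes "graded_vs sc V" "x \<in> free_deg V d" "coprod x \<in> sym_rel2 sc V" "pr1 sc x = 0"
  shows "x \<in> sym_rel sc V"
  using coprod_kernel[OF assms(1-3)] gen_zero_sym_rel[OF assms(1), of d] assms(4)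
  by (simp add: sym_rel_cong)

lemma subspace_add_diff:
  "fs.subspace S \<Longrightarrow> x \<in> S \<Longrightarrow> y \<in> S \<Longrightarrow> z \<in> S \<Longrightarrow> x + y - z \<in> S"
  by (simp add: fs.subspace_add fs.subspace_diff)

text \<open>The common pattern of both uniqueness proofs: by induction on word length the coproduct
  of \<open>H (gen w)\<close> is a relation, and an element with neither coproduct nor linear part
  is zero in the quotient.\<close>

lemma hom_vanish:
  fixes sc' :: "'k::field_char_0 \<Rightarrow> 'v::ab_group_add \<Rightarrow> 'v"
  assumes V': "graded_vs sc' V'" and H: "flinear H"
    and deg: "\<And>w. w \<in> words V \<Longrightarrow> H (gen w) \<in> free_deg V' (wdeg w + e)"
    and pr: "\<And>w. w \<in> words V \<Longrightarrow> pr1 sc' (H (gen w)) = 0"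
    and step: "\<And>w. w \<in> words V \<Longrightarrow>
      (\<And>u. u \<in> words V \<Longrightarrow> length u < length w \<Longrightarrow> H (gen u) \<in> sym_rel sc' V') \<Longrightarrow>
      coprod (H (gen w)) \<in> sym_rel2 sc' V'"
    and x: "x \<in> free_sp V"
  shows "H x \<in> sym_rel sc' V'"
proof (rule flinear_span_in[OF H subspace_sym_rel _ x[unfolded free_sp_def]])
  have "H (gen w) \<in> sym_rel sc' V'" if "w \<in> words V" for w
    using that
    by (induction w rule: length_induct) (rule coprod_pr1_kernel[OF V' deg step pr]; blast)
  then show "H b \<in> sym_rel sc' V'" if "b \<in> gen ` words V" for b
    using that by blast
qed

lemma words_mset:
  assumes "w \<in> words V" "mset a + mset b = mset w" "a \<noteq> []" "b \<noteq> []"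
  shows "a \<in> words V" "b \<in> words V" "length a < length w" "length b < length w"
  using assms hlists_mset[OF assms(2), of V] mset_length[OF assms(2)] by (auto simp: words_iff)

lemma coalg_hom_unique:
  fixes sc' :: "'k::field_char_0 \<Rightarrow> 'v::ab_group_add \<Rightarrow> 'v"
  assumes V': "graded_vs sc' V'"
    and A: "coalg_hom sc V sc' V' A" and B: "coalg_hom sc V sc' V' B"
    and pr: "\<And>w. w \<in> words V \<Longrightarrow> pr1 sc' (A (gen w)) = pr1 sc' (B (gen w))"
    and x: "x \<in> free_sp V"
  shows "A x - B x \<in> sym_rel sc' V'"
proof (rule hom_vanish[OF V' flinear_diff _ _ _ x, where e = 0])
  have sA: "sym_hom sc V sc' V' 0 A" and sB: "sym_hom sc V sc' V' 0 B"
    using A B by (auto simp: coalg_hom_def)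
  show linA: "flinear A" and linB: "flinear B" using sA sB by (auto dest: sym_homD)
  fix w assume w: "w \<in> words V"
  show "A (gen w) - B (gen w) \<in> free_deg V' (wdeg w + 0)"
    using sA sB gen_free_deg[OF w refl] by (auto dest: sym_homD(2) intro!: fs.subspace_diff[OF subspace_free_deg])
  show "pr1 sc' (A (gen w) - B (gen w)) = 0"
    by (simp add: pr1_simps[OF graded_vs_in(1)[OF V']] pr[OF w])
  assume IH: "\<And>u. u \<in> words V \<Longrightarrow> length u < length w \<Longrightarrow> A (gen u) - B (gen u) \<in> sym_rel sc' V'"
  have "tens_map 0 A A (coprod (gen w)) - tens_map 0 B B (coprod (gen w)) \<in> sym_rel2 sc' V'"
    unfolding tens_map_coprod_gen unsh_diff[symmetric]
  proof (rule unsh_in[OF subspace_sym_rel2])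
    fix a b assume m: "mset a + mset b = mset w"
    show "(if a = [] \<or> b = [] then 0 else signed (0 * wdeg a) (tens (A (gen a)) (A (gen b)))) -
        (if a = [] \<or> b = [] then 0 else signed (0 * wdeg a) (tens (B (gen a)) (B (gen b)))) \<in> sym_rel2 sc' V'"
    proof (cases "a = [] \<or> b = []")
      case False
      then have ab: "a \<in> words V" "b \<in> words V" "length a < length w" "length b < length w"
        using words_mset[OF w m] by auto
      \<comment> \<open>The difference of \<open>A \<otimes> A\<close> and
        \<open>B \<otimes> B\<close> is \<open>(A - B) \<otimes> A\<close> plus
        \<open>B \<otimes> (A - B)\<close>; both factors of a reduced splitting are shorter, so the
        induction hypothesis applies.\<close>
      have "tens (A (gen a) - B (gen a)) (A (gen b)) + tens (B (gen a)) (A (gen b) - B (gen b)) \<in> sym_rel2 sc' V'"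
        using IH ab sym_hom_free_sp[OF sA gen_free_sp] sym_hom_free_sp[OF sB gen_free_sp]
        by (intro fs.subspace_add[OF subspace_sym_rel2] tens_sym_rel2) auto
      with False show ?thesis by (simp add: tens_left_simps tens_right_simps)
    qed (auto simp: fs.subspace_0[OF subspace_sym_rel2])
  qed
  moreover have "coprod (A (gen w)) - tens_map 0 A A (coprod (gen w)) \<in> sym_rel2 sc' V'"
    "coprod (B (gen w)) - tens_map 0 B B (coprod (gen w)) \<in> sym_rel2 sc' V'"
    using A B gen_free_sp[OF w] by (auto simp: coalg_hom_def)
  ultimately have "(coprod (A (gen w)) - tens_map 0 A A (coprod (gen w))) +
     (tens_map 0 A A (coprod (gen w)) - tens_map 0 B B (coprod (gen w))) -
     (coprod (B (gen w)) - tens_map 0 B B (coprod (gen w))) \<in> sym_rel2 sc' V'"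
    using subspace_add_diff[OF subspace_sym_rel2] by blast
  then show "coprod (A (gen w) - B (gen w)) \<in> sym_rel2 sc' V'"
    by (simp add: fl_simps[OF flinear_coprod])
qed

lemma coderivation_unique:
  fixes sc :: "'k::field_char_0 \<Rightarrow> 'v::ab_group_add \<Rightarrow> 'v"
  assumes V: "graded_vs sc V"
    and A: "coderivation sc V A" and B: "coderivation sc V B"
    and pr: "\<And>w. w \<in> words V \<Longrightarrow> pr1 sc (A (gen w)) = pr1 sc (B (gen w))"
    and x: "x \<in> free_sp V"
  shows "A x - B x \<in> sym_rel sc V"
proof (rule hom_vanish[OF V flinear_diff _ _ _ x, where e = "-1"])
  have sA: "sym_hom sc V sc V (-1) A" and sB: "sym_hom sc V sc V (-1) B"
    using A B by (auto simp: coderivation_def)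
  show linA: "flinear A" and linB: "flinear B" using sA sB by (auto dest: sym_homD)
  fix w assume w: "w \<in> words V"
  show "A (gen w) - B (gen w) \<in> free_deg V (wdeg w + -1)"
    using sA sB gen_free_deg[OF w refl] by (intro fs.subspace_diff[OF subspace_free_deg] sym_homD(2))
  show "pr1 sc (A (gen w) - B (gen w)) = 0"
    by (simp add: pr1_simps[OF graded_vs_in(1)[OF V]] pr[OF w])
  assume IH: "\<And>u. u \<in> words V \<Longrightarrow> length u < length w \<Longrightarrow> A (gen u) - B (gen u) \<in> sym_rel sc V"
  let ?c = "\<lambda>A. tens_map 0 A id (coprod (gen w)) + tens_map (-1) id A (coprod (gen w))"
  have "?c A - ?c B \<in> sym_rel2 sc V"
    unfolding tens_map_coprod_gen unsh_diff[symmetric] unsh_add[symmetric]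
  proof (rule unsh_in[OF subspace_sym_rel2])
    fix a b assume m: "mset a + mset b = mset w"
    let ?t = "\<lambda>A. (if a = [] \<or> b = [] then 0 else signed (0 * wdeg a) (tens (A (gen a)) (id (gen b)))) +
        (if a = [] \<or> b = [] then 0 else signed (- 1 * wdeg a) (tens (id (gen a)) (A (gen b))))"
    show "?t A - ?t B \<in> sym_rel2 sc V"
    proof (cases "a = [] \<or> b = []")
      case False
      then have ab: "a \<in> words V" "b \<in> words V" "length a < length w" "length b < length w"
        using words_mset[OF w m] by auto
      \<comment> \<open>The coderivation formula is linear in the map, so the difference needs no
        mixed terms.\<close>
      have "tens (A (gen a) - B (gen a)) (gen b) + signed (- 1 * wdeg a) (tens (gen a) (A (gen b) - B (gen b))) \<in> sym_rel2 sc V"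
        using IH ab gen_free_sp
        by (intro fs.subspace_add[OF subspace_sym_rel2] fs_subspace_signed[OF subspace_sym_rel2] tens_sym_rel2) auto
      with False show ?thesis by (simp add: tens_left_simps tens_right_simps signed_diff algebra_simps)
    qed (auto simp: fs.subspace_0[OF subspace_sym_rel2])
  qed
  moreover have "coprod (A (gen w)) - ?c A \<in> sym_rel2 sc V" "coprod (B (gen w)) - ?c B \<in> sym_rel2 sc V"
    using A B gen_free_sp[OF w] by (auto simp: coderivation_def)
  ultimately have "(coprod (A (gen w)) - ?c A) + (?c A - ?c B) - (coprod (B (gen w)) - ?c B) \<in> sym_rel2 sc V"
    using subspace_add_diff[OF subspace_sym_rel2] by blast
  then show "coprod (A (gen w) - B (gen w)) \<in> sym_rel2 sc V"
    by (simp add: fl_simps[OF flinear_coprod])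
qed

section \<open>The coalgebra morphism with given components\<close>

text \<open>The counterpart of \<open>skew_maps\<close> on the suspension, where all components
  share one degree \<open>e\<close> and swaps carry the plain Koszul sign.\<close>

definition sym_maps ::
  "('k::field \<Rightarrow> 'v::ab_group_add \<Rightarrow> 'v) \<Rightarrow> (int \<Rightarrow> 'v set) \<Rightarrow>
   ('k \<Rightarrow> 'w::ab_group_add \<Rightarrow> 'w) \<Rightarrow> (int \<Rightarrow> 'w set) \<Rightarrow> int \<Rightarrow> ('v word \<Rightarrow> 'w) \<Rightarrow> bool"
  where "sym_maps sc V sc' V' e q \<longleftrightarrow>
    (\<forall>w \<in> words V. q w \<in> V' (wdeg w + e)) \<and>
    (\<forall>xs \<in> hlists V. \<forall>ys \<in> hlists V. \<forall>i. \<forall>a \<in> V i. \<forall>b \<in> V i.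
       q (xs @ (i, a + b) # ys) = q (xs @ (i, a) # ys) + q (xs @ (i, b) # ys)) \<and>
    (\<forall>xs \<in> hlists V. \<forall>ys \<in> hlists V. \<forall>i. \<forall>a \<in> V i. \<forall>c.
       q (xs @ (i, sc c a) # ys) = sc' c (q (xs @ (i, a) # ys))) \<and>
    (\<forall>xs \<in> hlists V. \<forall>ys \<in> hlists V. \<forall>i j. \<forall>a \<in> V i. \<forall>b \<in> V j.
       q (xs @ (i, a) # (j, b) # ys) = signed (i * j) (q (xs @ (j, b) # (i, a) # ys)))"

lemma sym_mapsD:
  assumes "sym_maps sc V sc' V' e q"
  shows "w \<in> words V \<Longrightarrow> q w \<in> V' (wdeg w + e)"
    and "xs \<in> hlists V \<Longrightarrow> ys \<in> hlists V \<Longrightarrow> a \<in> V i \<Longrightarrow> b \<in> V i \<Longrightarrow>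
       q (xs @ (i, a + b) # ys) = q (xs @ (i, a) # ys) + q (xs @ (i, b) # ys)"
    and "xs \<in> hlists V \<Longrightarrow> ys \<in> hlists V \<Longrightarrow> a \<in> V i \<Longrightarrow>
       q (xs @ (i, sc c a) # ys) = sc' c (q (xs @ (i, a) # ys))"
    and "xs \<in> hlists V \<Longrightarrow> ys \<in> hlists V \<Longrightarrow> a \<in> V i \<Longrightarrow> b \<in> V j \<Longrightarrow>
       q (xs @ (i, a) # (j, b) # ys) = signed (i * j) (q (xs @ (j, b) # (i, a) # ys))"
  using assms unfolding sym_maps_def by blast+

text \<open>Reading off components: \<open>pr1\<close> kills relations, so each relation preserved
  by \<open>H\<close> becomes an identity between its components. This yields the new brackets and
  the components of the isomorphism.\<close>

lemma sym_maps_hom: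
  assumes V: "graded_vs sc V" and V': "graded_vs sc' V'" and H: "sym_hom sc V sc' V' e H"
  shows "sym_maps sc V sc' V' e (\<lambda>w. pr1 sc' (H (gen w)))"
proof -
  note vs = graded_vs_in(1)[OF V']
  have rel: "pr1 sc' (H r) = 0" if "rel_gen sc V m d r" for m d r
    by (rule pr1_sym_rel[OF vs sym_homD(3)[OF H rel_gen_sym_rel[OF that]]])
  note h = fl_simps[OF sym_homD(1)[OF H]] flinear_signed[OF sym_homD(1)[OF H]] pr1_simps[OF vs]
  show ?thesis
    unfolding sym_maps_def
  proof (intro conjI ballI allI)
    fix w assume "w \<in> words V"
    then show "pr1 sc' (H (gen w)) \<in> V' (wdeg w + e)"
      by (intro pr1_free_deg[OF V'] sym_homD(2)[OF H] gen_free_deg) auto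
  next
    fix xs ys i a b assume "xs \<in> hlists V" "ys \<in> hlists V" "a \<in> V i" "b \<in> V i"
    from rel[OF rel_gen_add[OF this]]
    show "pr1 sc' (H (gen (xs @ (i, a + b) # ys))) = pr1 sc' (H (gen (xs @ (i, a) # ys))) + pr1 sc' (H (gen (xs @ (i, b) # ys)))"
      by (simp add: h algebra_simps)
  next
    fix xs ys i a c assume "xs \<in> hlists V" "ys \<in> hlists V" "a \<in> V i"
    from rel[OF rel_gen_scale[OF this]]
    show "pr1 sc' (H (gen (xs @ (i, sc c a) # ys))) = sc' c (pr1 sc' (H (gen (xs @ (i, a) # ys))))"
      by (simp add: h)
  next
    fix xs ys i j a b assume "xs \<in> hlists V" "ys \<in> hlists V" "a \<in> V i" "b \<in> V j"
    from rel[OF rel_gen_swap[OF this]]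
    show "pr1 sc' (H (gen (xs @ (i, a) # (j, b) # ys))) = signed (i * j) (pr1 sc' (H (gen (xs @ (j, b) # (i, a) # ys))))"
      by (simp add: h)
  qed
qed

abbreviation cons_map :: "int \<times> 'v \<Rightarrow> ('v word \<Rightarrow>\<^sub>0 'k::field) \<Rightarrow> ('v word \<Rightarrow>\<^sub>0 'k)"
  where "cons_map y \<equiv> lin_extend (\<lambda>u. gen (y # u))"

text \<open>A sum over set partitions of the letters, organised by the block that contains the first
  letter.\<close>

function ext_word :: "('v word \<Rightarrow> 'w) \<Rightarrow> 'v word \<Rightarrow> ('w word \<Rightarrow>\<^sub>0 'k::field)"
  where
    "ext_word q [] = gen []"
  | "ext_word q (x # w) = unsh (\<lambda>a b. cons_map (wdeg (x # a), q (x # a)) (ext_word q b)) w"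
  by pat_completeness auto
termination
  by (relation "measure (\<lambda>(q, w). length w)") (auto dest: mset_length)

declare ext_word.simps [simp del]

text \<open>A rule for locating \<open>ext_word q w\<close>: if \<open>Q\<close> survives adding the
  block of the first letter, every word in the support is \<open>Q\<close>-related to
  \<open>w\<close>. Degree, nonemptiness, length and homogeneity are all instances.\<close>

lemma ext_word_support:
  fixes q :: "'v word \<Rightarrow> 'w"
  assumes "Q [] []"
    and "\<And>x a b u w. mset a + mset b = mset w \<Longrightarrow> Q b u \<Longrightarrow> Q (x # w) ((wdeg (x # a), q (x # a)) # u)"
  shows "ext_word q w \<in> (fspan (gen ` {u. Q w u}) :: ('w word \<Rightarrow>\<^sub>0 'k::field) set)"
proof (induction w rule: length_induct)
  case (1 w)
  show ?case
  proof (cases w)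
    case Nil
    then show ?thesis using assms(1) by (auto simp: ext_word.simps intro!: fs.span_base)
  next
    case (Cons x w')
    show ?thesis
      unfolding Cons ext_word.simps
    proof (rule unsh_in[OF fs.subspace_span])
      fix a b assume m: "mset a + mset b = mset w'"
      then have "ext_word q b \<in> (fspan (gen ` {u. Q b u}) :: ('w word \<Rightarrow>\<^sub>0 'k) set)"
        using 1 Cons mset_length[OF m] by auto
      then show "cons_map (wdeg (x # a), q (x # a)) (ext_word q b) \<in> (fspan (gen ` {u. Q (x # w') u}) :: ('w word \<Rightarrow>\<^sub>0 'k) set)"
        by (rule flinear_span_in[OF flinear_lin_extend fs.subspace_span, rotated])
          (use assms(2)[OF m, where x = x] in \<open>auto intro!: fs.span_base imageI\<close>)
    qed
  qed
qed

lemma ext_word_wdeg: "ext_word q w \<in> fspan (gen ` {u. wdeg u = wdeg w})"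
  by (rule ext_word_support) (auto simp: mset_wdeg)

lemma ext_word_nonempty: "w \<noteq> [] \<Longrightarrow> ext_word q w \<in> fspan (gen ` {u. u \<noteq> []})"
  using ext_word_support[of "\<lambda>w u. w \<noteq> [] \<longrightarrow> u \<noteq> []" q w] by simp

text \<open>The unreduced coproduct, with the two trivial terms. It avoids case distinctions on
  empty parts, so the recursion of \<open>ext_word\<close> can be followed directly.\<close>

definition full_coprod :: "('v word \<Rightarrow>\<^sub>0 'k::field) \<Rightarrow> ('v word \<times> 'v word \<Rightarrow>\<^sub>0 'k)"
  where "full_coprod = lin_extend (unsh (\<lambda>a b. gen (a, b)))"

lemma flinear_full_coprod: "flinear full_coprod"
  unfolding full_coprod_def by (rule flinear_lin_extend)

lemma full_coprod_eq:
  fixes x :: "'v word \<Rightarrow>\<^sub>0 'k::field"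
  assumes "x \<in> fspan (gen ` {u. u \<noteq> []})"
  shows "full_coprod x = coprod x + tens (gen []) x + tens x (gen [])"
proof (rule flinear_eq_on_span[OF flinear_full_coprod _ _ assms])
  show "flinear (\<lambda>x :: 'v word \<Rightarrow>\<^sub>0 'k. coprod x + tens (gen []) x + tens x (gen []))"
    by (rule flinear_plus[OF flinear_plus[OF flinear_coprod flinear_tens_right] flinear_tens_left])
  fix b :: "'v word \<Rightarrow>\<^sub>0 'k" assume "b \<in> gen ` {u. u \<noteq> []}"
  then obtain u where u: "b = gen u" "u \<noteq> []" by auto
  show "full_coprod b = coprod b + tens (gen []) b + tens b (gen [])"
    using unsh_reduce[OF u(2), of "\<lambda>a b. gen (a, b)"] by (simp only: u full_coprod_def coprod_gen lin_extend_gen tens_gen)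
qed

text \<open>Multiplication by the coproduct of one letter, that is by
  \<open>y \<otimes> 1 + 1 \<otimes> y\<close>.\<close>

definition cons2 :: "int \<times> 'v \<Rightarrow> ('v word \<times> 'v word \<Rightarrow>\<^sub>0 'k::field) \<Rightarrow> ('v word \<times> 'v word \<Rightarrow>\<^sub>0 'k)"
  where "cons2 y = lin_extend (\<lambda>(a, b). gen (y # a, b) + signed (fst y * wdeg a) (gen (a, y # b)))"

lemma flinear_cons2: "flinear (cons2 y)"
  unfolding cons2_def by (rule flinear_lin_extend)

lemma cons2_gen: "cons2 y (gen (a, b)) = gen (y # a, b) + signed (fst y * wdeg a) (gen (a, y # b))"
  by (simp add: cons2_def)

lemma full_coprod_cons_map: "full_coprod (cons_map y x) = cons2 y (full_coprod x)"
  by (rule fun_cong[OF flinear_eqI[OF flinear_compose[OF flinear_lin_extend flinear_full_coprod]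
        flinear_compose[OF flinear_full_coprod flinear_cons2]]])
    (simp add: full_coprod_def unsh_hom[OF flinear_additive[OF flinear_cons2]] cons2_gen)

lemma cons2_tens:
  fixes x :: "'v word \<Rightarrow>\<^sub>0 'k::field"
  assumes x: "x \<in> fspan (gen ` {u. wdeg u = e})"
  shows "cons2 y (tens x z) = tens (cons_map y x) z + signed (fst y * e) (tens x (cons_map y z))"
proof (rule flinear_eq_on_span[OF flinear_compose[OF flinear_tens_left flinear_cons2] _ _ x])
  show "flinear (\<lambda>x. tens (cons_map y x) z + signed (fst y * e) (tens x (cons_map y z)))"
    by (intro flinearI) (simp_all add: fl_simps[OF flinear_lin_extend] tens_left_simps signed_def fs.scale_right_distrib)
  fix b :: "'v word \<Rightarrow>\<^sub>0 'k" assume "b \<in> gen ` {u. wdeg u = e}"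
  then obtain u where u: "b = gen u" "wdeg u = e" by auto
  have lin: "flinear (\<lambda>z. tens (cons_map y b) z + signed (fst y * e) (tens b (cons_map y z)))"
    by (intro flinearI) (simp_all add: fl_simps[OF flinear_lin_extend] tens_right_simps signed_def fs.scale_right_distrib)
  show "cons2 y (tens b z) = tens (cons_map y b) z + signed (fst y * e) (tens b (cons_map y z))"
    by (rule fun_cong[OF flinear_eqI[OF flinear_compose[OF flinear_tens_right flinear_cons2] lin]])
      (simp add: u cons2_gen)
qed

text \<open>The block containing the first letter goes as a whole to the left factor
  (\<open>?l\<close>) or to the right factor (\<open>?r\<close>). Regrouping by coassociativity
  reassembles the recursion of \<open>ext_word\<close> inside that factor.\<close>

lemma full_coprod_ext_word:
  "full_coprod (ext_word q w) = unsh (\<lambda>a b. tens (ext_word q a) (ext_word q b)) w"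
proof (induction w rule: length_induct)
  case (1 w)
  let ?P = "ext_word q :: _ \<Rightarrow> (_ \<Rightarrow>\<^sub>0 'b)"
  show ?case
  proof (cases w)
    case Nil
    then show ?thesis by (simp add: ext_word.simps full_coprod_def)
  next
    case (Cons x w')
    let ?c = "\<lambda>a. cons_map (wdeg (x # a), q (x # a)) :: _ \<Rightarrow> (_ \<Rightarrow>\<^sub>0 'b)"
    let ?l = "\<lambda>a b1 b2. tens (?c a (?P b1)) (?P b2)"
    let ?r = "\<lambda>b1 a b2. signed (fst x * wdeg b1) (tens (?P b1) (?c a (?P b2)))"
    have "full_coprod (?P w) = unsh (\<lambda>a b. full_coprod (?c a (?P b))) w'"
      unfolding Cons ext_word.simps by (rule unsh_hom[OF flinear_additive[OF flinear_full_coprod]])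
    also have "\<dots> = unsh (\<lambda>a b. unsh (\<lambda>b1 b2. ?l a b1 b2 + signed (wdeg a * wdeg b1) (?r b1 a b2)) b) w'"
    proof (rule unsh_cong[OF refl])
      fix a b assume "mset a + mset b = mset w'"
      then have "full_coprod (?P b) = unsh (\<lambda>a b. tens (?P a) (?P b)) b"
        using 1 Cons mset_length by fastforce
      then show "full_coprod (?c a (?P b)) = unsh (\<lambda>b1 b2. ?l a b1 b2 + signed (wdeg a * wdeg b1) (?r b1 a b2)) b"
        unfolding full_coprod_cons_map
        by (simp add: unsh_hom[OF flinear_additive[OF flinear_cons2]] cons2_tens[OF ext_word_wdeg] algebra_simps)
    qed
    also have "\<dots> = unsh (\<lambda>a b. unsh (?l a) b) w' +
        unsh (\<lambda>a b. unsh (\<lambda>b1 b2. signed (wdeg a * wdeg b1) (?r b1 a b2)) b) w'"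
      by (simp only: unsh_add)
    also have "unsh (\<lambda>a b. unsh (\<lambda>b1 b2. signed (wdeg a * wdeg b1) (?r b1 a b2)) b) w' =
        unsh (\<lambda>d b2. unsh (\<lambda>a b1. signed (wdeg a * wdeg b1) (?r b1 a b2)) d) w'"
      by (rule unsh_assoc[symmetric])
    \<comment> \<open>Cocommutativity exchanges \<open>a\<close> and \<open>b1\<close> and absorbs
      the sign between them; what remains is the sign of \<open>x\<close> passing \<open>b1\<close>,
      as in the recursion of \<open>unsh\<close>.\<close>
    also have "\<dots> = unsh (\<lambda>d b2. unsh (\<lambda>b1 a. ?r b1 a b2) d) w'"
      by (subst unsh_commute) simp
    also have "\<dots> = unsh (\<lambda>b1 d. unsh (?r b1) d) w'"
      by (rule unsh_assoc)
    also have "unsh (\<lambda>a b. unsh (?l a) b) w' = unsh (\<lambda>a b. unsh (\<lambda>a1 a2. ?l a1 a2 b) a) w'"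
      by (rule unsh_assoc[symmetric])
    also have "\<dots> + unsh (\<lambda>b1 d. unsh (?r b1) d) w' = unsh (\<lambda>a b. tens (?P a) (?P b)) w"
    proof -
      have "unsh (\<lambda>a1 a2. ?l a1 a2 b) a = tens (?P (x # a)) (?P b)" for a b
        unfolding ext_word.simps by (rule unsh_hom[OF flinear_additive[OF flinear_tens_left], symmetric])
      moreover have "unsh (?r b1) d = signed (fst x * wdeg b1) (tens (?P b1) (?P (x # d)))" for b1 d
        unfolding ext_word.simps unsh_signed
        by (simp only: unsh_hom[OF flinear_additive[OF flinear_tens_right]])
      ultimately show ?thesis
        by (simp only: Cons unsh.simps unsh_add)
    qed
    finally show ?thesis .
  qed
qed

definition ext_hom :: "('v word \<Rightarrow> 'w) \<Rightarrow> ('v word \<Rightarrow>\<^sub>0 'k::field) \<Rightarrow> ('w word \<Rightarrow>\<^sub>0 'k)"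
  where "ext_hom q = lin_extend (ext_word q)"

lemma flinear_ext_hom: "flinear (ext_hom q)"
  unfolding ext_hom_def by (rule flinear_lin_extend)

lemma ext_hom_gen [simp]: "ext_hom q (gen w) = ext_word q w"
  by (simp add: ext_hom_def)

lemma coprod_ext_hom:
  assumes "x \<in> free_sp V"
  shows "coprod (ext_hom q x) = tens_map 0 (ext_hom q) (ext_hom q) (coprod x)"
proof (rule flinear_eq_on_span[OF flinear_compose[OF flinear_ext_hom flinear_coprod]
      flinear_compose[OF flinear_coprod flinear_tens_map] _ assms[unfolded free_sp_def]])
  fix b :: "'a word \<Rightarrow>\<^sub>0 'b" assume "b \<in> gen ` words V"
  then obtain w where w: "b = gen w" "w \<noteq> []" by (auto simp: words_iff)
  have "coprod (ext_word q w) + tens (gen []) (ext_word q w) + tens (ext_word q w) (gen []) =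
      unsh (\<lambda>a b. if a = [] \<or> b = [] then 0 else tens (ext_word q a) (ext_word q b)) w +
      tens (ext_word q []) (ext_word q w) + tens (ext_word q w) (ext_word q [] :: _ \<Rightarrow>\<^sub>0 'b)"
    unfolding full_coprod_eq[OF ext_word_nonempty[OF w(2)], symmetric] full_coprod_ext_word
    by (rule unsh_reduce[OF w(2)])
  then show "coprod (ext_hom q b) = tens_map 0 (ext_hom q) (ext_hom q) (coprod b)"
    by (simp add: w(1) tens_map_coprod_gen ext_word.simps(1) cong: if_cong)
qed

lemma pr1_cons_map:
  assumes "vector_space sc" "x \<in> fspan (gen ` {u. u \<noteq> []})"
  shows "pr1 sc (cons_map y x) = 0"
  using assms(2)
  by (induction rule: fs.span_induct_alt)
    (auto simp: fl_simps[OF flinear_lin_extend] pr1_simps[OF assms(1)] pr1_gen[OF assms(1)] vector_space_simps[OF assms(1)])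

text \<open>Only the partition into a single block produces a word of length one.\<close>

lemma pr1_ext_word:
  assumes "vector_space sc" "w \<noteq> []"
  shows "pr1 sc (ext_word q w) = q w"
proof -
  obtain x w' where w: "w = x # w'" using assms(2) by (cases w) auto
  have add: "additive (pr1 sc)" by unfold_locales (rule pr1_simps[OF assms(1)])
  have "pr1 sc (ext_word q w) = unsh (\<lambda>a b. if b = [] then q (x # a) else 0) w'"
    unfolding w ext_word.simps unsh_hom[OF add]
    by (rule unsh_cong[OF refl])
      (auto simp: ext_word.simps pr1_gen[OF assms(1)] pr1_cons_map[OF assms(1) ext_word_nonempty])
  then show ?thesis by (simp add: unsh_Nil_right w)
qed

lemma sym_maps_letter_deg:
  assumes "sym_maps sc V sc' V' 0 q" "w \<in> words V"
  shows "q w \<in> V' (wdeg w)"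
  using sym_mapsD(1)[OF assms] by simp

lemma ext_word_free_deg:
  fixes sc :: "'k::field \<Rightarrow> 'v::ab_group_add \<Rightarrow> 'v" and sc' :: "'k \<Rightarrow> 'w::ab_group_add \<Rightarrow> 'w"
  assumes q: "sym_maps sc V sc' V' 0 q" and w: "w \<in> words V"
  shows "(ext_word q w :: 'w word \<Rightarrow>\<^sub>0 'k) \<in> free_deg V' (wdeg w)"
proof -
  \<comment> \<open>The implications are needed because the recursion passes through the empty word
    and because nothing is known about \<open>q\<close> outside \<open>V\<close>.\<close>
  have "(ext_word q w :: 'w word \<Rightarrow>\<^sub>0 'k) \<in> fspan (gen ` {u. w \<in> hlists V \<longrightarrow> u \<in> hlists V' \<and> wdeg u = wdeg w \<and> (w \<noteq> [] \<longrightarrow> u \<noteq> [])})"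
  proof (rule ext_word_support)
    fix x :: "int \<times> 'v" and a b u and w :: "'v word" assume m: "mset a + mset b = mset w"
      and u: "b \<in> hlists V \<longrightarrow> u \<in> hlists V' \<and> wdeg u = wdeg b \<and> (b \<noteq> [] \<longrightarrow> u \<noteq> [])"
    obtain i v where x: "x = (i, v)" by (cases x)
    show "x # w \<in> hlists V \<longrightarrow> (wdeg (x # a), q (x # a)) # u \<in> hlists V' \<and>
       wdeg ((wdeg (x # a), q (x # a)) # u) = wdeg (x # w) \<and> (x # w \<noteq> [] \<longrightarrow> (wdeg (x # a), q (x # a)) # u \<noteq> [])"
      using u hlists_mset[OF m, of V] mset_wdeg[OF m] sym_maps_letter_deg[OF q, of "x # a"]
      by (auto simp: words_iff x)
  qed auto
  also have "\<dots> \<subseteq> free_deg V' (wdeg w)"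
    unfolding free_deg_def by (rule fs.span_mono) (use w in \<open>auto simp: words_iff\<close>)
  finally show ?thesis .
qed

lemma ext_hom_free_deg:
  fixes sc :: "'k::field \<Rightarrow> 'v::ab_group_add \<Rightarrow> 'v" and sc' :: "'k \<Rightarrow> 'w::ab_group_add \<Rightarrow> 'w"
  assumes q: "sym_maps sc V sc' V' 0 q" and x: "(x :: 'v word \<Rightarrow>\<^sub>0 'k) \<in> free_deg V d"
  shows "ext_hom q x \<in> free_deg V' d"
  by (rule flinear_span_in[OF flinear_ext_hom subspace_free_deg _ x[unfolded free_deg_def]])
    (use ext_word_free_deg[OF q] in auto)

text \<open>Induction on the length of the relation. Its coproduct involves only shorter relations,
  so the image has a vanishing coproduct modulo relations; the symmetry of \<open>q\<close> removes
  the linear part, and \<open>coprod_pr1_kernel\<close> applies.\<close>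

lemma ext_hom_rel_gen:
  fixes sc :: "'k::field_char_0 \<Rightarrow> 'v::ab_group_add \<Rightarrow> 'v" and sc' :: "'k \<Rightarrow> 'w::ab_group_add \<Rightarrow> 'w"
  assumes V: "graded_vs sc V" and V': "graded_vs sc' V'" and q: "sym_maps sc V sc' V' 0 q"
  shows "rel_gen sc V m d r \<Longrightarrow> ext_hom q r \<in> sym_rel sc' V'"
proof (induction m arbitrary: d r rule: less_induct)
  case (less m)
  note vs = graded_vs_in(1)[OF V']
  have r: "r \<in> free_deg V d" by (rule rel_gen_free_deg[OF V less.prems])
  show ?case
  proof (rule coprod_pr1_kernel[OF V' ext_hom_free_deg[OF q r]])
    have "tens_map 0 (ext_hom q) (ext_hom q) (coprod r) \<in> sym_rel2 sc' V'"
    proof (rule flinear_span_in[OF flinear_tens_map subspace_sym_rel2 _ coprod_rel_gen[OF less.prems, unfolded lower_rel2_def]])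
      have e: "(ext_word q w :: _ \<Rightarrow>\<^sub>0 'k) \<in> free_sp V'" if "w \<in> words V" for w
        using ext_word_free_deg[OF q that] free_deg_subset_free_sp by blast
      fix b :: "'v word \<times> 'v word \<Rightarrow>\<^sub>0 'k"
      assume "b \<in> {tens r (gen w) | r w m' d. rel_gen sc V m' d r \<and> m' < m \<and> w \<in> words V} \<union>
          {tens (gen w) r | r w m' d. rel_gen sc V m' d r \<and> m' < m \<and> w \<in> words V}"
      then obtain r' w m' d' where "rel_gen sc V m' d' r'" "m' < m" "w \<in> words V" and
        b: "b = tens r' (gen w) \<or> b = tens (gen w) r'" by blast
      then have "ext_hom q r' \<in> sym_rel sc' V'" "(ext_word q w :: _ \<Rightarrow>\<^sub>0 'k) \<in> free_sp V'"
        using less.IH e by auto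
      with b show "tens_map 0 (ext_hom q) (ext_hom q) b \<in> sym_rel2 sc' V'"
        using tens_sym_rel2[of "ext_hom q r'" sc' V' "ext_word q w"]
        by (auto simp: tens_map_tens[OF flinear_ext_hom flinear_ext_hom])
    qed
    then show "coprod (ext_hom q r) \<in> sym_rel2 sc' V'"
      using coprod_ext_hom[of r V q] r free_deg_subset_free_sp by (metis subsetD)
    show "pr1 sc' (ext_hom q r) = 0"
      using less.prems
      by cases (auto simp: fl_simps[OF flinear_ext_hom] flinear_signed[OF flinear_ext_hom] pr1_simps[OF vs]
          pr1_ext_word[OF vs] sym_mapsD(2,3)[OF q] sym_mapsD(4)[OF q, symmetric])
  qed
qed

lemma coalg_hom_ext_hom:
  fixes sc :: "'k::field_char_0 \<Rightarrow> 'v::ab_group_add \<Rightarrow> 'v" and sc' :: "'k \<Rightarrow> 'w::ab_group_add \<Rightarrow> 'w"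
  assumes V: "graded_vs sc V" and V': "graded_vs sc' V'" and q: "sym_maps sc V sc' V' 0 q"
  shows "coalg_hom sc V sc' V' (ext_hom q)"
proof -
  have "ext_hom q r \<in> sym_rel sc' V'" if "r \<in> sym_rel sc V" for r
    by (rule flinear_span_in[OF flinear_ext_hom subspace_sym_rel _ that[unfolded sym_rel_eq]])
      (use ext_hom_rel_gen[OF V V' q] in blast)
  then show ?thesis
    using ext_hom_free_deg[OF q] flinear_ext_hom[of q] fs.subspace_0[OF subspace_sym_rel2]
    by (auto simp: coalg_hom_def sym_hom_def coprod_ext_hom)
qed

section \<open>Composition and inversion\<close>

lemma coalg_hom_sym_hom: "coalg_hom sc V sc' V' F \<Longrightarrow> sym_hom sc V sc' V' 0 F"
  by (simp add: coalg_hom_def)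

lemma tens_map_compose:
  assumes "flinear F" "flinear G"
  shows "tens_map 0 F G (tens_map 0 F' G' x) = tens_map 0 (\<lambda>x. F (F' x)) (\<lambda>x. G (G' x)) x"
  by (rule fun_cong[OF flinear_eqI[OF flinear_compose[OF flinear_tens_map flinear_tens_map] flinear_tens_map]])
    (auto simp: tens_map_gen tens_map_tens[OF assms])

lemma coalg_hom_compose:
  assumes V': "graded_vs sc' V'"
    and F: "coalg_hom sc V sc' V' F" and G: "coalg_hom sc' V' sc'' V'' G"
  shows "coalg_hom sc V sc'' V'' (\<lambda>x. G (F x))"
proof -
  note sF = coalg_hom_sym_hom[OF F] and sG = coalg_hom_sym_hom[OF G]
  have "coprod (G (F x)) - tens_map 0 (\<lambda>x. G (F x)) (\<lambda>x. G (F x)) (coprod x) \<in> sym_rel2 sc'' V''"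
    if x: "x \<in> free_sp V" for x
  proof -
    have "tens_map 0 G G (coprod (F x) - tens_map 0 F F (coprod x)) \<in> sym_rel2 sc'' V''"
      using F x by (intro tens_map_sym_rel2[OF V' sG sG]) (auto simp: coalg_hom_def)
    moreover have "coprod (G (F x)) - tens_map 0 G G (coprod (F x)) \<in> sym_rel2 sc'' V''"
      using G sym_hom_free_sp[OF sF x] by (auto simp: coalg_hom_def)
    ultimately have "coprod (G (F x)) - tens_map 0 G G (coprod (F x)) +
        tens_map 0 G G (coprod (F x) - tens_map 0 F F (coprod x)) \<in> sym_rel2 sc'' V''"
      using fs.subspace_add[OF subspace_sym_rel2] by blast
    then show ?thesis
      by (simp add: fl_simps[OF flinear_tens_map] tens_map_compose[OF sym_homD(1)[OF sG] sym_homD(1)[OF sG]])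
  qed
  then show ?thesis
    using sym_hom_compose[OF sF sG] by (simp add: coalg_hom_def)
qed

abbreviation short_words :: "nat \<Rightarrow> ('v word \<Rightarrow>\<^sub>0 'k::field) set"
  where "short_words m \<equiv> fspan (gen ` {u. length u < m})"

text \<open>\<open>Q\<close> differs from the identity by a map that lowers word length, and every
  element has bounded length, so induction on the bound inverts \<open>Q\<close>. The last property
  is the important one: the inverse preserves every subspace that \<open>Q\<close> preserves, which
  fails for bijections in general.\<close>

lemma unipotent_inverse:
  fixes Q :: "('v word \<Rightarrow>\<^sub>0 'k::field) \<Rightarrow> ('v word \<Rightarrow>\<^sub>0 'k)"
  assumes Q: "flinear Q" and uni: "\<And>w. Q (gen w) - gen w \<in> short_words (length w)"
  obtains P where "flinear P" "\<And>x. Q (P x) = x" "\<And>x. P (Q x) = x"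
    "\<And>S x. fs.subspace S \<Longrightarrow> (\<And>y. y \<in> S \<Longrightarrow> Q y \<in> S) \<Longrightarrow> x \<in> S \<Longrightarrow> P x \<in> S"
proof -
  have shrink: "Q x - x \<in> short_words m" if "x \<in> short_words (Suc m)" for m x
  proof (rule flinear_span_in[OF flinear_diff[OF Q flinear_id] fs.subspace_span _ that])
    fix b :: "'v word \<Rightarrow>\<^sub>0 'k" assume "b \<in> gen ` {u. length u < Suc m}"
    then obtain u where u: "b = gen u" "length u \<le> m" by auto
    have "short_words (length u) \<subseteq> (short_words m :: ('v word \<Rightarrow>\<^sub>0 'k) set)"
      by (rule fs.span_mono) (use u in auto)
    then show "Q b - b \<in> short_words m" using uni[of u] u by auto
  qed
  have ex: "\<exists>m. x \<in> short_words m" for x :: "'v word \<Rightarrow>\<^sub>0 'k"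
    by (rule exI[of _ "Suc (Max (length ` Poly_Mapping.keys x))"])
      (auto simp: fspan_gen less_Suc_eq_le intro!: Max_ge)
  have inj: "x = 0" if "Q x = 0" "x \<in> short_words m" for x m
    using that(2)
  proof (induction m)
    case (Suc m)
    then show ?case using shrink[OF Suc.prems] fs.span_neg[of "- x"] that(1) by simp
  qed simp
  have surj: "\<exists>y. Q y = x" if "x \<in> short_words m" for x m
    using that
  proof (induction m arbitrary: x)
    case 0
    then show ?case using fl_simps(5)[OF Q] by auto
  next
    case (Suc m)
    \<comment> \<open>The error \<open>Q x - x\<close> is shorter and already has a preimage;
      subtracting it corrects \<open>x\<close>.\<close>
    then obtain y where "Q y = Q x - x" using shrink by blast
    then have "Q (x - y) = x" by (simp add: fl_simps[OF Q])
    then show ?case ..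
  qed
  define P where "P = inv Q"
  have "inj Q"
  proof (rule injI)
    fix x y assume "Q x = Q y"
    then have "Q (x - y) = 0" by (simp add: fl_simps[OF Q])
    with inj ex[of "x - y"] have "x - y = 0" by blast
    then show "x = y" by simp
  qed
  have "surj Q" using surj ex by (metis surjI)
  have QP: "Q (P x) = x" for x unfolding P_def by (rule surj_f_inv_f[OF \<open>surj Q\<close>])
  have PQ: "P (Q x) = x" for x unfolding P_def by (rule inv_f_f[OF \<open>inj Q\<close>])
  have linP: "flinear P"
    by (rule flinearI; rule injD[OF \<open>inj Q\<close>]) (simp_all add: QP fl_simps[OF Q])
  have stable: "P x \<in> S" if S: "fs.subspace S" and QS: "\<And>y. y \<in> S \<Longrightarrow> Q y \<in> S" and x: "x \<in> S" for S x
  proof -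
    obtain m where "x \<in> short_words m" using ex by blast
    then show ?thesis using x
    proof (induction m arbitrary: x)
      case 0
      then show ?case using fl_simps(5)[OF linP] by simp
    next
      case (Suc m)
      \<comment> \<open>This uses \<open>P x = x - P (Q x - x)\<close>, with \<open>Q x - x\<close>
        in \<open>S\<close> and shorter than \<open>x\<close>.\<close>
      have "P (Q x - x) \<in> S"
        using Suc shrink[OF Suc.prems(1)] QS by (intro Suc.IH) (auto intro: fs.subspace_diff[OF S])
      then have "x - P (Q x - x) \<in> S" using Suc fs.subspace_diff[OF S] by blast
      then show ?case by (simp add: fl_simps[OF linP] PQ)
    qed
  qed
  show ?thesis by (rule that[OF linP QP PQ stable])
qed

text \<open>The partition into singletons returns \<open>w\<close>; every other partition has fewer
  blocks than letters.\<close>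

lemma ext_word_unipotent:
  fixes q :: "'v word \<Rightarrow> 'v"
  assumes "\<And>x. q [x] = snd x"
  shows "ext_word q w - gen w \<in> (short_words (length w) :: ('v word \<Rightarrow>\<^sub>0 'k::field) set)"
proof (induction w rule: length_induct)
  case (1 w)
  have len: "ext_word q b \<in> (short_words (Suc (length b)) :: ('v word \<Rightarrow>\<^sub>0 'k) set)" for b
    by (rule ext_word_support) (auto dest: mset_length)
  show ?case
  proof (cases w)
    case (Cons x w')
    let ?f = "\<lambda>a b. cons_map (wdeg (x # a), q (x # a)) (ext_word q b) :: _ \<Rightarrow>\<^sub>0 'k"
    have up: "cons_map y z \<in> short_words (Suc m)" if "z \<in> short_words m" for y m and z :: "'v word \<Rightarrow>\<^sub>0 'k"
      by (rule flinear_span_in[OF flinear_lin_extend fs.subspace_span _ that]) (auto intro!: fs.span_base)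
    have "cons_map x (ext_word q w' - gen w') \<in> (short_words (length w) :: ('v word \<Rightarrow>\<^sub>0 'k) set)"
      using 1 Cons up by auto
    moreover have "unsh (\<lambda>a b. ?f a b - (if a = [] then ?f [] b else 0)) w' \<in> short_words (length w)"
    proof (rule unsh_in[OF fs.subspace_span])
      fix a b assume m: "mset a + mset b = mset w'"
      show "?f a b - (if a = [] then ?f [] b else 0) \<in> short_words (length w)"
      proof (cases "a = []")
        case False
        then have "Suc (Suc (length b)) \<le> length w" using mset_length[OF m] Cons by (cases a) auto
        then have "short_words (Suc (Suc (length b))) \<subseteq> (short_words (length w) :: ('v word \<Rightarrow>\<^sub>0 'k) set)"
          by (intro fs.span_mono) auto
        with up[OF len[of b]] False show ?thesis by auto
      qed (simp add: fs.span_zero)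
    qed
    moreover have "ext_word q w - gen w = cons_map x (ext_word q w' - gen w') +
        unsh (\<lambda>a b. ?f a b - (if a = [] then ?f [] b else 0)) w'"
      unfolding unsh_diff unsh_Nil_left
      by (simp add: Cons ext_word.simps assms fl_simps[OF flinear_lin_extend])
    ultimately show ?thesis by (simp only: fs.span_add)
  qed (simp add: ext_word.simps fs.span_zero)
qed

text \<open>Apply \<open>P \<otimes> P\<close> to the compatibility of \<open>Q\<close> with
  coproducts at \<open>P x\<close>; as \<open>P\<close> inverts \<open>Q\<close> exactly, both sides
  simplify.\<close>

lemma coalg_hom_inverse:
  fixes sc :: "'k::field \<Rightarrow> 'v::ab_group_add \<Rightarrow> 'v" and sc' :: "'k \<Rightarrow> 'w::ab_group_add \<Rightarrow> 'w"
  assumes V: "graded_vs sc V" and V': "graded_vs sc' V'" and Q: "coalg_hom sc V sc' V' Q"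
    and P: "sym_hom sc' V' sc V 0 P" and QP: "\<And>x. Q (P x) = x" and PQ: "\<And>x. P (Q x) = x"
  shows "coalg_hom sc' V' sc V P"
proof -
  note sQ = coalg_hom_sym_hom[OF Q]
  note lin = sym_homD(1)[OF P] sym_homD(1)[OF sQ]
  have "coprod (P x) - tens_map 0 P P (coprod x) \<in> sym_rel2 sc V" if x: "x \<in> free_sp V'" for x
  proof -
    have "coprod (Q (P x)) - tens_map 0 Q Q (coprod (P x)) \<in> sym_rel2 sc' V'"
      using Q sym_hom_free_sp[OF P x] by (auto simp: coalg_hom_def)
    then have "tens_map 0 P P (coprod (Q (P x)) - tens_map 0 Q Q (coprod (P x))) \<in> sym_rel2 sc V"
      by (rule tens_map_sym_rel2[OF V' P P])
    moreover have "tens_map 0 (\<lambda>x. x) (\<lambda>x. x) y = y" for y :: "'v word \<times> 'v word \<Rightarrow>\<^sub>0 'k"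
      by (rule fun_cong[OF flinear_eqI[OF flinear_tens_map flinear_id]]) (auto simp: tens_map_gen)
    ultimately have "tens_map 0 P P (coprod x) - coprod (P x) \<in> sym_rel2 sc V"
      by (simp add: fl_simps[OF flinear_tens_map] tens_map_compose[OF lin(1,1)] QP PQ)
    then show ?thesis using fs.subspace_neg[OF subspace_sym_rel2] by fastforce
  qed
  then show ?thesis using P by (simp add: coalg_hom_def)
qed

lemma coderivation_conjugate:
  fixes sc :: "'k::field \<Rightarrow> 'v::ab_group_add \<Rightarrow> 'v" and sc' :: "'k \<Rightarrow> 'w::ab_group_add \<Rightarrow> 'w"
  assumes V: "graded_vs sc V" and V': "graded_vs sc' V'" and D: "coderivation sc V D"
    and Q: "coalg_hom sc V sc' V' Q" and P: "coalg_hom sc' V' sc V P" and QP: "\<And>x. Q (P x) = x"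
  shows "coderivation sc' V' (\<lambda>x. Q (D (P x)))"
proof -
  note sQ = coalg_hom_sym_hom[OF Q] and sP = coalg_hom_sym_hom[OF P]
  have sD: "sym_hom sc V sc V (-1) D" using D by (simp add: coderivation_def)
  note lQ = sym_homD(1)[OF sQ] and lP = sym_homD(1)[OF sP] and lD = sym_homD(1)[OF sD]
  let ?D = "\<lambda>x. Q (D (P x))"
  have sD': "sym_hom sc' V' sc' V' (-1) ?D"
    using sym_hom_compose[OF sym_hom_compose[OF sP sD] sQ] by simp
  have "coprod (?D x) - (tens_map 0 ?D id (coprod x) + tens_map (-1) id ?D (coprod x)) \<in> sym_rel2 sc' V'"
    if x: "x \<in> free_sp V'" for x
  proof -
    let ?c = "\<lambda>y. tens_map 0 D id y + tens_map (-1) id D y"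
    note Px = sym_hom_free_sp[OF sP x]
    have lc: "flinear ?c" by (intro flinear_plus flinear_tens_map)
    have 1: "coprod (?D x) - tens_map 0 Q Q (coprod (D (P x))) \<in> sym_rel2 sc' V'"
      using Q sym_hom_free_sp[OF sD Px] by (auto simp: coalg_hom_def)
    have 2: "tens_map 0 Q Q (coprod (D (P x)) - ?c (coprod (P x))) \<in> sym_rel2 sc' V'"
      using D Px by (intro tens_map_sym_rel2[OF V sQ sQ]) (auto simp: coderivation_def)
    have "coprod (P x) - tens_map 0 P P (coprod x) \<in> sym_rel2 sc V"
      using P x by (auto simp: coalg_hom_def)
    then have "?c (coprod (P x) - tens_map 0 P P (coprod x)) \<in> sym_rel2 sc V"
      by (intro fs.subspace_add[OF subspace_sym_rel2] tens_map_sym_rel2[OF V sD sym_hom_id]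
          tens_map_sym_rel2[OF V sym_hom_id sD])
    then have 3: "tens_map 0 Q Q (?c (coprod (P x) - tens_map 0 P P (coprod x))) \<in> sym_rel2 sc' V'"
      by (rule tens_map_sym_rel2[OF V sQ sQ])
    \<comment> \<open>Conjugation factor by factor. Since \<open>P\<close> has degree 0, passing
      \<open>D\<close> across \<open>P (gen u)\<close> gives the same sign as passing it across
      \<open>gen u\<close>.\<close>
    have 4: "tens_map 0 Q Q (?c (tens_map 0 P P (coprod x))) = tens_map 0 ?D id (coprod x) + tens_map (-1) id ?D (coprod x)"
    proof (rule flinear_eq_on_span[OF _ _ _ x[unfolded free_sp_def]])
      show "flinear (\<lambda>x. tens_map 0 Q Q (?c (tens_map 0 P P (coprod x))))"
        by (intro flinear_compose[OF _ flinear_tens_map] flinear_compose[OF _ lc] flinear_compose[OF flinear_coprod flinear_tens_map])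
      show "flinear (\<lambda>x. tens_map 0 ?D id (coprod x) + tens_map (-1) id ?D (coprod x))"
        by (intro flinear_plus flinear_compose[OF flinear_coprod flinear_tens_map])
      fix b :: "'w word \<Rightarrow>\<^sub>0 'k" assume "b \<in> gen ` words V'"
      then obtain w where w: "b = gen w" "w \<in> words V'" by auto
      have *: "tens_map 0 Q Q (?c (tens (P (gen u)) (P (gen v)))) =
          tens (?D (gen u)) (gen v) + signed (- wdeg u) (tens (gen u) (?D (gen v)))" if u: "u \<in> words V'" for u v
      proof -
        have "P (gen u) \<in> free_deg V (wdeg u)"
          using sym_homD(2)[OF sP gen_free_deg[OF u refl]] by simp
        then show ?thesis
          by (simp add: tens_map_tens[OF lD fs.linear_id] tens_map_tens[OF fs.linear_id lD, of _ _ V "wdeg u"]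
              fl_simps[OF flinear_tens_map] flinear_signed[OF flinear_tens_map] tens_map_tens[OF lQ lQ] QP)
      qed
      have add: "additive (\<lambda>y. tens_map 0 Q Q (?c y))"
        by (rule flinear_additive[OF flinear_compose[OF lc flinear_tens_map]])
      show "tens_map 0 Q Q (?c (tens_map 0 P P (coprod b))) = tens_map 0 ?D id (coprod b) + tens_map (-1) id ?D (coprod b)"
        unfolding w(1) tens_map_coprod_gen unsh_hom[OF add] unsh_add[symmetric]
      proof (rule unsh_cong[OF refl])
        fix u v assume m: "mset u + mset v = mset w"
        show "tens_map 0 Q Q (?c (if u = [] \<or> v = [] then 0 else signed (0 * wdeg u) (tens (P (gen u)) (P (gen v))))) =
          (if u = [] \<or> v = [] then 0 else signed (0 * wdeg u) (tens (?D (gen u)) (id (gen v)))) +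
          (if u = [] \<or> v = [] then 0 else signed (- 1 * wdeg u) (tens (id (gen u)) (?D (gen v))))"
        proof (cases "u = [] \<or> v = []")
          case True
          then show ?thesis by (auto simp: fl_simps[OF flinear_tens_map])
        next
          case False
          then show ?thesis using *[of u v] words_mset[OF w(2) m] by auto
        qed
      qed
    qed
    \<comment> \<open>Facts 1 to 3 move the coproduct past \<open>Q\<close>, \<open>D\<close> and
      \<open>P\<close> in turn, each modulo relations; this adds them up.\<close>
    have tel: "a - e \<in> S" if "a - b \<in> S" "b' \<in> S" "c' \<in> S" "b' = b - c" "c' = c - e" "fs.subspace S"
      for a b c e b' c' :: "'w word \<times> 'w word \<Rightarrow>\<^sub>0 'k" and S
      using fs.subspace_add[OF that(6) fs.subspace_add[OF that(6) that(1,2)] that(3)] unfolding that(4,5) by simp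
    have 5: "tens_map 0 Q Q (?c (coprod (P x) - tens_map 0 P P (coprod x))) =
        tens_map 0 Q Q (?c (coprod (P x))) - (tens_map 0 ?D id (coprod x) + tens_map (-1) id ?D (coprod x))"
      unfolding 4[symmetric] by (rule fl_simps(2)[OF flinear_compose[OF lc flinear_tens_map]])
    show ?thesis
      by (rule tel[OF 1 2 3 fl_simps(2)[OF flinear_tens_map] 5 subspace_sym_rel2])
  qed
  with sD' show ?thesis by (simp add: coderivation_def)
qed

section \<open>Decalage\<close>

fun desusp_parity :: "'v word \<Rightarrow> int"
  where
    "desusp_parity [] = 0"
  | "desusp_parity (x # w) = fst x * int (length w) + desusp_parity w"

definition decalage_parity :: "'v word \<Rightarrow> int"
  where "decalage_parity w = int (length w * (length w - 1) div 2) + desusp_parity w"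

abbreviation shift_word :: "int \<Rightarrow> 'v word \<Rightarrow> 'v word"
  where "shift_word d \<equiv> map (\<lambda>(i, v). (i + d, v))"

lemma desusp_parity_append [simp]:
  "desusp_parity (u @ w) = desusp_parity u + wdeg u * int (length w) + desusp_parity w"
  by (induction u) (auto simp: algebra_simps)

text \<open>Swapping letters of suspended degrees \<open>i\<close> and \<open>j\<close> changes the
  sign by \<open>i + j\<close>. As \<open>(i - 1) * (j - 1) + 1 + i + j\<close> has the parity of
  \<open>i * j\<close>, skew symmetry turns into symmetry.\<close>

lemma decalage_parity_swap:
  "even (decalage_parity (xs @ (i, a) # (j, b) # ys) + decalage_parity (xs @ (j, b') # (i, a') # ys) + i + j)"
  by (auto simp: decalage_parity_def)

lemma decalage_parity_letter:
  "decalage_parity (xs @ (i, a) # ys) = decalage_parity (xs @ (i, b) # ys)"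
  by (simp add: decalage_parity_def)

lemma desusp_sign_eq: "desusp_sign w = (-1) powi desusp_parity w"
  by (induction w rule: desusp_sign.induct) (simp_all add: power_int_add)

lemma sc_signed:
  assumes "vector_space sc"
  shows "sc ((-1) powi n) v = signed n v"
  by (cases "even n") (simp_all add: signed_def power_int_minus_left vector_space_simps[OF assms])

lemma decalage_eq:
  assumes "vector_space sc"
  shows "decalage sc q w = signed (decalage_parity w) (q (shift_word (-1) w))"
proof -
  have "((-1) ^ (length w * (length w - 1) div 2) * desusp_sign w :: 'a) = (-1) powi decalage_parity w"
    by (simp add: decalage_parity_def desusp_sign_eq power_int_add)
  then show ?thesis
    by (simp add: decalage_def sc_signed[OF assms])
qed

text \<open>The inverse of \<open>decalage\<close>: a sign is its own inverse, so the same sign is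
  applied, read off the suspended word.\<close>

definition undecalage :: "('v word \<Rightarrow> 'w::ab_group_add) \<Rightarrow> 'v word \<Rightarrow> 'w"
  where "undecalage q w = signed (decalage_parity (shift_word 1 w)) (q (shift_word 1 w))"

lemma shift_word_shift_word: "d + d' = 0 \<Longrightarrow> shift_word d (shift_word d' w) = w"
  by (induction w) (auto simp: add.assoc add.commute[of d' d])

lemma decalage_undecalage:
  assumes "vector_space sc"
  shows "decalage sc (undecalage q) w = q w"
proof -
  have "shift_word 1 (shift_word (-1) w) = w" by (rule shift_word_shift_word) simp
  then show ?thesis
    unfolding decalage_eq[OF assms] undecalage_def by (simp only: signed_signed) (simp add: signed_def)
qed

lemma wdeg_shift_word: "wdeg (shift_word d w) = wdeg w + d * int (length w)"
  by (induction w) (auto simp: algebra_simps)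

lemma hlists_shift_word:
  "shift_word 1 w \<in> hlists (susp V) \<longleftrightarrow> w \<in> hlists V"
  "shift_word (-1) w \<in> hlists V \<longleftrightarrow> w \<in> hlists (susp V)"
  by (induction w) (auto simp: susp_def)

lemma words_shift_word:
  "w \<in> words V \<Longrightarrow> shift_word 1 w \<in> words (susp V)"
  "w \<in> words (susp V) \<Longrightarrow> shift_word (-1) w \<in> words V"
  by (simp_all only: words_iff hlists_shift_word map_is_Nil_conv simp_thms)

lemma graded_vs_susp: "graded_vs sc V \<Longrightarrow> graded_vs sc (susp V)"
  by (simp add: graded_vs_def susp_def)

lemma graded_vs_signed: "graded_vs sc V \<Longrightarrow> v \<in> V i \<Longrightarrow> signed n v \<in> V i"
  by (metis graded_vs_in(1,4) sc_signed)

lemma skew_mapsD: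
  assumes "skew_maps sc V sc' V' e q" and V': "vector_space sc'"
  shows "w \<in> words V \<Longrightarrow> q w \<in> V' (wdeg w + e (length w))"
    and "xs \<in> hlists V \<Longrightarrow> ys \<in> hlists V \<Longrightarrow> a \<in> V i \<Longrightarrow> b \<in> V i \<Longrightarrow>
       q (xs @ (i, a + b) # ys) = q (xs @ (i, a) # ys) + q (xs @ (i, b) # ys)"
    and "xs \<in> hlists V \<Longrightarrow> ys \<in> hlists V \<Longrightarrow> a \<in> V i \<Longrightarrow>
       q (xs @ (i, sc c a) # ys) = sc' c (q (xs @ (i, a) # ys))"
    and "xs \<in> hlists V \<Longrightarrow> ys \<in> hlists V \<Longrightarrow> a \<in> V i \<Longrightarrow> b \<in> V j \<Longrightarrow>
       q (xs @ (i, a) # (j, b) # ys) = signed (1 + i * j) (q (xs @ (j, b) # (i, a) # ys))"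
proof -
  have "sc' (- ((-1) powi n)) v = signed (1 + n) v" for n v
    by (simp add: vector_space_simps[OF V'] sc_signed[OF V'] signed_def)
  note h = this
  show "w \<in> words V \<Longrightarrow> q w \<in> V' (wdeg w + e (length w))"
    and "xs \<in> hlists V \<Longrightarrow> ys \<in> hlists V \<Longrightarrow> a \<in> V i \<Longrightarrow> b \<in> V i \<Longrightarrow>
       q (xs @ (i, a + b) # ys) = q (xs @ (i, a) # ys) + q (xs @ (i, b) # ys)"
    and "xs \<in> hlists V \<Longrightarrow> ys \<in> hlists V \<Longrightarrow> a \<in> V i \<Longrightarrow>
       q (xs @ (i, sc c a) # ys) = sc' c (q (xs @ (i, a) # ys))"
    and "xs \<in> hlists V \<Longrightarrow> ys \<in> hlists V \<Longrightarrow> a \<in> V i \<Longrightarrow> b \<in> V j \<Longrightarrow>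
       q (xs @ (i, a) # (j, b) # ys) = signed (1 + i * j) (q (xs @ (j, b) # (i, a) # ys))"
    using assms(1) unfolding skew_maps_def h by blast+
qed

lemma skew_mapsI:
  assumes V': "vector_space sc'"
    and "\<And>w. w \<in> words V \<Longrightarrow> q w \<in> V' (wdeg w + e (length w))"
    and "\<And>xs ys i a b. xs \<in> hlists V \<Longrightarrow> ys \<in> hlists V \<Longrightarrow> a \<in> V i \<Longrightarrow> b \<in> V i \<Longrightarrow>
       q (xs @ (i, a + b) # ys) = q (xs @ (i, a) # ys) + q (xs @ (i, b) # ys)"
    and "\<And>xs ys i a c. xs \<in> hlists V \<Longrightarrow> ys \<in> hlists V \<Longrightarrow> a \<in> V i \<Longrightarrow>
       q (xs @ (i, sc c a) # ys) = sc' c (q (xs @ (i, a) # ys))"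
    and "\<And>xs ys i j a b. xs \<in> hlists V \<Longrightarrow> ys \<in> hlists V \<Longrightarrow> a \<in> V i \<Longrightarrow> b \<in> V j \<Longrightarrow>
       q (xs @ (i, a) # (j, b) # ys) = signed (1 + i * j) (q (xs @ (j, b) # (i, a) # ys))"
  shows "skew_maps sc V sc' V' e q"
proof -
  have "sc' (- ((-1) powi n)) v = signed (1 + n) v" for n v
    by (simp add: vector_space_simps[OF V'] sc_signed[OF V'] signed_def)
  note h = this
  show ?thesis
    unfolding skew_maps_def h using assms(2-) by blast
qed

lemma sym_mapsI:
  assumes "\<And>w. w \<in> words V \<Longrightarrow> q w \<in> V' (wdeg w + e)"
    and "\<And>xs ys i a b. xs \<in> hlists V \<Longrightarrow> ys \<in> hlists V \<Longrightarrow> a \<in> V i \<Longrightarrow> b \<in> V i \<Longrightarrow>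
       q (xs @ (i, a + b) # ys) = q (xs @ (i, a) # ys) + q (xs @ (i, b) # ys)"
    and "\<And>xs ys i a c. xs \<in> hlists V \<Longrightarrow> ys \<in> hlists V \<Longrightarrow> a \<in> V i \<Longrightarrow>
       q (xs @ (i, sc c a) # ys) = sc' c (q (xs @ (i, a) # ys))"
    and "\<And>xs ys i j a b. xs \<in> hlists V \<Longrightarrow> ys \<in> hlists V \<Longrightarrow> a \<in> V i \<Longrightarrow> b \<in> V j \<Longrightarrow>
       q (xs @ (i, a) # (j, b) # ys) = signed (i * j) (q (xs @ (j, b) # (i, a) # ys))"
  shows "sym_maps sc V sc' V' e q"
  unfolding sym_maps_def using assms by blast

lemma sc_signed_commute:
  assumes "vector_space sc"
  shows "sc c (signed n v) = signed n (sc c v)"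
  by (simp add: signed_def vector_space_simps[OF assms])

text \<open>Brackets are the case \<open>e = -1\<close> and morphisms the case \<open>e = 0\<close>;
  the shift by the word length cancels the dependence of the degree on \<open>k\<close>.\<close>

lemma sym_maps_decalage:
  assumes L': "graded_vs sc' L'" and f: "skew_maps sc L sc' L' d f" and d: "\<And>k. d k = int k - 1 + e"
  shows "sym_maps sc (susp L) sc' (susp L') e (decalage sc' f)"
proof (rule sym_mapsI)
  note vs = graded_vs_in(1)[OF L'] and D = skew_mapsD[OF f graded_vs_in(1)[OF L']]
  note dec = decalage_eq[OF vs]
  fix w assume "w \<in> words (susp L)"
  from D(1)[OF words_shift_word(2)[OF this], unfolded wdeg_shift_word]
  show "decalage sc' f w \<in> susp L' (wdeg w + e)"
    unfolding dec by (intro graded_vs_signed[OF graded_vs_susp[OF L']]) (simp add: d susp_def algebra_simps)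
next
  note vs = graded_vs_in(1)[OF L'] and D = skew_mapsD[OF f graded_vs_in(1)[OF L']]
  note dec = decalage_eq[OF vs]
  fix xs ys i a
  assume xs: "xs \<in> hlists (susp L)" and ys: "ys \<in> hlists (susp L)" and a: "a \<in> susp L i"
  note h = iffD2[OF hlists_shift_word(2) xs] iffD2[OF hlists_shift_word(2) ys] a[unfolded susp_def]
  show "decalage sc' f (xs @ (i, a + b) # ys) = decalage sc' f (xs @ (i, a) # ys) + decalage sc' f (xs @ (i, b) # ys)"
    if b: "b \<in> susp L i" for b
    using D(2)[OF h b[unfolded susp_def]] decalage_parity_letter[of xs i "a + b" ys a] decalage_parity_letter[of xs i b ys a]
    by (simp add: dec signed_add)
  show "decalage sc' f (xs @ (i, sc c a) # ys) = sc' c (decalage sc' f (xs @ (i, a) # ys))" for c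
    using D(3)[OF h] decalage_parity_letter[of xs i "sc c a" ys a]
    by (simp add: dec sc_signed_commute[OF vs])
  fix j b assume "b \<in> susp L j"
  from D(4)[OF h this[unfolded susp_def]] decalage_parity_swap[of xs i a j b ys b a]
  show "decalage sc' f (xs @ (i, a) # (j, b) # ys) = signed (i * j) (decalage sc' f (xs @ (j, b) # (i, a) # ys))"
    by (auto simp: dec intro!: signed_parity)
qed

lemma skew_maps_undecalage:
  assumes L': "graded_vs sc' L'" and q: "sym_maps sc (susp L) sc' (susp L') e q" and d: "\<And>k. d k = int k - 1 + e"
  shows "skew_maps sc L sc' L' d (undecalage q)"
proof (rule skew_mapsI[OF graded_vs_in(1)[OF L']])
  note vs = graded_vs_in(1)[OF L'] and D = sym_mapsD[OF q]
  fix w assume "w \<in> words L"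
  from D(1)[OF words_shift_word(1)[OF this], unfolded wdeg_shift_word]
  show "undecalage q w \<in> L' (wdeg w + d (length w))"
    unfolding undecalage_def by (intro graded_vs_signed[OF L']) (simp add: d susp_def algebra_simps)
next
  note vs = graded_vs_in(1)[OF L'] and D = sym_mapsD[OF q]
  fix xs ys i a
  assume xs: "xs \<in> hlists L" and ys: "ys \<in> hlists L" and a: "a \<in> L i"
  have up: "b \<in> L i \<Longrightarrow> b \<in> susp L (i + 1)" for b i by (simp add: susp_def)
  note h = iffD2[OF hlists_shift_word(1) xs] iffD2[OF hlists_shift_word(1) ys] up[OF a]
  show "undecalage q (xs @ (i, a + b) # ys) = undecalage q (xs @ (i, a) # ys) + undecalage q (xs @ (i, b) # ys)"
    if b: "b \<in> L i" for b
    using D(2)[OF h up[OF b]] decalage_parity_letter[of "shift_word 1 xs" "i + 1" "a + b" "shift_word 1 ys" a] decalage_parity_letter[of "shift_word 1 xs" "i + 1" b "shift_word 1 ys" a]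
    by (simp add: undecalage_def signed_add)
  show "undecalage q (xs @ (i, sc c a) # ys) = sc' c (undecalage q (xs @ (i, a) # ys))" for c
    using D(3)[OF h] decalage_parity_letter[of "shift_word 1 xs" "i + 1" "sc c a" "shift_word 1 ys" a]
    by (simp add: undecalage_def sc_signed_commute[OF vs])
  fix j b assume "b \<in> L j"
  from D(4)[OF h up[OF this]] decalage_parity_swap[of "shift_word 1 xs" "i + 1" a "j + 1" b "shift_word 1 ys" b a]
  show "undecalage q (xs @ (i, a) # (j, b) # ys) = signed (1 + i * j) (undecalage q (xs @ (j, b) # (i, a) # ys))"
    by (auto simp: undecalage_def intro!: signed_parity)
qed

section \<open>Linear sections\<close>

text \<open>Lift a basis of \<open>B\<close> through \<open>h\<close> and extend linearly. The map
  \<open>h\<close> is linear on \<open>A\<close> only, so the section property is verified by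
  induction over the span of the basis.\<close>

lemma linear_section:
  fixes sc :: "'k::field \<Rightarrow> 'v::ab_group_add \<Rightarrow> 'v" and sc' :: "'k \<Rightarrow> 'w::ab_group_add \<Rightarrow> 'w"
  assumes A: "vector_space sc" "module.subspace sc A" and B: "vector_space sc'" "module.subspace sc' B"
    and add: "\<And>a b. a \<in> A \<Longrightarrow> b \<in> A \<Longrightarrow> h (a + b) = h a + h b"
    and scale: "\<And>c a. a \<in> A \<Longrightarrow> h (sc c a) = sc' c (h a)" and surj: "h ` A = B"
  obtains s where "\<And>y. y \<in> B \<Longrightarrow> s y \<in> A" "\<And>y. y \<in> B \<Longrightarrow> h (s y) = y"
    "Vector_Spaces.linear sc' sc s"
proof -
  interpret a: vector_space sc by fact
  interpret b: vector_space sc' by fact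
  interpret p: vector_space_pair sc' sc ..
  have h0: "h 0 = 0" using scale[of 0 0] a.subspace_0[OF A(2)] by simp
  obtain C where C: "C \<subseteq> B" "b.independent C" "B \<subseteq> b.span C"
    by (rule b.basis_exists[of B])
  have "\<forall>c\<in>C. \<exists>x\<in>A. h x = c" using C(1) surj by blast
  then obtain t where t: "\<And>c. c \<in> C \<Longrightarrow> t c \<in> A" "\<And>c. c \<in> C \<Longrightarrow> h (t c) = c" by metis
  define s where "s = p.construct C t"
  have lin: "Vector_Spaces.linear sc' sc s"
    unfolding s_def by (rule p.linear_construct[OF C(2)])
  interpret s: Vector_Spaces.linear sc' sc s by (rule lin)
  have "s y \<in> A \<and> h (s y) = y" if "y \<in> B" for y
  proof -
    have "y \<in> b.span C" using that C(3) by blast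
    then show ?thesis
    proof (induction rule: b.span_induct_alt)
      case base then show ?case using a.subspace_0[OF A(2)] h0 by (simp add: s.zero)
    next
      case (step c x y)
      have "s x = t x" unfolding s_def using step by (intro p.construct_basis[OF C(2)])
      then show ?case
        using step t[of x] a.subspace_add[OF A(2)] a.subspace_scale[OF A(2)]
        by (simp add: s.add s.scale add scale)
    qed
  qed
  with that[OF _ _ lin] show ?thesis by blast
qed

text \<open>In degrees at most 0, where surjectivity is not assumed, the zero map serves as a
  default.\<close>

lemma graded_section:
  fixes sc :: "'k::field \<Rightarrow> 'v::ab_group_add \<Rightarrow> 'v" and sc' :: "'k \<Rightarrow> 'w::ab_group_add \<Rightarrow> 'w"
  assumes L: "graded_vs sc L" and L': "graded_vs sc' L'"
    and add: "\<And>i a b. a \<in> L i \<Longrightarrow> b \<in> L i \<Longrightarrow> h i (a + b) = h i a + h i b"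
    and scale: "\<And>i c a. a \<in> L i \<Longrightarrow> h i (sc c a) = sc' c (h i a)"
    and surj: "\<And>i. 0 < i \<Longrightarrow> h i ` L i = L' i"
  obtains s where "\<And>i y. y \<in> L' i \<Longrightarrow> s i y \<in> L i" "\<And>i y. 0 < i \<Longrightarrow> y \<in> L' i \<Longrightarrow> h i (s i y) = y"
    "\<And>i. Vector_Spaces.linear sc' sc (s i)"
proof -
  note vs = graded_vs_in(1)[OF L] and vs' = graded_vs_in(1)[OF L']
  have "\<exists>s. (\<forall>y\<in>L' i. s y \<in> L i \<and> (0 < i \<longrightarrow> h i (s y) = y)) \<and> Vector_Spaces.linear sc' sc s" for i
  proof (cases "0 < i")
    case True
    obtain s where "\<And>y. y \<in> L' i \<Longrightarrow> s y \<in> L i" "\<And>y. y \<in> L' i \<Longrightarrow> h i (s y) = y"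
      "Vector_Spaces.linear sc' sc s"
      by (rule linear_section[OF vs _ vs' _ add scale surj[OF True]])
        (use L L' in \<open>auto simp: graded_vs_def\<close>)
    then show ?thesis by blast
  next
    case False
    have "Vector_Spaces.linear sc' sc (\<lambda>_. 0)"
      by (simp add: Vector_Spaces.linear_iff vs vs' vector_space_simps[OF vs])
    with False show ?thesis using graded_vs_in(2)[OF L] by (intro exI[of _ "\<lambda>_. 0"]) simp
  qed
  then show ?thesis using that by metis
qed

section \<open>Strictification of fibrations\<close>

text \<open>For strict components the extension keeps word length, so its linear part sees only the
  linear part of the argument.\<close>

lemma pr1_ext_hom_strict:
  fixes sc :: "'k::field \<Rightarrow> 'v::ab_group_add \<Rightarrow> 'v" and sc' :: "'k \<Rightarrow> 'w::ab_group_add \<Rightarrow> 'w"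
  assumes V: "graded_vs sc V" and V': "graded_vs sc' V'" and q: "sym_maps sc V sc' V' 0 q"
    and strict: "\<And>w. w \<in> words V \<Longrightarrow> length w \<noteq> 1 \<Longrightarrow> q w = 0"
    and x: "x \<in> free_deg V d"
  shows "pr1 sc' (ext_hom q x) = q [(d, pr1 sc x)]"
proof -
  note vs = graded_vs_in(1)[OF V] and vs' = graded_vs_in(1)[OF V']
  have q0: "q [(d, 0)] = 0"
    using sym_mapsD(3)[OF q, of "[]" "[]" 0 d 0] by (simp add: graded_vs_in[OF V] vector_space_simps[OF vs] vector_space_simps[OF vs'])
  have "pr1 sc x \<in> V d \<and> pr1 sc' (ext_hom q x) = q [(d, pr1 sc x)]"
    using x unfolding free_deg_def
  proof (induction rule: fs.span_induct_alt)
    case base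
    then show ?case by (simp add: fl_simps[OF flinear_ext_hom] pr1_simps[OF vs] pr1_simps[OF vs'] q0 graded_vs_in[OF V])
  next
    case (step c b y)
    then obtain w where w: "b = gen w" "w \<in> words V" "wdeg w = d" by auto
    have w0: "w \<noteq> []" using w(2) by (simp add: words_iff)
    have b: "pr1 sc b \<in> V d" using pr1_free_deg[OF V gen_free_deg[OF w(2,3)]] w(1) by simp
    have "pr1 sc' (ext_hom q b) = q [(d, pr1 sc b)]"
    proof (cases "length w = 1")
      case True
      then obtain v where "w = [(d, v)]" using w(3) by (auto simp: length_Suc_conv)
      then show ?thesis by (simp add: w(1) pr1_ext_word[OF vs'] pr1_gen[OF vs])
    next
      case False
      then show ?thesis using w0 strict[OF w(2)] q0 by (simp add: w(1) pr1_ext_word[OF vs'] pr1_gen[OF vs])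
    qed
    then show ?case
      using step b sym_mapsD(2)[OF q, of "[]" "[]" "sc c (pr1 sc b)" d "pr1 sc y"]
        sym_mapsD(3)[OF q, of "[]" "[]" "pr1 sc b" d c]
      by (simp add: fl_simps[OF flinear_ext_hom] pr1_simps[OF vs] pr1_simps[OF vs'] graded_vs_in[OF V])
  qed
  then show ?thesis ..
qed

text \<open>A letter has zero reduced coproduct, hence so has its image under \<open>D\<close>
  modulo relations, and such an element is a letter again.\<close>

lemma coderivation_letter:
  fixes sc :: "'k::field_char_0 \<Rightarrow> 'v::ab_group_add \<Rightarrow> 'v"
  assumes V: "graded_vs sc V" and D: "coderivation sc V D" and v: "v \<in> V i"
  shows "D (gen [(i, v)]) - gen [(i - 1, pr1 sc (D (gen [(i, v)])))] \<in> sym_rel sc V"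
proof (rule coprod_kernel[OF V])
  have w: "[(i, v)] \<in> words V" using v by (simp add: words_iff)
  have sD: "sym_hom sc V sc V (-1) D" using D by (simp add: coderivation_def)
  show "D (gen [(i, v)]) \<in> free_deg V (i - 1)"
    using sym_homD(2)[OF sD gen_free_deg[OF w refl]] by simp
  have "coprod (gen [(i, v)]) = (0 :: _ \<Rightarrow>\<^sub>0 'k)" by (simp add: coprod_gen)
  moreover have "coprod (D (gen [(i, v)])) - (tens_map 0 D id (coprod (gen [(i, v)])) + tens_map (-1) id D (coprod (gen [(i, v)]))) \<in> sym_rel2 sc V"
    using D gen_free_sp[OF w] by (auto simp: coderivation_def)
  ultimately show "coprod (D (gen [(i, v)])) \<in> sym_rel2 sc V"
    by (simp add: fl_simps[OF flinear_tens_map])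
qed

lemma sym_maps_zero_letter:
  assumes V: "graded_vs sc V" and V': "graded_vs sc' V'" and q: "sym_maps sc V sc' V' e q"
    and w: "w \<in> words V" and z: "(i, 0) \<in> set w"
  shows "q w = 0"
proof -
  obtain xs ys where "w = xs @ (i, 0) # ys" using z by (meson split_list)
  then show ?thesis
    using sym_mapsD(3)[OF q, of xs ys 0 i 0] w graded_vs_in[OF V]
    by (simp add: words_iff vector_space_simps graded_vs_in(1)[OF V'])
qed

theorem lemma3p11:
  fixes n :: enat
    and sc :: "'k::field_char_0 \<Rightarrow> 'v::ab_group_add \<Rightarrow> 'v"
    and sc' :: "'k \<Rightarrow> 'w::ab_group_add \<Rightarrow> 'w"
    and L :: "int \<Rightarrow> 'v set" and L' :: "int \<Rightarrow> 'w set"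
    and l :: "'v word \<Rightarrow> 'v" and l' :: "'w word \<Rightarrow> 'w"
    and f :: "'v word \<Rightarrow> 'w"
  assumes "Lie_n_fibration n sc L l sc' L' l' f"
  shows "\<exists>lt \<phi> g.
    Lie_n_algebra n sc L lt \<and>
    Linf_isomorphism sc L lt sc L l \<phi> \<and>
    Linf_composite sc L sc L sc' L' f \<phi> g \<and>
    Lie_n_fibration n sc L lt sc' L' l' g \<and>
    strict L g \<and>
    (\<forall>i. \<forall>x \<in> L i. g [(i, x)] = f [(i, x)])"
proof -
  let ?V = "susp L" and ?V' = "susp L'"
  from assms have algL: "Linf_algebra sc L l" and algL': "Linf_algebra sc' L' l'"
    and dimL: "\<And>i. \<not> (0 \<le> i \<and> enat (nat i) < n) \<Longrightarrow> L i = {0}"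
    and dimL': "\<And>i. \<not> (0 \<le> i \<and> enat (nat i) < n) \<Longrightarrow> L' i = {0}"
    and skewf: "skew_maps sc L sc' L' (\<lambda>k. int k - 1) f"
    and surj: "\<And>i. 0 < i \<Longrightarrow> (\<lambda>x. f [(i, x)]) ` L i = L' i"
    unfolding Lie_n_fibration_def Lie_n_algebra_def Linf_morphism_def by blast+
  from assms obtain D D' F where D: "coder_of sc L l D" and D': "coder_of sc' L' l' D'"
    and F: "coalg_hom_of sc L sc' L' f F"
    and FD: "\<And>x. x \<in> free_sp ?V \<Longrightarrow> F (D x) - D' (F x) \<in> sym_rel sc' ?V'"
    unfolding Lie_n_fibration_def Linf_morphism_def by blast
  from algL obtain D0 where gL: "graded_vs sc L" and skewl: "skew_maps sc L sc L (\<lambda>k. int k - 2) l"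
    and D0: "coder_of sc L l D0" and D00: "\<And>x. x \<in> free_sp ?V \<Longrightarrow> D0 (D0 x) \<in> sym_rel sc ?V"
    unfolding Linf_algebra_def by blast
  from algL' have gL': "graded_vs sc' L'" unfolding Linf_algebra_def by blast
  note V = graded_vs_susp[OF gL] and V' = graded_vs_susp[OF gL']
  note vs = graded_vs_in(1)[OF gL] and vs' = graded_vs_in(1)[OF gL']
  note fs' = skew_mapsD[OF skewf vs']
  have f_add: "f [(i, a + b)] = f [(i, a)] + f [(i, b)]" if "a \<in> L i" "b \<in> L i" for i a b
    using fs'(2)[of "[]" "[]" a i b] that by simp
  have f_scale: "f [(i, sc c a)] = sc' c (f [(i, a)])" if "a \<in> L i" for i a c
    using fs'(3)[of "[]" "[]" a i c] that by simp
  obtain \<sigma> where \<sigma>: "\<And>i y. y \<in> L' i \<Longrightarrow> \<sigma> i y \<in> L i" "\<And>i y. 0 < i \<Longrightarrow> y \<in> L' i \<Longrightarrow> f [(i, \<sigma> i y)] = y"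
    and lin\<sigma>: "\<And>i. Vector_Spaces.linear sc' sc (\<sigma> i)"
    by (rule graded_section[OF gL gL', of "\<lambda>i x. f [(i, x)]"]) (use f_add f_scale surj in auto)
  have \<sigma>_simps: "\<sigma> i (y + z) = \<sigma> i y + \<sigma> i z" "\<sigma> i (sc' c y) = sc c (\<sigma> i y)" for i y z c
    using lin\<sigma>[of i] by (simp_all add: Vector_Spaces.linear_iff)
  have \<sigma>_0: "\<sigma> i 0 = 0" for i using \<sigma>_simps(1)[of i 0 0] by simp
  have \<sigma>_signed: "\<sigma> i (signed m y) = signed m (\<sigma> i y)" for i m y
    by (simp add: sc_signed[OF vs, symmetric] sc_signed[OF vs', symmetric] \<sigma>_simps)

  \<comment> \<open>The components of the fibration on the suspension\<close>
  define qf where "qf = decalage sc' f"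
  have symf: "sym_maps sc ?V sc' ?V' 0 qf"
    unfolding qf_def by (rule sym_maps_decalage[OF gL' skewf]) simp
  have qf_letter: "qf [(i, v)] = f [(i - 1, v)]" for i v
    by (simp add: qf_def decalage_eq[OF vs'] decalage_parity_def)
  \<comment> \<open>The suspension lives in degrees at least 1, so a word of two or more nonzero
    letters has degree at least 2. Zero letters may carry any degree, so a word of lower degree
    contains one and multilinearity kills it.\<close>
  have qf_low: "qf w = 0" if w: "w \<in> words ?V" and len: "length w \<noteq> 1" and deg: "wdeg w \<le> 1" for w
  proof -
    have "\<exists>(i, v)\<in>set w. i \<le> 0"
    proof (rule ccontr)
      assume "\<not> ?thesis"
      then have "\<forall>x\<in>set w. 1 \<le> fst x" by force
      then have "int (length w) \<le> wdeg w" by (induction w) auto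
      moreover have "length w \<noteq> 0" using w by (simp add: words_iff)
      ultimately show False using len deg by linarith
    qed
    then obtain i v where iv: "(i, v) \<in> set w" "i \<le> 0" by blast
    then have "v \<in> L (i - 1)" using w by (auto simp: words_def hlists_def susp_def)
    then have "v = 0" using dimL[of "i - 1"] iv by simp
    then show ?thesis using sym_maps_zero_letter[OF V V' symf w] iv by simp
  qed

  \<comment> \<open>The coalgebra automorphism and its inverse\<close>
  define \<psi> where "\<psi> w = (if length w = 1 then snd (hd w) else \<sigma> (wdeg w - 1) (qf w))" for w
  \<comment> \<open>\<open>wdeg w\<close> is a suspended degree, one more than the degree in
    \<open>L'\<close>; hence the index of \<open>\<sigma>\<close> in \<open>\<psi>\<close>.\<close>
  have qf_in: "qf w \<in> L' (wdeg w - 1)" if "w \<in> words ?V" for w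
    using sym_mapsD(1)[OF symf that] by (simp add: susp_def)
  have sym\<psi>: "sym_maps sc ?V sc ?V 0 \<psi>"
  proof (rule sym_mapsI)
    fix w assume w: "w \<in> words ?V"
    show "\<psi> w \<in> ?V (wdeg w + 0)"
    proof (cases "length w = 1")
      case True
      then obtain i v where "w = [(i, v)]" by (auto simp: length_Suc_conv)
      with w show ?thesis by (simp add: \<psi>_def words_iff)
    next
      case False
      then show ?thesis using \<sigma>(1)[OF qf_in[OF w]] by (simp add: \<psi>_def susp_def)
    qed
  next
    fix xs ys i a
    assume h: "xs \<in> hlists ?V" "ys \<in> hlists ?V" "a \<in> ?V i"
    show "\<psi> (xs @ (i, a + b) # ys) = \<psi> (xs @ (i, a) # ys) + \<psi> (xs @ (i, b) # ys)" if b: "b \<in> ?V i" for b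
      using sym_mapsD(2)[OF symf h b] by (auto simp: \<psi>_def \<sigma>_simps)
    show "\<psi> (xs @ (i, sc c a) # ys) = sc c (\<psi> (xs @ (i, a) # ys))" for c
      using sym_mapsD(3)[OF symf h, of c] by (auto simp: \<psi>_def \<sigma>_simps)
    fix j b assume "b \<in> ?V j"
    from sym_mapsD(4)[OF symf h this]
    show "\<psi> (xs @ (i, a) # (j, b) # ys) = signed (i * j) (\<psi> (xs @ (j, b) # (i, a) # ys))"
      by (simp add: \<psi>_def \<sigma>_signed algebra_simps)
  qed
  define \<Psi> :: "('v word \<Rightarrow>\<^sub>0 'k) \<Rightarrow> ('v word \<Rightarrow>\<^sub>0 'k)" where "\<Psi> = ext_hom \<psi>"
  have \<Psi>: "coalg_hom sc ?V sc ?V \<Psi>" unfolding \<Psi>_def by (rule coalg_hom_ext_hom[OF V V sym\<psi>])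
  note s\<Psi> = coalg_hom_sym_hom[OF \<Psi>]
  have \<psi>_letter: "\<psi> [x] = snd x" for x by (simp add: \<psi>_def)
  obtain \<Phi> where lin\<Phi>: "flinear \<Phi>" and \<Psi>\<Phi>: "\<And>x. \<Psi> (\<Phi> x) = x" and \<Phi>\<Psi>: "\<And>x. \<Phi> (\<Psi> x) = x"
    and stable: "\<And>S x. fs.subspace S \<Longrightarrow> (\<And>y. y \<in> S \<Longrightarrow> \<Psi> y \<in> S) \<Longrightarrow> x \<in> S \<Longrightarrow> \<Phi> x \<in> S"
    by (rule unipotent_inverse[of \<Psi>])
      (use ext_word_unipotent[of \<psi>, OF \<psi>_letter] in \<open>auto simp: \<Psi>_def flinear_ext_hom\<close>)
  \<comment> \<open>Degrees and relations are subspaces stable under \<open>\<Psi>\<close>, so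
    \<open>stable\<close> passes both to the inverse.\<close>
  have s\<Phi>: "sym_hom sc ?V sc ?V 0 \<Phi>"
    unfolding sym_hom_def
  proof (intro conjI allI ballI lin\<Phi>)
    show "\<Phi> x \<in> free_deg ?V (d + 0)" if "x \<in> free_deg ?V d" for d x
      using stable[OF subspace_free_deg _ that] sym_homD(2)[OF s\<Psi>] by simp
    show "\<Phi> x \<in> sym_rel sc ?V" if "x \<in> sym_rel sc ?V" for x
      using stable[OF subspace_sym_rel _ that] sym_homD(3)[OF s\<Psi>] by simp
  qed
  have \<Phi>: "coalg_hom sc ?V sc ?V \<Phi>"
    by (rule coalg_hom_inverse[OF V V \<Psi> s\<Phi> \<Psi>\<Phi> \<Phi>\<Psi>])
  have \<Psi>_letter: "\<Psi> (gen [x]) = gen [x]" for x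
    by (simp add: \<Psi>_def ext_word.simps \<psi>_letter)
  have \<Phi>_letter: "\<Phi> (gen [x]) = gen [x]" for x
    using \<Phi>\<Psi>[of "gen [x]"] by (simp add: \<Psi>_letter)

  \<comment> \<open>The transported differential\<close>
  have cD: "coderivation sc ?V D" and cD0: "coderivation sc ?V D0"
    using D D0 by (auto simp: coder_of_def)
  have sD: "sym_hom sc ?V sc ?V (-1) D" and sD0: "sym_hom sc ?V sc ?V (-1) D0"
    using cD cD0 by (auto simp: coderivation_def)
  \<comment> \<open>The morphism provides \<open>D\<close>, whereas the square-zero condition is
    known for the possibly different representative \<open>D0\<close>. Having the same components,
    they agree modulo relations, and the condition carries over to \<open>D\<close>.\<close>
  have DD0: "D x - D0 x \<in> sym_rel sc ?V" if "x \<in> free_sp ?V" for x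
    by (rule coderivation_unique[OF V cD cD0 _ that]) (use D D0 in \<open>auto simp: coder_of_def\<close>)
  have DD: "D (D x) \<in> sym_rel sc ?V" if x: "x \<in> free_sp ?V" for x
  proof -
    have "D (D x - D0 x) + (D (D0 x) - D0 (D0 x)) + D0 (D0 x) \<in> sym_rel sc ?V"
      by (intro fs.subspace_add[OF subspace_sym_rel] sym_homD(3)[OF sD] DD0 D00 x sym_hom_free_sp[OF sD0])
    then show ?thesis by (simp add: fl_simps[OF sym_homD(1)[OF sD]])
  qed
  define Dt where "Dt x = \<Psi> (D (\<Phi> x))" for x
  have cDt: "coderivation sc ?V Dt"
    unfolding Dt_def by (rule coderivation_conjugate[OF V V cD \<Psi> \<Phi> \<Psi>\<Phi>])
  then have sDt: "sym_hom sc ?V sc ?V (-1) Dt" by (simp add: coderivation_def)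
  define lt where "lt = undecalage (\<lambda>w. pr1 sc (Dt (gen w)))"
  define \<phi> where "\<phi> = undecalage (\<lambda>w. pr1 sc (\<Phi> (gen w)))"
  define g where "g w = (if length w = 1 then f w else 0)" for w
  have coder_lt: "coder_of sc L lt Dt"
    unfolding coder_of_def lt_def by (simp add: cDt decalage_undecalage[OF vs])
  have hom_\<phi>: "coalg_hom_of sc L sc L \<phi> \<Phi>"
    unfolding coalg_hom_of_def \<phi>_def by (simp add: \<Phi> decalage_undecalage[OF vs])
  have skew_\<phi>: "skew_maps sc L sc L (\<lambda>k. int k - 1) \<phi>"
    unfolding \<phi>_def by (rule skew_maps_undecalage[OF gL sym_maps_hom[OF V V s\<Phi>]]) simp
  have alg_lt: "Linf_algebra sc L lt"
    unfolding Linf_algebra_def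
  proof (intro conjI exI[of _ Dt] ballI gL coder_lt)
    show "skew_maps sc L sc L (\<lambda>k. int k - 2) lt"
      unfolding lt_def by (rule skew_maps_undecalage[OF gL sym_maps_hom[OF V V sDt]]) simp
    show "Dt (Dt x) \<in> sym_rel sc ?V" if "x \<in> free_sp ?V" for x
      using sym_homD(3)[OF s\<Psi> DD[OF sym_hom_free_sp[OF s\<Phi> that]]] by (simp add: Dt_def \<Phi>\<Psi>)
  qed
  have "Linf_morphism sc L lt sc L l \<phi>"
    unfolding Linf_morphism_def
    by (intro conjI exI[of _ Dt] exI[of _ D] exI[of _ \<Phi>] alg_lt algL skew_\<phi> coder_lt D hom_\<phi>)
      (simp add: Dt_def \<Phi>\<Psi> fs.subspace_0[OF subspace_sym_rel])
  moreover have \<phi>_letter: "\<phi> [(i, x)] = x" for i x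
    by (simp add: \<phi>_def undecalage_def \<Phi>_letter pr1_gen[OF vs] decalage_parity_def)
  \<comment> \<open>\<open>D\<close> sends a letter to a letter modulo relations and
    \<open>\<Psi>\<close> fixes letters, so conjugation leaves the differential unchanged. With
    \<open>\<phi>\<close> the identity on letters, this makes its linear part an isomorphism of
    complexes.\<close>
  moreover have lt_letter: "lt [(i, x)] = l [(i, x)]" if x: "x \<in> L i" for i x
  proof -
    let ?w = "[(i + 1, x)]"
    have w: "?w \<in> words ?V" using x by (simp add: words_iff susp_def)
    have "\<Psi> (D (gen ?w) - gen [(i + 1 - 1, pr1 sc (D (gen ?w)))]) \<in> sym_rel sc ?V"
      by (rule sym_homD(3)[OF s\<Psi> coderivation_letter[OF V cD]]) (use x in \<open>simp add: susp_def\<close>)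
    then have "pr1 sc (\<Psi> (D (gen ?w))) = pr1 sc (D (gen ?w))"
      using pr1_sym_rel[OF vs] by (fastforce simp: fl_simps[OF sym_homD(1)[OF s\<Psi>]] \<Psi>_letter pr1_simps[OF vs] pr1_gen[OF vs])
    also have "\<dots> = decalage sc l ?w" using D w by (simp add: coder_of_def)
    also have "\<dots> = l [(i, x)]" by (simp add: decalage_eq[OF vs] decalage_parity_def)
    finally show ?thesis by (simp add: lt_def undecalage_def Dt_def \<Phi>_letter decalage_parity_def)
  qed
  ultimately have iso: "Linf_isomorphism sc L lt sc L l \<phi>"
    unfolding Linf_isomorphism_def by (auto simp: bij_betw_def inj_on_def)

  \<comment> \<open>The strict morphism and its identification with the composite\<close>
  have skew_g: "skew_maps sc L sc' L' (\<lambda>k. int k - 1) g"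
  proof (rule skew_mapsI[OF vs'])
    show "g w \<in> L' (wdeg w + (int (length w) - 1))" if "w \<in> words L" for w
      using fs'(1)[OF that] graded_vs_in(2)[OF gL'] by (cases "length w = 1") (simp_all add: g_def)
  next
    fix xs ys i a
    assume h: "xs \<in> hlists L" "ys \<in> hlists L" "a \<in> L i"
    show "g (xs @ (i, a + b) # ys) = g (xs @ (i, a) # ys) + g (xs @ (i, b) # ys)" if "b \<in> L i" for b
      using fs'(2)[OF h that] by (auto simp: g_def)
    show "g (xs @ (i, sc c a) # ys) = sc' c (g (xs @ (i, a) # ys))" for c
      using fs'(3)[OF h, of c] by (auto simp: g_def vector_space_simps[OF vs'])
    show "g (xs @ (i, a) # (j, b) # ys) = signed (1 + i * j) (g (xs @ (j, b) # (i, a) # ys))" for j b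
      by (simp add: g_def)
  qed
  define qg where "qg = decalage sc' g"
  have symg: "sym_maps sc ?V sc' ?V' 0 qg"
    unfolding qg_def by (rule sym_maps_decalage[OF gL' skew_g]) simp
  have qg_letter: "qg [(i, v)] = f [(i - 1, v)]" for i v
    by (simp add: qg_def decalage_eq[OF vs'] decalage_parity_def g_def)
  have qg_strict: "qg w = 0" if "length w \<noteq> 1" for w
    using that by (simp add: qg_def decalage_eq[OF vs'] g_def)
  define G :: "('v word \<Rightarrow>\<^sub>0 'k) \<Rightarrow> ('w word \<Rightarrow>\<^sub>0 'k)" where "G = ext_hom qg"
  have G: "coalg_hom sc ?V sc' ?V' G" unfolding G_def by (rule coalg_hom_ext_hom[OF V V' symg])
  have cF: "coalg_hom sc ?V sc' ?V' F" using F by (simp add: coalg_hom_of_def)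
  note sF = coalg_hom_sym_hom[OF cF]
  \<comment> \<open>By uniqueness only components need comparing: the linear part of
    \<open>G (\<Psi> (gen w))\<close> is \<open>f\<close> applied to the single letter
    \<open>\<psi> w\<close>.\<close>
  have FG: "F x - G (\<Psi> x) \<in> sym_rel sc' ?V'" if x: "x \<in> free_sp ?V" for x
  proof (rule coalg_hom_unique[OF V' cF coalg_hom_compose[OF V \<Psi> G] _ x])
    fix w assume w: "w \<in> words ?V"
    have w0: "w \<noteq> []" using w by (simp add: words_iff)
    have "pr1 sc' (G (\<Psi> (gen w))) = qg [(wdeg w, pr1 sc (\<Psi> (gen w)))]"
      unfolding G_def
      by (rule pr1_ext_hom_strict[OF V V' symg qg_strict])
        (use sym_homD(2)[OF s\<Psi> gen_free_deg[OF w refl]] in auto)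
    also have "\<dots> = f [(wdeg w - 1, \<psi> w)]"
      by (simp add: qg_letter \<Psi>_def pr1_ext_word[OF vs w0])
    also have "\<dots> = qf w"
    proof (cases "length w = 1")
      case True
      then obtain i v where "w = [(i, v)]" by (auto simp: length_Suc_conv)
      then show ?thesis by (simp add: \<psi>_letter qf_letter)
    next
      case False
      show ?thesis
      \<comment> \<open>In positive degree \<open>\<sigma>\<close> is a section; otherwise
        \<open>qf w\<close> vanishes by \<open>qf_low\<close> and both sides are zero.\<close>
      proof (cases "0 < wdeg w - 1")
        case True
        with False show ?thesis using \<sigma>(2)[OF True qf_in[OF w]] by (simp add: \<psi>_def)
      next
        case low: False
        have "f [(wdeg w - 1, 0)] = 0"
          using f_add[of 0 "wdeg w - 1" 0] graded_vs_in(2)[OF gL] by simp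
        with False low show ?thesis using qf_low[OF w] by (simp add: \<psi>_def \<sigma>_0)
      qed
    qed
    finally show "pr1 sc' (F (gen w)) = pr1 sc' (G (\<Psi> (gen w)))"
      using F w by (simp add: coalg_hom_of_def qf_def)
  qed
  have hom_g: "coalg_hom_of sc L sc' L' g (F \<circ> \<Phi>)"
    unfolding coalg_hom_of_def
  proof (intro conjI ballI)
    show "coalg_hom sc ?V sc' ?V' (F \<circ> \<Phi>)"
      using coalg_hom_compose[OF V \<Phi> cF] by (simp add: o_def)
    fix w assume w: "w \<in> words ?V"
    have "F (\<Phi> (gen w)) - G (gen w) \<in> sym_rel sc' ?V'"
      using FG[OF sym_hom_free_sp[OF s\<Phi> gen_free_sp[OF w]]] by (simp add: \<Psi>\<Phi>)
    then have "pr1 sc' (F (\<Phi> (gen w))) = pr1 sc' (G (gen w))"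
      using pr1_sym_rel[OF vs'] by (fastforce simp: pr1_simps[OF vs'])
    then show "pr1 sc' ((F \<circ> \<Phi>) (gen w)) = decalage sc' g w"
      using w by (simp add: G_def pr1_ext_word[OF vs'] words_iff qg_def)
  qed
  have comp: "Linf_composite sc L sc L sc' L' f \<phi> g"
    unfolding Linf_composite_def using F hom_\<phi> hom_g by blast
  \<comment> \<open>Since \<open>\<Phi>\<close> cancels \<open>\<Psi>\<close> exactly,
    \<open>\<Phi> (Dt x)\<close> equals \<open>D (\<Phi> x)\<close>, and the morphism property of
    \<open>F\<close> at \<open>\<Phi> x\<close> is what remains.\<close>
  have "F (\<Phi> (Dt x)) - D' (F (\<Phi> x)) \<in> sym_rel sc' ?V'" if "x \<in> free_sp ?V" for x
    using FD[OF sym_hom_free_sp[OF s\<Phi> that]] by (simp add: Dt_def \<Phi>\<Psi>)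
  then have "Linf_morphism sc L lt sc' L' l' g"
    unfolding Linf_morphism_def
    by (intro conjI exI[of _ Dt] exI[of _ D'] exI[of _ "F \<circ> \<Phi>"] alg_lt algL' skew_g coder_lt D' hom_g) simp
  moreover have alg: "Lie_n_algebra n sc L lt"
    unfolding Lie_n_algebra_def using alg_lt dimL by blast
  ultimately have "Lie_n_fibration n sc L lt sc' L' l' g"
    using assms surj by (simp add: Lie_n_fibration_def g_def)
  moreover have "strict L g" by (simp add: strict_def g_def)
  moreover have "\<forall>i. \<forall>x\<in>L i. g [(i, x)] = f [(i, x)]" by (simp add: g_def)
  ultimately show ?thesis using alg iso comp by blast
qed

end
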